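(* Let $\kappa$ and $\lambda$ be regular cardinals such that $\gamma<\kappa\Rightarrow 2^{\gamma}<\lambda$, and let $\mathcal{D}$ be a $\lambda$-geometric category such that 1. $\mathcal{D}$ has products of size $<\kappa$; 2. for any object $x$, in $\mathrm{Sub}_{\mathcal{D}}(x)$ the $<\kappa$ meets distribute over binary unions; 3. if $(f_i:x_i\to y_i)_{i<\gamma}$, $\gamma<\kappa$, are effective epimorphisms then $\prod_i f_i:\prod_i x_i\to\prod_i y_i$ is an effective epimorphism; 4. the product of $<\kappa$-many non-initial objects is non-initial; 5. $\mathcal{D}$ has filtered colimits of size $<\lambda$, which commute with finite limits; 6. $\mathcal{D}$ is weakly Boolean. Then for any coherent category $\mathcal{C}$, the class $\mathbf{Coh}(\mathcal{C},\mathcal{D})$ of coherent functors is closed under $<\kappa$ ultraproducts in $\mathcal{D}^{\mathcal{C}}$, i.e. for every set $I$ with $|I|<\kappa$, every ultrafilter $U$ on $I$ and all coherent functors $F_i:\mathcal{C}\to\mathcal{D}$ $(i\in I)$, the functor $\left(\prod_{i\in I}F_i\right)/U$ is coherent. Moreover, for such $I$ and $U$, given subobjects $A_i\hookrightarrow X_i\hookleftarrow B_i$ in $\mathcal{D}$ $(i\in I)$: $$\Big(\prod_{I}A_i\Big)/U\subseteq\Big(\prod_{I}B_i\Big)/U\quad\text{iff}\quad\{i\in I:A_i\subseteq B_i\}\in U .$$ (The inclusion is between subobjects of $(\prod_I X_i)/U$.)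
   Context: A $\lambda$-geometric category is a coherent category with pullback-stable unions of fewer than $\lambda$ subobjects. Ultraproducts: for objects $(D_i)_{i\in I}$ and an ultrafilter $U\subseteq\mathcal{P}(I)$, the ultraproduct is $(\prod_{i\in I}D_i)/U=\mathrm{colim}_{J\in U}\prod_{i\in J}D_i$, a filtered colimit taken over the projection maps $\prod_{J}D_i\to\prod_{J'}D_i$ for $J'\subseteq J$ in $U$. In $\mathcal{D}^{\mathcal{C}}$ ultraproducts are computed pointwise. Distributivity in 2 means: for $\gamma<\kappa$ and subobjects $a_{0,i},a_{1,i}\hookrightarrow x$ $(i<\gamma)$, $\bigcap_{i<\gamma}(a_{0,i}\cup a_{1,i})=\bigcup_{\varepsilon:\gamma\to\{0,1\}}\bigcap_{i<\gamma}a_{\varepsilon(i),i}$. A coherent category $\mathcal{D}$ is weakly Boolean if for any pair of subobjects $a\hookrightarrow x\hookleftarrow b$ either $a\le b$ or there is $\emptyset\neq u\le a$ with $u\cap b=\emptyset$ ($\emptyset$ the initial object). *)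

theory Defs
  imports Main "HOL-Library.FuncSet"
begin

unbundle cardinal_syntax

text \<open>
  Categories are carrier-based, with composition written in the order of application of functions:
  \<open>g \<cdot>\<^bsub>C\<^esub> f\<close> is "first \<open>f\<close>, then \<open>g\<close>". Universal objects (limits, colimits, unions, ...) are
  described by relations, since they are only determined up to isomorphism.
\<close>

section \<open>Categories and functors\<close>

record ('o, 'm) cat =
  Obj :: "'o set"
  Arr :: "'m set"
  Dom :: "'m \<Rightarrow> 'o"
  Cod :: "'m \<Rightarrow> 'o"
  Ident :: "'o \<Rightarrow> 'm"
  Comp :: "'m \<Rightarrow> 'm \<Rightarrow> 'm"  (infixr "\<cdot>\<index>" 70)

locale category =
  fixes C :: "('o, 'm) cat" (structure)
  assumes Dom_Obj: "f \<in> Arr C \<Longrightarrow> Dom C f \<in> Obj C"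
    and Cod_Obj: "f \<in> Arr C \<Longrightarrow> Cod C f \<in> Obj C"
    and Ident_Arr: "a \<in> Obj C \<Longrightarrow> Ident C a \<in> Arr C"
    and Dom_Ident: "a \<in> Obj C \<Longrightarrow> Dom C (Ident C a) = a"
    and Cod_Ident: "a \<in> Obj C \<Longrightarrow> Cod C (Ident C a) = a"
    and Comp_Arr: "\<lbrakk>f \<in> Arr C; g \<in> Arr C; Cod C f = Dom C g\<rbrakk> \<Longrightarrow> g \<cdot> f \<in> Arr C"
    and Dom_Comp: "\<lbrakk>f \<in> Arr C; g \<in> Arr C; Cod C f = Dom C g\<rbrakk> \<Longrightarrow> Dom C (g \<cdot> f) = Dom C f"
    and Cod_Comp: "\<lbrakk>f \<in> Arr C; g \<in> Arr C; Cod C f = Dom C g\<rbrakk> \<Longrightarrow> Cod C (g \<cdot> f) = Cod C g"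
    and Comp_Ident: "f \<in> Arr C \<Longrightarrow> f \<cdot> Ident C (Dom C f) = f"
    and Ident_Comp: "f \<in> Arr C \<Longrightarrow> Ident C (Cod C f) \<cdot> f = f"
    and Comp_assoc: "\<lbrakk>f \<in> Arr C; g \<in> Arr C; h \<in> Arr C; Cod C f = Dom C g; Cod C g = Dom C h\<rbrakk>
      \<Longrightarrow> h \<cdot> (g \<cdot> f) = (h \<cdot> g) \<cdot> f"

definition hom :: "('o, 'm) cat \<Rightarrow> 'o \<Rightarrow> 'o \<Rightarrow> 'm set" where
  "hom C a b = {f \<in> Arr C. Dom C f = a \<and> Cod C f = b}"

record ('o, 'm, 'p, 'n) fctr =
  FO :: "'o \<Rightarrow> 'p"
  FA :: "'m \<Rightarrow> 'n"

definition is_functor :: "('o, 'm) cat \<Rightarrow> ('p, 'n) cat \<Rightarrow> ('o, 'm, 'p, 'n) fctr \<Rightarrow> bool" where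
  "is_functor C D F \<longleftrightarrow> category C \<and> category D \<and>
     (\<forall>a\<in>Obj C. FO F a \<in> Obj D) \<and>
     (\<forall>f\<in>Arr C. FA F f \<in> hom D (FO F (Dom C f)) (FO F (Cod C f))) \<and>
     (\<forall>a\<in>Obj C. FA F (Ident C a) = Ident D (FO F a)) \<and>
     (\<forall>f\<in>Arr C. \<forall>g\<in>Arr C. Cod C f = Dom C g \<longrightarrow> FA F (g \<cdot>\<^bsub>C\<^esub> f) = FA F g \<cdot>\<^bsub>D\<^esub> FA F f)"

definition comp_fctr ::
    "('p, 'n, 'q, 'r) fctr \<Rightarrow> ('o, 'm, 'p, 'n) fctr \<Rightarrow> ('o, 'm, 'q, 'r) fctr" where
  "comp_fctr G F = \<lparr>FO = FO G \<circ> FO F, FA = FA G \<circ> FA F\<rparr>"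

definition prod_cat :: "('o, 'm) cat \<Rightarrow> ('p, 'n) cat \<Rightarrow> ('o \<times> 'p, 'm \<times> 'n) cat" where
  "prod_cat J K = \<lparr>Obj = Obj J \<times> Obj K, Arr = Arr J \<times> Arr K,
     Dom = map_prod (Dom J) (Dom K), Cod = map_prod (Cod J) (Cod K),
     Ident = map_prod (Ident J) (Ident K),
     Comp = (\<lambda>(g, g') (f, f'). (g \<cdot>\<^bsub>J\<^esub> f, g' \<cdot>\<^bsub>K\<^esub> f'))\<rparr>"

text \<open>The functors \<open>F(j, -)\<close> and \<open>F(-, k)\<close> for \<open>F\<close> defined on a product category \<open>J \<times> K\<close>.\<close>

definition fix_fst ::
    "('o, 'm) cat \<Rightarrow> ('o \<times> 'p, 'm \<times> 'n, 'q, 'r) fctr \<Rightarrow> 'o \<Rightarrow> ('p, 'n, 'q, 'r) fctr" where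
  "fix_fst J F j = \<lparr>FO = (\<lambda>k. FO F (j, k)), FA = (\<lambda>g. FA F (Ident J j, g))\<rparr>"

definition fix_snd ::
    "('p, 'n) cat \<Rightarrow> ('o \<times> 'p, 'm \<times> 'n, 'q, 'r) fctr \<Rightarrow> 'p \<Rightarrow> ('o, 'm, 'q, 'r) fctr" where
  "fix_snd K F k = \<lparr>FO = (\<lambda>j. FO F (j, k)), FA = (\<lambda>f. FA F (f, Ident K k))\<rparr>"


section \<open>Limits and colimits\<close>

definition is_iso :: "('o, 'm) cat \<Rightarrow> 'm \<Rightarrow> bool" where
  "is_iso C f \<longleftrightarrow> f \<in> Arr C \<and> (\<exists>g\<in>hom C (Cod C f) (Dom C f).
     g \<cdot>\<^bsub>C\<^esub> f = Ident C (Dom C f) \<and> f \<cdot>\<^bsub>C\<^esub> g = Ident C (Cod C f))"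

definition mono_arr :: "('o, 'm) cat \<Rightarrow> 'm \<Rightarrow> bool" where
  "mono_arr C m \<longleftrightarrow> m \<in> Arr C \<and> (\<forall>w. \<forall>f\<in>hom C w (Dom C m). \<forall>g\<in>hom C w (Dom C m).
     m \<cdot>\<^bsub>C\<^esub> f = m \<cdot>\<^bsub>C\<^esub> g \<longrightarrow> f = g)"

definition is_initial :: "('o, 'm) cat \<Rightarrow> 'o \<Rightarrow> bool" where
  "is_initial C z \<longleftrightarrow> z \<in> Obj C \<and> (\<forall>x\<in>Obj C. \<exists>!f. f \<in> hom C z x)"

definition is_cone ::
    "('p, 'n) cat \<Rightarrow> ('o, 'm) cat \<Rightarrow> ('p, 'n, 'o, 'm) fctr \<Rightarrow> 'o \<Rightarrow> ('p \<Rightarrow> 'm) \<Rightarrow> bool" where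
  "is_cone K D F l p \<longleftrightarrow> l \<in> Obj D \<and> (\<forall>k\<in>Obj K. p k \<in> hom D l (FO F k)) \<and>
     (\<forall>g\<in>Arr K. FA F g \<cdot>\<^bsub>D\<^esub> p (Dom K g) = p (Cod K g))"

definition is_limit ::
    "('p, 'n) cat \<Rightarrow> ('o, 'm) cat \<Rightarrow> ('p, 'n, 'o, 'm) fctr \<Rightarrow> 'o \<Rightarrow> ('p \<Rightarrow> 'm) \<Rightarrow> bool" where
  "is_limit K D F l p \<longleftrightarrow> is_cone K D F l p \<and>
     (\<forall>w r. is_cone K D F w r \<longrightarrow> (\<exists>!u. u \<in> hom D w l \<and> (\<forall>k\<in>Obj K. p k \<cdot>\<^bsub>D\<^esub> u = r k)))"

definition is_cocone ::
    "('p, 'n) cat \<Rightarrow> ('o, 'm) cat \<Rightarrow> ('p, 'n, 'o, 'm) fctr \<Rightarrow> 'o \<Rightarrow> ('p \<Rightarrow> 'm) \<Rightarrow> bool" where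
  "is_cocone K D F l q \<longleftrightarrow> l \<in> Obj D \<and> (\<forall>k\<in>Obj K. q k \<in> hom D (FO F k) l) \<and>
     (\<forall>g\<in>Arr K. q (Cod K g) \<cdot>\<^bsub>D\<^esub> FA F g = q (Dom K g))"

definition is_colimit ::
    "('p, 'n) cat \<Rightarrow> ('o, 'm) cat \<Rightarrow> ('p, 'n, 'o, 'm) fctr \<Rightarrow> 'o \<Rightarrow> ('p \<Rightarrow> 'm) \<Rightarrow> bool" where
  "is_colimit K D F l q \<longleftrightarrow> is_cocone K D F l q \<and>
     (\<forall>w r. is_cocone K D F w r \<longrightarrow> (\<exists>!u. u \<in> hom D l w \<and> (\<forall>k\<in>Obj K. u \<cdot>\<^bsub>D\<^esub> q k = r k)))"

definition is_product ::
    "('o, 'm) cat \<Rightarrow> 'i set \<Rightarrow> ('i \<Rightarrow> 'o) \<Rightarrow> 'o \<Rightarrow> ('i \<Rightarrow> 'm) \<Rightarrow> bool" where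
  "is_product D I x P p \<longleftrightarrow> P \<in> Obj D \<and> (\<forall>i\<in>I. p i \<in> hom D P (x i)) \<and>
     (\<forall>w\<in>Obj D. \<forall>r. (\<forall>i\<in>I. r i \<in> hom D w (x i)) \<longrightarrow>
        (\<exists>!u. u \<in> hom D w P \<and> (\<forall>i\<in>I. p i \<cdot>\<^bsub>D\<^esub> u = r i)))"

definition is_pullback :: "('o, 'm) cat \<Rightarrow> 'm \<Rightarrow> 'm \<Rightarrow> 'm \<Rightarrow> 'm \<Rightarrow> bool" where
  "is_pullback C f g p q \<longleftrightarrow>
     f \<in> Arr C \<and> g \<in> Arr C \<and> p \<in> Arr C \<and> q \<in> Arr C \<and> Cod C f = Cod C g \<and>
     Cod C p = Dom C f \<and> Cod C q = Dom C g \<and> Dom C p = Dom C q \<and> f \<cdot>\<^bsub>C\<^esub> p = g \<cdot>\<^bsub>C\<^esub> q \<and>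
     (\<forall>w. \<forall>r\<in>hom C w (Dom C f). \<forall>s\<in>hom C w (Dom C g). f \<cdot>\<^bsub>C\<^esub> r = g \<cdot>\<^bsub>C\<^esub> s \<longrightarrow>
        (\<exists>!u. u \<in> hom C w (Dom C p) \<and> p \<cdot>\<^bsub>C\<^esub> u = r \<and> q \<cdot>\<^bsub>C\<^esub> u = s))"

definition is_coequalizer :: "('o, 'm) cat \<Rightarrow> 'm \<Rightarrow> 'm \<Rightarrow> 'm \<Rightarrow> bool" where
  "is_coequalizer C p q e \<longleftrightarrow>
     p \<in> Arr C \<and> q \<in> Arr C \<and> e \<in> Arr C \<and> Dom C p = Dom C q \<and> Cod C p = Dom C e \<and>
     Cod C q = Dom C e \<and> e \<cdot>\<^bsub>C\<^esub> p = e \<cdot>\<^bsub>C\<^esub> q \<and>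
     (\<forall>w. \<forall>h\<in>hom C (Dom C e) w. h \<cdot>\<^bsub>C\<^esub> p = h \<cdot>\<^bsub>C\<^esub> q \<longrightarrow>
        (\<exists>!u. u \<in> hom C (Cod C e) w \<and> u \<cdot>\<^bsub>C\<^esub> e = h))"

text \<open>An effective epimorphism is a coequalizer of its own kernel pair.\<close>

definition effective_epi :: "('o, 'm) cat \<Rightarrow> 'm \<Rightarrow> bool" where
  "effective_epi C e \<longleftrightarrow> (\<exists>p q. is_pullback C e e p q \<and> is_coequalizer C p q e)"

text \<open>Every finite category is isomorphic to one whose objects and arrows are natural numbers.\<close>

definition has_finite_limits :: "('o, 'm) cat \<Rightarrow> bool" where
  "has_finite_limits D \<longleftrightarrow> (\<forall>(K :: (nat, nat) cat) F.
     finite (Arr K) \<and> is_functor K D F \<longrightarrow> (\<exists>l p. is_limit K D F l p))"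

definition preserves_finite_limits ::
    "('o, 'm) cat \<Rightarrow> ('p, 'n) cat \<Rightarrow> ('o, 'm, 'p, 'n) fctr \<Rightarrow> bool" where
  "preserves_finite_limits C D F \<longleftrightarrow> (\<forall>(K :: (nat, nat) cat) G l p.
     finite (Arr K) \<and> is_functor K C G \<and> is_limit K C G l p \<longrightarrow>
     is_limit K D (comp_fctr F G) (FO F l) (\<lambda>k. FA F (p k)))"

definition filtered :: "('o, 'm) cat \<Rightarrow> bool" where
  "filtered J \<longleftrightarrow> category J \<and> Obj J \<noteq> {} \<and>
     (\<forall>a\<in>Obj J. \<forall>b\<in>Obj J. \<exists>c f g. f \<in> hom J a c \<and> g \<in> hom J b c) \<and>
     (\<forall>a b. \<forall>f\<in>hom J a b. \<forall>g\<in>hom J a b. \<exists>c. \<exists>h\<in>hom J b c. h \<cdot>\<^bsub>J\<^esub> f = h \<cdot>\<^bsub>J\<^esub> g)"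

text \<open>
  For an infinite cardinal \<open>lam\<close> on \<open>'l\<close>, every category with fewer than \<open>lam\<close> arrows is isomorphic
  to one whose objects and arrows are elements of \<open>'l\<close>.
\<close>

definition has_filtered_colimits :: "'l rel \<Rightarrow> ('o, 'm) cat \<Rightarrow> bool" where
  "has_filtered_colimits lam D \<longleftrightarrow> (\<forall>(J :: ('l, 'l) cat) F.
     filtered J \<and> |Arr J| <o lam \<and> is_functor J D F \<longrightarrow> (\<exists>l q. is_colimit J D F l q))"

text \<open>
  In the following definition \<open>L = lim\<^sub>k F(-, k)\<close> is computed by the cones \<open>p j\<close>, and
  \<open>Q = colim\<^sub>j F(j, -)\<close> by the cocones \<open>q k\<close>. The arrow \<open>u\<close>, which is uniquely determined by the
  last equation, is the canonical comparison \<open>colim\<^sub>j lim\<^sub>k F(j, k) \<rightarrow> lim\<^sub>k colim\<^sub>j F(j, k)\<close>.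
\<close>

definition filtered_colimits_commute_with_finite_limits :: "'l rel \<Rightarrow> ('o, 'm) cat \<Rightarrow> bool" where
  "filtered_colimits_commute_with_finite_limits lam D \<longleftrightarrow>
     (\<forall>(J :: ('l, 'l) cat) (K :: (nat, nat) cat) F L p Q q M m N n u.
        filtered J \<and> |Arr J| <o lam \<and> category K \<and> finite (Arr K) \<and>
        is_functor (prod_cat J K) D F \<and>
        is_functor J D L \<and>
        (\<forall>j\<in>Obj J. is_limit K D (fix_fst J F j) (FO L j) (p j)) \<and>
        (\<forall>f\<in>Arr J. \<forall>k\<in>Obj K.
           p (Cod J f) k \<cdot>\<^bsub>D\<^esub> FA L f = FA F (f, Ident K k) \<cdot>\<^bsub>D\<^esub> p (Dom J f) k) \<and>
        is_functor K D Q \<and>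
        (\<forall>k\<in>Obj K. is_colimit J D (fix_snd K F k) (FO Q k) (q k)) \<and>
        (\<forall>g\<in>Arr K. \<forall>j\<in>Obj J.
           FA Q g \<cdot>\<^bsub>D\<^esub> q (Dom K g) j = q (Cod K g) j \<cdot>\<^bsub>D\<^esub> FA F (Ident J j, g)) \<and>
        is_colimit J D L M m \<and> is_limit K D Q N n \<and>
        u \<in> hom D M N \<and>
        (\<forall>j\<in>Obj J. \<forall>k\<in>Obj K. n k \<cdot>\<^bsub>D\<^esub> (u \<cdot>\<^bsub>D\<^esub> m j) = q k j \<cdot>\<^bsub>D\<^esub> p j k)
        \<longrightarrow> is_iso D u)"


section \<open>Subobjects\<close>

text \<open>
  Subobjects of \<open>x\<close> are represented by monomorphisms into \<open>x\<close>, preordered by factorization. Meets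
  and unions are greatest lower and least upper bounds; the meet of the empty set is \<open>x\<close> itself.
\<close>

definition Sub :: "('o, 'm) cat \<Rightarrow> 'o \<Rightarrow> 'm set" where
  "Sub C x = {m. mono_arr C m \<and> Cod C m = x}"

definition sub_le :: "('o, 'm) cat \<Rightarrow> 'o \<Rightarrow> 'm \<Rightarrow> 'm \<Rightarrow> bool" where
  "sub_le C x a b \<longleftrightarrow> a \<in> Sub C x \<and> b \<in> Sub C x \<and>
     (\<exists>h\<in>hom C (Dom C a) (Dom C b). a = b \<cdot>\<^bsub>C\<^esub> h)"

definition is_union :: "('o, 'm) cat \<Rightarrow> 'o \<Rightarrow> 'm set \<Rightarrow> 'm \<Rightarrow> bool" where
  "is_union C x S u \<longleftrightarrow> S \<subseteq> Sub C x \<and> u \<in> Sub C x \<and> (\<forall>a\<in>S. sub_le C x a u) \<and>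
     (\<forall>v\<in>Sub C x. (\<forall>a\<in>S. sub_le C x a v) \<longrightarrow> sub_le C x u v)"

definition is_meet :: "('o, 'm) cat \<Rightarrow> 'o \<Rightarrow> 'm set \<Rightarrow> 'm \<Rightarrow> bool" where
  "is_meet C x S u \<longleftrightarrow> S \<subseteq> Sub C x \<and> u \<in> Sub C x \<and> (\<forall>a\<in>S. sub_le C x u a) \<and>
     (\<forall>v\<in>Sub C x. (\<forall>a\<in>S. sub_le C x v a) \<longrightarrow> sub_le C x v u)"

text \<open>The subobject \<open>b\<close> of \<open>Dom f\<close> represents the pullback of the subobject \<open>a\<close> of \<open>Cod f\<close> along \<open>f\<close>.\<close>

definition is_preimage :: "('o, 'm) cat \<Rightarrow> 'm \<Rightarrow> 'm \<Rightarrow> 'm \<Rightarrow> bool" where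
  "is_preimage C f a b \<longleftrightarrow> (\<exists>q. is_pullback C f a b q)"

definition has_stable_unions :: "('m set \<Rightarrow> bool) \<Rightarrow> ('o, 'm) cat \<Rightarrow> bool" where
  "has_stable_unions small C \<longleftrightarrow> (\<forall>x\<in>Obj C. \<forall>S\<subseteq>Sub C x. small S \<longrightarrow>
     (\<exists>u. is_union C x S u) \<and>
     (\<forall>u y f v. is_union C x S u \<and> f \<in> hom C y x \<and> is_preimage C f u v \<longrightarrow>
        is_union C y {b. \<exists>a\<in>S. is_preimage C f a b} v))"


section \<open>Coherent categories and functors\<close>

definition coherent_category :: "('o, 'm) cat \<Rightarrow> bool" where
  "coherent_category C \<longleftrightarrow> category C \<and> has_finite_limits C \<and>
     (\<forall>f\<in>Arr C. \<exists>e m. effective_epi C e \<and> mono_arr C m \<and> Cod C e = Dom C m \<and> f = m \<cdot>\<^bsub>C\<^esub> e) \<and>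
     (\<forall>e f p q. effective_epi C e \<and> is_pullback C f e p q \<longrightarrow> effective_epi C p) \<and>
     has_stable_unions finite C"

definition coherent_functor ::
    "('o, 'm) cat \<Rightarrow> ('p, 'n) cat \<Rightarrow> ('o, 'm, 'p, 'n) fctr \<Rightarrow> bool" where
  "coherent_functor C D F \<longleftrightarrow> is_functor C D F \<and> preserves_finite_limits C D F \<and>
     (\<forall>e. effective_epi C e \<longrightarrow> effective_epi D (FA F e)) \<and>
     (\<forall>x\<in>Obj C. \<forall>S u. finite S \<and> is_union C x S u \<longrightarrow>
        is_union D (FO F x) (FA F ` S) (FA F u))"

definition geometric_category :: "'l rel \<Rightarrow> ('o, 'm) cat \<Rightarrow> bool" where
  "geometric_category lam D \<longleftrightarrow> coherent_category D \<and> has_stable_unions (\<lambda>S. |S| <o lam) D"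

definition weakly_Boolean :: "('o, 'm) cat \<Rightarrow> bool" where
  "weakly_Boolean D \<longleftrightarrow> (\<forall>x\<in>Obj D. \<forall>a\<in>Sub D x. \<forall>b\<in>Sub D x.
     sub_le D x a b \<or>
     (\<exists>u m. sub_le D x u a \<and> \<not> is_initial D (Dom D u) \<and>
        is_meet D x {u, b} m \<and> is_initial D (Dom D m)))"


section \<open>Conditions on products and meets of size less than \<open>\<kappa>\<close>\<close>

text \<open>
  Up to bijection, the index sets of size less than \<open>\<kappa> :: 'k rel\<close> are the sets \<open>I :: 'k set\<close> with
  \<open>|I| <o \<kappa>\<close>.
\<close>

definition has_small_products :: "'k rel \<Rightarrow> ('o, 'm) cat \<Rightarrow> bool" where
  "has_small_products \<kappa> D \<longleftrightarrow> (\<forall>(I :: 'k set) x.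
     |I| <o \<kappa> \<and> (\<forall>i\<in>I. x i \<in> Obj D) \<longrightarrow> (\<exists>P p. is_product D I x P p))"

definition small_meets_distribute :: "'k rel \<Rightarrow> ('o, 'm) cat \<Rightarrow> bool" where
  "small_meets_distribute \<kappa> D \<longleftrightarrow> (\<forall>x\<in>Obj D. \<forall>(I :: 'k set) (a :: bool \<Rightarrow> 'k \<Rightarrow> 'm) u m n.
     |I| <o \<kappa> \<and>
     (\<forall>i\<in>I. is_union D x {a False i, a True i} (u i)) \<and>
     is_meet D x (u ` I) m \<and>
     (\<forall>\<epsilon> \<in> I \<rightarrow>\<^sub>E UNIV. is_meet D x ((\<lambda>i. a (\<epsilon> i) i) ` I) (n \<epsilon>))
     \<longrightarrow> is_union D x (n ` (I \<rightarrow>\<^sub>E UNIV)) m)"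

definition small_products_preserve_effective_epis :: "'k rel \<Rightarrow> ('o, 'm) cat \<Rightarrow> bool" where
  "small_products_preserve_effective_epis \<kappa> D \<longleftrightarrow> (\<forall>(I :: 'k set) f P p Q q t.
     |I| <o \<kappa> \<and> (\<forall>i\<in>I. effective_epi D (f i)) \<and>
     is_product D I (\<lambda>i. Dom D (f i)) P p \<and> is_product D I (\<lambda>i. Cod D (f i)) Q q \<and>
     t \<in> hom D P Q \<and> (\<forall>i\<in>I. q i \<cdot>\<^bsub>D\<^esub> t = f i \<cdot>\<^bsub>D\<^esub> p i)
     \<longrightarrow> effective_epi D t)"

definition small_products_of_noninitial :: "'k rel \<Rightarrow> ('o, 'm) cat \<Rightarrow> bool" where
  "small_products_of_noninitial \<kappa> D \<longleftrightarrow> (\<forall>(I :: 'k set) x P p.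
     |I| <o \<kappa> \<and> is_product D I x P p \<and> (\<forall>i\<in>I. \<not> is_initial D (x i)) \<longrightarrow> \<not> is_initial D P)"


section \<open>Ultraproducts\<close>

text \<open>
  Products and filtered colimits are chosen here, so that ultraproducts become functions; the choices
  are meaningful whenever the respective universal objects exist.
\<close>

definition is_ultrafilter :: "'i set \<Rightarrow> 'i set set \<Rightarrow> bool" where
  "is_ultrafilter I U \<longleftrightarrow> U \<subseteq> Pow I \<and> I \<in> U \<and> {} \<notin> U \<and>
     (\<forall>A\<in>U. \<forall>B\<in>U. A \<inter> B \<in> U) \<and> (\<forall>A\<in>U. \<forall>B. A \<subseteq> B \<and> B \<subseteq> I \<longrightarrow> B \<in> U) \<and>
     (\<forall>A\<subseteq>I. A \<in> U \<or> I - A \<in> U)"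

definition prod_cone :: "('o, 'm) cat \<Rightarrow> 'i set \<Rightarrow> ('i \<Rightarrow> 'o) \<Rightarrow> 'o \<times> ('i \<Rightarrow> 'm)" where
  "prod_cone D J x = (SOME (P, p). is_product D J x P p)"

definition prod_obj :: "('o, 'm) cat \<Rightarrow> 'i set \<Rightarrow> ('i \<Rightarrow> 'o) \<Rightarrow> 'o" where
  "prod_obj D J x = fst (prod_cone D J x)"

definition prod_proj :: "('o, 'm) cat \<Rightarrow> 'i set \<Rightarrow> ('i \<Rightarrow> 'o) \<Rightarrow> 'i \<Rightarrow> 'm" where
  "prod_proj D J x = snd (prod_cone D J x)"

definition prod_map ::
    "('o, 'm) cat \<Rightarrow> 'i set \<Rightarrow> ('i \<Rightarrow> 'o) \<Rightarrow> ('i \<Rightarrow> 'o) \<Rightarrow> ('i \<Rightarrow> 'm) \<Rightarrow> 'm" where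
  "prod_map D J x y f = (THE t. t \<in> hom D (prod_obj D J x) (prod_obj D J y) \<and>
     (\<forall>i\<in>J. prod_proj D J y i \<cdot>\<^bsub>D\<^esub> t = f i \<cdot>\<^bsub>D\<^esub> prod_proj D J x i))"

definition prod_restrict :: "('o, 'm) cat \<Rightarrow> 'i set \<Rightarrow> 'i set \<Rightarrow> ('i \<Rightarrow> 'o) \<Rightarrow> 'm" where
  "prod_restrict D J J' x = (THE t. t \<in> hom D (prod_obj D J x) (prod_obj D J' x) \<and>
     (\<forall>i\<in>J'. prod_proj D J' x i \<cdot>\<^bsub>D\<^esub> t = prod_proj D J x i))"

text \<open>\<open>U\<close> ordered by reverse inclusion; the arrow \<open>J \<rightarrow> J'\<close>, for \<open>J' \<subseteq> J\<close>, is the pair \<open>(J, J')\<close>.\<close>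

definition ultra_cat :: "'i set set \<Rightarrow> ('i set, 'i set \<times> 'i set) cat" where
  "ultra_cat U = \<lparr>Obj = U, Arr = {(J, J'). J \<in> U \<and> J' \<in> U \<and> J' \<subseteq> J}, Dom = fst, Cod = snd,
     Ident = (\<lambda>J. (J, J)), Comp = (\<lambda>g f. (fst f, snd g))\<rparr>"

definition ultra_diagram ::
    "('o, 'm) cat \<Rightarrow> ('i \<Rightarrow> 'o) \<Rightarrow> ('i set, 'i set \<times> 'i set, 'o, 'm) fctr" where
  "ultra_diagram D x =
     \<lparr>FO = (\<lambda>J. prod_obj D J x), FA = (\<lambda>(J, J'). prod_restrict D J J' x)\<rparr>"

definition ultra_cocone ::
    "('o, 'm) cat \<Rightarrow> 'i set set \<Rightarrow> ('i \<Rightarrow> 'o) \<Rightarrow> 'o \<times> ('i set \<Rightarrow> 'm)" where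
  "ultra_cocone D U x = (SOME (c, q). is_colimit (ultra_cat U) D (ultra_diagram D x) c q)"

definition ultra_obj :: "('o, 'm) cat \<Rightarrow> 'i set set \<Rightarrow> ('i \<Rightarrow> 'o) \<Rightarrow> 'o" where
  "ultra_obj D U x = fst (ultra_cocone D U x)"

definition ultra_inj :: "('o, 'm) cat \<Rightarrow> 'i set set \<Rightarrow> ('i \<Rightarrow> 'o) \<Rightarrow> 'i set \<Rightarrow> 'm" where
  "ultra_inj D U x = snd (ultra_cocone D U x)"

definition ultra_map ::
    "('o, 'm) cat \<Rightarrow> 'i set set \<Rightarrow> ('i \<Rightarrow> 'o) \<Rightarrow> ('i \<Rightarrow> 'o) \<Rightarrow> ('i \<Rightarrow> 'm) \<Rightarrow> 'm" where
  "ultra_map D U x y f = (THE t. t \<in> hom D (ultra_obj D U x) (ultra_obj D U y) \<and>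
     (\<forall>J\<in>U. t \<cdot>\<^bsub>D\<^esub> ultra_inj D U x J = ultra_inj D U y J \<cdot>\<^bsub>D\<^esub> prod_map D J x y f))"

text \<open>The ultraproduct of functors \<open>F i : C \<rightarrow> D\<close>, computed pointwise.\<close>

definition ultra_fctr ::
    "('c, 'd) cat \<Rightarrow> ('o, 'm) cat \<Rightarrow> 'i set set \<Rightarrow> ('i \<Rightarrow> ('c, 'd, 'o, 'm) fctr) \<Rightarrow>
     ('c, 'd, 'o, 'm) fctr" where
  "ultra_fctr C D U F = \<lparr>FO = (\<lambda>c. ultra_obj D U (\<lambda>i. FO (F i) c)),
     FA = (\<lambda>h. ultra_map D U (\<lambda>i. FO (F i) (Dom C h)) (\<lambda>i. FO (F i) (Cod C h)) (\<lambda>i. FA (F i) h))\<rparr>"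

end

theory Submission
  imports Defs
begin

text \<open>
  Write \<open>Ult x\<close> for the ultraproduct of a family \<open>x\<close>, the colimit over \<open>J \<in> U\<close> of the products of the
  \<open>x i\<close> over \<open>i \<in> J\<close>. The sets in \<open>U\<close>, under reverse inclusion, form a filtered category with at most
  \<open>2 ^ |I| \<cdot> 2 ^ |I| < \<lambda>\<close> arrows, so the colimit exists and commutes with finite limits. Products
  commute with limits anyway, hence \<open>Ult\<close> preserves finite limits (\<open>ultra_limit\<close>), in particular
  monomorphisms, kernel pairs and intersections of subobjects.

  Effective epimorphisms are preserved because products preserve them and because a colimit of
  coequalizers is a coequalizer, the kernel pair of the colimit being the colimit of the kernel pairs
  (\<open>ultra_effective_epi\<close>).

  For unions the point is the defining property of an ultrafilter. Distributivity
  expands the product over \<open>J\<close> of the unions of \<open>a False i\<close> and \<open>a True i\<close> into the union, over all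
  choices \<open>\<epsilon> : J \<rightarrow> {False, True}\<close>, of the products of the \<open>a (\<epsilon> i) i\<close> (\<open>prod_union\<close>). Every \<open>\<epsilon>\<close> is
  constant on a subset of \<open>J\<close> that belongs to \<open>U\<close>, so that its summand is mapped into \<open>Ult (a False)\<close> or
  \<open>Ult (a True)\<close> (\<open>ultra_binary_union\<close>). The empty union is treated through initial objects, which in
  a coherent category are strict: an object with an arrow to an initial object is initial
  (\<open>strict_initial\<close>).

  Strictness also gives the criterion for inclusions. If \<open>a i \<le> b i\<close> holds on a set in \<open>U\<close>, then
  restriction to that set yields \<open>Ult a \<le> Ult b\<close> (\<open>ultra_le\<close>). If it fails on a set in \<open>U\<close>, weak
  Booleanness provides there non-initial subobjects \<open>u i \<le> a i\<close> disjoint from \<open>b i\<close>. Then \<open>Ult u\<close> and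
  \<open>Ult b\<close> have initial intersection, but \<open>Ult u\<close> is not initial, as it receives an arrow from a
  non-initial product. So \<open>Ult u\<close>, and with it \<open>Ult a\<close>, is not contained in \<open>Ult b\<close>
  (\<open>ultra_le_imp\<close>).
\<close>

section \<open>Monomorphisms, pullbacks and subobjects\<close>

context category begin

lemma comp_hom: "\<lbrakk>g \<in> hom C b c; f \<in> hom C a b\<rbrakk> \<Longrightarrow> g \<cdot> f \<in> hom C a c"
  by (auto simp: hom_def Comp_Arr Dom_Comp Cod_Comp)

lemma assoc_hom:
  "\<lbrakk>f \<in> hom C a b; g \<in> hom C b c; h \<in> hom C c d\<rbrakk> \<Longrightarrow> (h \<cdot> g) \<cdot> f = h \<cdot> (g \<cdot> f)"
  using Comp_assoc by (auto simp: hom_def)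

lemma ident_hom: "a \<in> Obj C \<Longrightarrow> Ident C a \<in> hom C a a"
  by (auto simp: hom_def Ident_Arr Dom_Ident Cod_Ident)

lemma comp_ident: "f \<in> hom C a b \<Longrightarrow> f \<cdot> Ident C a = f"
  using Comp_Ident by (auto simp: hom_def)

lemma ident_comp: "f \<in> hom C a b \<Longrightarrow> Ident C b \<cdot> f = f"
  using Ident_Comp by (auto simp: hom_def)

lemma hom_objs: "f \<in> hom C a b \<Longrightarrow> a \<in> Obj C \<and> b \<in> Obj C"
  using Dom_Obj Cod_Obj by (auto simp: hom_def)

lemma mono_cancel:
  "\<lbrakk>mono_arr C m; m \<in> hom C a b; f \<in> hom C w a; g \<in> hom C w a; m \<cdot> f = m \<cdot> g\<rbrakk> \<Longrightarrow> f = g"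
  by (auto simp: mono_arr_def hom_def)

lemma mono_arrI:
  assumes "m \<in> hom C a b"
    and "\<And>w f g. \<lbrakk>f \<in> hom C w a; g \<in> hom C w a; m \<cdot> f = m \<cdot> g\<rbrakk> \<Longrightarrow> f = g"
  shows "mono_arr C m"
  using assms unfolding mono_arr_def by (auto simp: hom_def)

lemma mono_comp:
  assumes m: "mono_arr C m" "m \<in> hom C b c" and n: "mono_arr C n" "n \<in> hom C a b"
  shows "mono_arr C (m \<cdot> n)"
proof (rule mono_arrI[OF comp_hom[OF m(2) n(2)]])
  fix w f g assume fg: "f \<in> hom C w a" "g \<in> hom C w a" "(m \<cdot> n) \<cdot> f = (m \<cdot> n) \<cdot> g"
  then have "m \<cdot> (n \<cdot> f) = m \<cdot> (n \<cdot> g)" using assoc_hom[OF _ n(2) m(2)] by metis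
  then have "n \<cdot> f = n \<cdot> g" using mono_cancel[OF m] comp_hom[OF n(2)] fg by blast
  then show "f = g" using mono_cancel[OF n] fg by blast
qed

lemma mono_left_factor:
  assumes "mono_arr C (m \<cdot> n)" "m \<in> hom C b c" "n \<in> hom C a b"
  shows "mono_arr C n"
proof (rule mono_arrI[OF assms(3)])
  fix w f g assume fg: "f \<in> hom C w a" "g \<in> hom C w a" "n \<cdot> f = n \<cdot> g"
  then have "(m \<cdot> n) \<cdot> f = (m \<cdot> n) \<cdot> g" using assoc_hom[OF _ assms(3,2)] by metis
  then show "f = g" using mono_cancel[OF assms(1) comp_hom[OF assms(2,3)]] fg by blast
qed

lemma mono_ident: "a \<in> Obj C \<Longrightarrow> mono_arr C (Ident C a)"
  by (rule mono_arrI[OF ident_hom]) (metis ident_comp)+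


lemma is_pullbackI:
  assumes "f \<in> hom C x z" "g \<in> hom C y z" "p \<in> hom C r x" "q \<in> hom C r y" "f \<cdot> p = g \<cdot> q"
    and "\<And>w s t. \<lbrakk>s \<in> hom C w x; t \<in> hom C w y; f \<cdot> s = g \<cdot> t\<rbrakk> \<Longrightarrow>
      \<exists>!u. u \<in> hom C w r \<and> p \<cdot> u = s \<and> q \<cdot> u = t"
  shows "is_pullback C f g p q"
  using assms unfolding is_pullback_def by (auto simp: hom_def)

lemma is_pullbackD:
  assumes "is_pullback C f g p q" "f \<in> hom C x z" "g \<in> hom C y z"
  shows "p \<in> hom C (Dom C p) x" "q \<in> hom C (Dom C p) y" "f \<cdot> p = g \<cdot> q"
    "\<And>w s t. \<lbrakk>s \<in> hom C w x; t \<in> hom C w y; f \<cdot> s = g \<cdot> t\<rbrakk> \<Longrightarrow>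
      \<exists>!u. u \<in> hom C w (Dom C p) \<and> p \<cdot> u = s \<and> q \<cdot> u = t"
proof -
  have D: "Dom C f = x" "Dom C g = y" using assms by (auto simp: hom_def)
  note P = assms(1)[unfolded is_pullback_def D]
  show "p \<in> hom C (Dom C p) x" "q \<in> hom C (Dom C p) y" "f \<cdot> p = g \<cdot> q"
    using P by (auto simp: hom_def)
  show "\<And>w s t. \<lbrakk>s \<in> hom C w x; t \<in> hom C w y; f \<cdot> s = g \<cdot> t\<rbrakk> \<Longrightarrow>
      \<exists>!u. u \<in> hom C w (Dom C p) \<and> p \<cdot> u = s \<and> q \<cdot> u = t"
    using P by blast
qed

lemma pullback_homs:
  "is_pullback C f g p q \<Longrightarrow> f \<in> hom C (Dom C f) (Cod C f) \<and> g \<in> hom C (Dom C g) (Cod C f)"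
  by (auto simp: is_pullback_def hom_def)

lemma mono_iff_pullback:
  assumes "m \<in> hom C a b"
  shows "mono_arr C m \<longleftrightarrow> is_pullback C m m (Ident C a) (Ident C a)"
proof
  assume m: "mono_arr C m"
  have a: "a \<in> Obj C" using assms hom_objs by blast
  show "is_pullback C m m (Ident C a) (Ident C a)"
  proof (rule is_pullbackI[OF assms assms ident_hom[OF a] ident_hom[OF a] refl])
    fix w s t assume st: "s \<in> hom C w a" "t \<in> hom C w a" "m \<cdot> s = m \<cdot> t"
    then have "s = t" using mono_cancel[OF m assms] by blast
    then show "\<exists>!u. u \<in> hom C w a \<and> Ident C a \<cdot> u = s \<and> Ident C a \<cdot> u = t"
      using st ident_comp by metis
  qed
next
  assume P: "is_pullback C m m (Ident C a) (Ident C a)"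
  have a: "a \<in> Obj C" using assms hom_objs by blast
  show "mono_arr C m"
  proof (rule mono_arrI[OF assms])
    fix w s t assume st: "s \<in> hom C w a" "t \<in> hom C w a" "m \<cdot> s = m \<cdot> t"
    then obtain u where "u \<in> hom C w (Dom C (Ident C a))" "Ident C a \<cdot> u = s" "Ident C a \<cdot> u = t"
      using is_pullbackD(4)[OF P assms assms] by blast
    then show "s = t" by simp
  qed
qed

lemma mono_pullback:
  assumes P: "is_pullback C f m p q" and m: "mono_arr C m"
  shows "mono_arr C p"
proof -
  have h: "f \<in> hom C (Dom C f) (Cod C f)" "m \<in> hom C (Dom C m) (Cod C f)"
    using pullback_homs[OF P] by auto
  note D = is_pullbackD[OF P h]
  show ?thesis
  proof (rule mono_arrI[OF D(1)])
    fix w s t assume st: "s \<in> hom C w (Dom C p)" "t \<in> hom C w (Dom C p)" "p \<cdot> s = p \<cdot> t"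
    have "m \<cdot> (q \<cdot> s) = f \<cdot> (p \<cdot> s)" "m \<cdot> (q \<cdot> t) = f \<cdot> (p \<cdot> t)"
      using assoc_hom[OF _ D(2) h(2)] assoc_hom[OF _ D(1) h(1)] st D(3) by metis+
    then have qq: "q \<cdot> s = q \<cdot> t"
      using st mono_cancel[OF m h(2) comp_hom[OF D(2)] comp_hom[OF D(2)]] by metis
    have "f \<cdot> (p \<cdot> s) = m \<cdot> (q \<cdot> s)"
      using assoc_hom[OF _ D(2) h(2)] assoc_hom[OF _ D(1) h(1)] st D(3) by metis
    then show "s = t"
      using D(4)[OF comp_hom[OF D(1)] comp_hom[OF D(2)]] st qq by metis
  qed
qed

lemma limit_transport_iso:
  assumes L: "is_limit K C F l p" and u: "is_iso C u" "u \<in> hom C w l"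
    and F: "\<And>k. k \<in> Obj K \<Longrightarrow> r k = p k \<cdot> u"
    and G: "\<And>g. g \<in> Arr K \<Longrightarrow> Dom K g \<in> Obj K \<and> Cod K g \<in> Obj K
        \<and> FA F g \<in> hom C (FO F (Dom K g)) (FO F (Cod K g))"
  shows "is_limit K C F w r"
proof -
  have ph: "\<And>k. k \<in> Obj K \<Longrightarrow> p k \<in> hom C l (FO F k)"
    and pn: "\<And>g. g \<in> Arr K \<Longrightarrow> FA F g \<cdot> p (Dom K g) = p (Cod K g)"
    using L unfolding is_limit_def is_cone_def by auto
  obtain v where v: "v \<in> hom C l w" "v \<cdot> u = Ident C w" "u \<cdot> v = Ident C l"
    using u unfolding is_iso_def by (auto simp: hom_def)
  have cone: "is_cone K C F w r"
    unfolding is_cone_def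
  proof (intro conjI ballI)
    show "w \<in> Obj C" using u hom_objs by blast
    show "r k \<in> hom C w (FO F k)" if "k \<in> Obj K" for k
      using F comp_hom[OF ph u(2)] that by simp
    show "FA F g \<cdot> r (Dom K g) = r (Cod K g)" if "g \<in> Arr K" for g
    proof -
      have "FA F g \<cdot> (p (Dom K g) \<cdot> u) = (FA F g \<cdot> p (Dom K g)) \<cdot> u"
        using assoc_hom[OF u(2) ph] G[OF that] by metis
      then show ?thesis using F G[OF that] pn[OF that] by simp
    qed
  qed
  show ?thesis
    unfolding is_limit_def
  proof (intro conjI allI impI, rule cone)
    fix x s assume s: "is_cone K C F x s"
    then obtain t where t: "t \<in> hom C x l" "\<And>k. k \<in> Obj K \<Longrightarrow> p k \<cdot> t = s k"
      and tu: "\<And>t'. \<lbrakk>t' \<in> hom C x l; \<forall>k\<in>Obj K. p k \<cdot> t' = s k\<rbrakk> \<Longrightarrow> t' = t"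
      using L unfolding is_limit_def by metis
    have cancel: "u \<cdot> (v \<cdot> t) = t"
      using assoc_hom[OF t(1) v(1) u(2)] v ident_comp[OF t(1)] by simp
    show "\<exists>!t'. t' \<in> hom C x w \<and> (\<forall>k\<in>Obj K. r k \<cdot> t' = s k)"
    proof (rule ex1I[where a = "v \<cdot> t"], intro conjI ballI)
      show vt: "v \<cdot> t \<in> hom C x w" using comp_hom[OF v(1) t(1)] .
      fix k assume k: "k \<in> Obj K"
      show "r k \<cdot> (v \<cdot> t) = s k"
        using assoc_hom[OF vt u(2) ph[OF k]] F[OF k] cancel t(2)[OF k] by simp
    next
      fix t' assume t': "t' \<in> hom C x w \<and> (\<forall>k\<in>Obj K. r k \<cdot> t' = s k)"
      have "u \<cdot> t' = t"
      proof (rule tu)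
        show "u \<cdot> t' \<in> hom C x l" using comp_hom u(2) t' by blast
        show "\<forall>k\<in>Obj K. p k \<cdot> (u \<cdot> t') = s k"
          using t' F assoc_hom[OF _ u(2) ph] by metis
      qed
      then show "t' = v \<cdot> t"
        using assoc_hom[OF _ u(2) v(1)] t' v ident_comp by metis
    qed
  qed
qed


lemma SubI: "\<lbrakk>mono_arr C m; m \<in> hom C a x\<rbrakk> \<Longrightarrow> m \<in> Sub C x"
  by (auto simp: Sub_def hom_def)

lemma SubD: "m \<in> Sub C x \<Longrightarrow> mono_arr C m \<and> m \<in> hom C (Dom C m) x"
  by (auto simp: Sub_def hom_def mono_arr_def)

lemma sub_leI:
  "\<lbrakk>a \<in> Sub C x; b \<in> Sub C x; h \<in> hom C (Dom C a) (Dom C b); b \<cdot> h = a\<rbrakk> \<Longrightarrow> sub_le C x a b"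
  by (auto simp: sub_le_def)

lemma sub_leE:
  assumes "sub_le C x a b"
  obtains h where "a \<in> Sub C x" "b \<in> Sub C x" "h \<in> hom C (Dom C a) (Dom C b)" "b \<cdot> h = a"
  using assms unfolding sub_le_def by auto

lemma sub_le_refl:
  assumes "a \<in> Sub C x"
  shows "sub_le C x a a"
proof (rule sub_leI[OF assms assms])
  have h: "a \<in> hom C (Dom C a) x" using SubD[OF assms] by simp
  show "Ident C (Dom C a) \<in> hom C (Dom C a) (Dom C a)" using h hom_objs ident_hom by blast
  show "a \<cdot> Ident C (Dom C a) = a" using comp_ident[OF h] .
qed

lemma sub_le_trans:
  assumes "sub_le C x a b" "sub_le C x b c"
  shows "sub_le C x a c"
proof -
  obtain h where h: "a \<in> Sub C x" "h \<in> hom C (Dom C a) (Dom C b)" "b \<cdot> h = a"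
    using assms(1) by (rule sub_leE)
  obtain k where k: "c \<in> Sub C x" "k \<in> hom C (Dom C b) (Dom C c)" "c \<cdot> k = b"
    using assms(2) by (rule sub_leE)
  have "c \<cdot> (k \<cdot> h) = a" using assoc_hom[OF h(2) k(2)] SubD[OF k(1)] h(3) k(3) by metis
  then show ?thesis using sub_leI[OF h(1) k(1) comp_hom[OF k(2) h(2)]] by blast
qed

lemma union_cong:
  assumes "is_union C x S u" "T \<subseteq> Sub C x"
    and "\<And>a. a \<in> S \<Longrightarrow> \<exists>b\<in>T. sub_le C x a b" "\<And>b. b \<in> T \<Longrightarrow> \<exists>a\<in>S. sub_le C x b a"
  shows "is_union C x T u"
  using assms unfolding is_union_def by (meson sub_le_trans)

lemma union_insert:
  assumes "is_union C x (insert a S) u" "is_union C x S v"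
  shows "is_union C x {a, v} u"
  using assms unfolding is_union_def by (simp, meson sub_le_trans)

text \<open>Preimages are characterized by their lower sets.\<close>

lemma preimage_le_iff:
  assumes f: "f \<in> hom C y x" and a: "a \<in> Sub C x" and b: "is_preimage C f a b"
  shows "b \<in> Sub C y"
    and "w \<in> Sub C y \<Longrightarrow>
      sub_le C y w b \<longleftrightarrow> (\<exists>h\<in>hom C (Dom C w) (Dom C a). a \<cdot> h = f \<cdot> w)"
proof -
  obtain q where P: "is_pullback C f a b q" using b unfolding is_preimage_def by blast
  have a': "mono_arr C a" "a \<in> hom C (Dom C a) x" using SubD[OF a] by auto
  note D = is_pullbackD[OF P f a'(2)]
  show bS: "b \<in> Sub C y" using SubI[OF mono_pullback[OF P a'(1)] D(1)] .
  assume w: "w \<in> Sub C y"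
  have w': "w \<in> hom C (Dom C w) y" using SubD[OF w] by auto
  show "sub_le C y w b \<longleftrightarrow> (\<exists>h\<in>hom C (Dom C w) (Dom C a). a \<cdot> h = f \<cdot> w)"
  proof
    assume "sub_le C y w b"
    then obtain h where h: "h \<in> hom C (Dom C w) (Dom C b)" "b \<cdot> h = w" by (rule sub_leE)
    have "a \<cdot> (q \<cdot> h) = f \<cdot> w"
      using assoc_hom[OF h(1) D(2) a'(2)] assoc_hom[OF h(1) D(1) f] D(3) h(2) by simp
    then show "\<exists>h\<in>hom C (Dom C w) (Dom C a). a \<cdot> h = f \<cdot> w"
      using comp_hom[OF D(2) h(1)] by blast
  next
    assume "\<exists>h\<in>hom C (Dom C w) (Dom C a). a \<cdot> h = f \<cdot> w"
    then obtain h where "h \<in> hom C (Dom C w) (Dom C a)" "f \<cdot> w = a \<cdot> h" by metis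
    then obtain u where "u \<in> hom C (Dom C w) (Dom C b)" "b \<cdot> u = w"
      using D(4)[OF w'] by blast
    then show "sub_le C y w b" using sub_leI[OF w bS] by blast
  qed
qed

end


section \<open>Pullbacks as limits over the cospan\<close>

text \<open>The objects are \<open>0, 1, 2\<close>, named like their identities; the arrows \<open>3 : 0 \<rightarrow> 2\<close> and \<open>4 : 1 \<rightarrow> 2\<close> are
  the two legs. Since a leg can only be composed with identities, the composite of \<open>f\<close> and \<open>g\<close> is
  whichever of them is a leg.\<close>

definition cospan_cat :: "(nat, nat) cat" where
  "cospan_cat = \<lparr>Obj = {0, 1, 2}, Arr = {0, 1, 2, 3, 4},
     Dom = (\<lambda>n. if n = 3 then 0 else if n = 4 then 1 else n), Cod = (\<lambda>n. if n \<in> {3, 4} then 2 else n),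
     Ident = (\<lambda>n. n), Comp = (\<lambda>g f. if g \<in> {3, 4} then g else f)\<rparr>"

definition cospan_fctr :: "('o, 'm) cat \<Rightarrow> 'o \<Rightarrow> 'o \<Rightarrow> 'o \<Rightarrow> 'm \<Rightarrow> 'm \<Rightarrow> (nat, nat, 'o, 'm) fctr" where
  "cospan_fctr C x y z f g = (let FO = (\<lambda>n. if n = 0 then x else if n = 1 then y else z) in
     \<lparr>FO = FO, FA = (\<lambda>n. if n = 3 then f else if n = 4 then g else Ident C (FO n))\<rparr>)"

lemma category_cospan: "category cospan_cat"
proof
  fix f g h :: nat
  show "h \<cdot>\<^bsub>cospan_cat\<^esub> (g \<cdot>\<^bsub>cospan_cat\<^esub> f) = (h \<cdot>\<^bsub>cospan_cat\<^esub> g) \<cdot>\<^bsub>cospan_cat\<^esub> f"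
    by (simp add: cospan_cat_def)
  show "f \<in> Arr cospan_cat \<Longrightarrow> Dom cospan_cat f \<in> Obj cospan_cat"
    "f \<in> Arr cospan_cat \<Longrightarrow> Cod cospan_cat f \<in> Obj cospan_cat"
    "f \<in> Arr cospan_cat \<Longrightarrow> f \<cdot>\<^bsub>cospan_cat\<^esub> Ident cospan_cat (Dom cospan_cat f) = f"
    "f \<in> Arr cospan_cat \<Longrightarrow> Ident cospan_cat (Cod cospan_cat f) \<cdot>\<^bsub>cospan_cat\<^esub> f = f"
    by (auto simp: cospan_cat_def)
  assume fg: "f \<in> Arr cospan_cat" "g \<in> Arr cospan_cat" "Cod cospan_cat f = Dom cospan_cat g"
  show "g \<cdot>\<^bsub>cospan_cat\<^esub> f \<in> Arr cospan_cat"
    using fg(1,2) by (simp add: cospan_cat_def)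
  show "Dom cospan_cat (g \<cdot>\<^bsub>cospan_cat\<^esub> f) = Dom cospan_cat f"
    "Cod cospan_cat (g \<cdot>\<^bsub>cospan_cat\<^esub> f) = Cod cospan_cat g"
    using fg by (simp_all add: cospan_cat_def split: if_splits) auto
next
  fix a
  assume "a \<in> Obj cospan_cat"
  then show "Ident cospan_cat a \<in> Arr cospan_cat" "Dom cospan_cat (Ident cospan_cat a) = a"
      "Cod cospan_cat (Ident cospan_cat a) = a"
    by (auto simp: cospan_cat_def)
qed

lemma functor_hom:
  "\<lbrakk>is_functor C D F; f \<in> Arr C; Dom C f = a; Cod C f = b\<rbrakk> \<Longrightarrow> FA F f \<in> hom D (FO F a) (FO F b)"
  unfolding is_functor_def by blast

lemma functor_ident: "\<lbrakk>is_functor C D F; a \<in> Obj C\<rbrakk> \<Longrightarrow> FA F (Ident C a) = Ident D (FO F a)"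
  unfolding is_functor_def by blast

lemma cospan_functor_homs:
  assumes "is_functor cospan_cat C G"
  shows "FA G 3 \<in> hom C (FO G 0) (FO G 2)" "FA G 4 \<in> hom C (FO G 1) (FO G 2)"
  using assms by (auto intro!: functor_hom simp: cospan_cat_def)

lemma finite_cospan: "finite (Arr cospan_cat)"
  by (simp add: cospan_cat_def)

context category begin

lemma functor_cospan:
  assumes f: "f \<in> hom C x z" and g: "g \<in> hom C y z"
  shows "is_functor cospan_cat C (cospan_fctr C x y z f g)"
proof -
  have o: "x \<in> Obj C" "y \<in> Obj C" "z \<in> Obj C" using f g hom_objs by auto
  note i = o[THEN ident_hom]
  let ?F = "cospan_fctr C x y z f g"
  have 1: "FA ?F h \<in> hom C (FO ?F (Dom cospan_cat h)) (FO ?F (Cod cospan_cat h))"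
    if "h \<in> Arr cospan_cat" for h
    using that i f g by (auto simp: cospan_cat_def cospan_fctr_def)
  have 2: "FA ?F h = Ident C (FO ?F h)" if "h \<in> Obj cospan_cat" for h
    using that by (auto simp: cospan_cat_def cospan_fctr_def)
  have 3: "FA ?F (k \<cdot>\<^bsub>cospan_cat\<^esub> h) = FA ?F k \<cdot> FA ?F h"
    if h: "h \<in> Arr cospan_cat" and k: "k \<in> Arr cospan_cat" and hk: "Cod cospan_cat h = Dom cospan_cat k" for h k
  proof (cases "k \<in> {3, 4}")
    case True
    \<comment> \<open>the non-identity arrows of the cospan can only be preceded by identities\<close>
    then have "h = Dom cospan_cat k" "h \<in> Obj cospan_cat" "k \<cdot>\<^bsub>cospan_cat\<^esub> h = k"
      using h hk by (auto simp: cospan_cat_def split: if_splits)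
    then show ?thesis using 2[of h] comp_ident[OF 1[OF k]] by simp
  next
    case False
    then have "k = Cod cospan_cat h" "k \<in> Obj cospan_cat" "k \<cdot>\<^bsub>cospan_cat\<^esub> h = h"
      using k hk by (auto simp: cospan_cat_def)
    then show ?thesis using 2[of k] ident_comp[OF 1[OF h]] by simp
  qed
  show ?thesis
    unfolding is_functor_def
  proof (intro conjI ballI impI)
    show "FO ?F a \<in> Obj C" if "a \<in> Obj cospan_cat" for a
      using o by (simp add: cospan_fctr_def)
    show "FA ?F (Ident cospan_cat a) = Ident C (FO ?F a)" if "a \<in> Obj cospan_cat" for a
      using 2[OF that] by (simp add: cospan_cat_def)
  qed (use category_cospan category_axioms 1 3 in auto)
qed

lemma cospan_cone_iff:
  assumes G: "is_functor cospan_cat C G"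
  shows "is_cone cospan_cat C G w r \<longleftrightarrow> r 0 \<in> hom C w (FO G 0) \<and> r 1 \<in> hom C w (FO G 1) \<and>
    r 2 = FA G 3 \<cdot> r 0 \<and> r 2 = FA G 4 \<cdot> r 1"
proof -
  note 3 = cospan_functor_homs(1)[OF G]
  have i: "FA G 0 = Ident C (FO G 0)" "FA G 1 = Ident C (FO G 1)" "FA G 2 = Ident C (FO G 2)"
    using functor_ident[OF G] by (auto simp: cospan_cat_def)
  show ?thesis
  proof
    assume "is_cone cospan_cat C G w r"
    then show "r 0 \<in> hom C w (FO G 0) \<and> r 1 \<in> hom C w (FO G 1) \<and>
        r 2 = FA G 3 \<cdot> r 0 \<and> r 2 = FA G 4 \<cdot> r 1"
      unfolding is_cone_def by (simp add: cospan_cat_def)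
  next
    assume r: "r 0 \<in> hom C w (FO G 0) \<and> r 1 \<in> hom C w (FO G 1) \<and>
        r 2 = FA G 3 \<cdot> r 0 \<and> r 2 = FA G 4 \<cdot> r 1"
    have r2: "r 2 \<in> hom C w (FO G 2)" using comp_hom[OF 3] r by metis
    have w: "w \<in> Obj C" using r hom_objs by blast
    have j: "Ident C (FO G 0) \<cdot> r 0 = r 0" "Ident C (FO G 1) \<cdot> r 1 = r 1"
       "Ident C (FO G 2) \<cdot> r 2 = r 2" using r r2 ident_comp by blast+
    then have j': "Ident C (FO G (Suc 0)) \<cdot> r (Suc 0) = r (Suc 0)" by simp
    show "is_cone cospan_cat C G w r"
      using r r2 w i j j' unfolding is_cone_def by (auto simp: cospan_cat_def)
  qed
qed

lemma cospan_limit_pullback: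
  assumes G: "is_functor cospan_cat C G" and L: "is_limit cospan_cat C G l t"
  shows "is_pullback C (FA G 3) (FA G 4) (t 0) (t 1)"
proof -
  note 3 = cospan_functor_homs[OF G]
  have t: "t 0 \<in> hom C l (FO G 0)" "t 1 \<in> hom C l (FO G 1)"
      "t 2 = FA G 3 \<cdot> t 0" "t 2 = FA G 4 \<cdot> t 1"
    using L[unfolded is_limit_def cospan_cone_iff[OF G]] by blast+
  have O: "k \<in> Obj cospan_cat \<longleftrightarrow> k = 0 \<or> k = 1 \<or> k = 2" for k
    by (simp add: cospan_cat_def)
  show ?thesis
  proof (rule is_pullbackI[OF 3 t(1,2)])
    show "FA G 3 \<cdot> t 0 = FA G 4 \<cdot> t 1" using t by simp
    fix w a b assume ab: "a \<in> hom C w (FO G 0)" "b \<in> hom C w (FO G 1)" "FA G 3 \<cdot> a = FA G 4 \<cdot> b"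
    define r where "r = (\<lambda>n::nat. if n = 0 then a else if n = 1 then b else FA G 3 \<cdot> a)"
    have r: "r 0 = a" "r 1 = b" "r 2 = FA G 3 \<cdot> a" by (auto simp: r_def)
    have "is_cone cospan_cat C G w r"
      using ab cospan_cone_iff[OF G] r by simp
    then obtain u where u: "u \<in> hom C w l" "\<forall>k\<in>Obj cospan_cat. t k \<cdot> u = r k"
        and un: "\<And>u'. \<lbrakk>u' \<in> hom C w l; \<forall>k\<in>Obj cospan_cat. t k \<cdot> u' = r k\<rbrakk> \<Longrightarrow> u' = u"
      using L unfolding is_limit_def by metis
    show "\<exists>!u. u \<in> hom C w l \<and> t 0 \<cdot> u = a \<and> t 1 \<cdot> u = b"
    proof (rule ex1I[of _ u])
      show "u \<in> hom C w l \<and> t 0 \<cdot> u = a \<and> t 1 \<cdot> u = b"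
        using u r O by metis
      fix v assume v: "v \<in> hom C w l \<and> t 0 \<cdot> v = a \<and> t 1 \<cdot> v = b"
      then have "t 2 \<cdot> v = r 2" using assoc_hom[OF _ t(1) 3(1)] t(3) r by metis
      then show "v = u" using v un r O by metis
    qed
  qed
qed

lemma pullback_cospan_limit:
  fixes G :: "(nat, nat, 'o, 'm) fctr"
  assumes G: "is_functor cospan_cat C G" and P: "is_pullback C (FA G 3) (FA G 4) p q"
  shows "is_limit cospan_cat C G (Dom C p) (\<lambda>n. if n = 0 then p else if n = 1 then q else FA G 3 \<cdot> p)"
    (is "is_limit _ _ _ _ ?t")
proof -
  note 3 = cospan_functor_homs[OF G]
  note D = is_pullbackD[OF P 3]
  have t: "?t 0 = p" "?t 1 = q" "?t 2 = FA G 3 \<cdot> p" by simp_all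
  have cone: "is_cone cospan_cat C G (Dom C p) ?t"
    unfolding cospan_cone_iff[OF G] t using D(1-3) by simp
  show ?thesis
    unfolding is_limit_def
  proof (intro conjI allI impI, rule cone)
    fix w and r :: "nat \<Rightarrow> 'm" assume "is_cone cospan_cat C G w r"
    then have r: "r 0 \<in> hom C w (FO G 0)" "r 1 \<in> hom C w (FO G 1)"
        "r 2 = FA G 3 \<cdot> r 0" "FA G 3 \<cdot> r 0 = FA G 4 \<cdot> r 1"
      unfolding cospan_cone_iff[OF G] by auto
    have "(FA G 3 \<cdot> p) \<cdot> u = FA G 3 \<cdot> (p \<cdot> u)" if "u \<in> hom C w (Dom C p)" for u
      using assoc_hom[OF that D(1) 3(1)] .
    moreover have O: "(\<forall>k\<in>Obj cospan_cat. ?t k \<cdot> u = r k) \<longleftrightarrow>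
        p \<cdot> u = r 0 \<and> q \<cdot> u = r 1 \<and> (FA G 3 \<cdot> p) \<cdot> u = r 2" for u
      by (simp add: cospan_cat_def)
    ultimately have "u \<in> hom C w (Dom C p) \<and> (\<forall>k\<in>Obj cospan_cat. ?t k \<cdot> u = r k) \<longleftrightarrow>
        u \<in> hom C w (Dom C p) \<and> p \<cdot> u = r 0 \<and> q \<cdot> u = r 1" for u
      unfolding O using r(3) by metis
    then show "\<exists>!u. u \<in> hom C w (Dom C p) \<and> (\<forall>k\<in>Obj cospan_cat. ?t k \<cdot> u = r k)"
      using D(4)[OF r(1,2,4)] by simp
  qed
qed

end


section \<open>Strict initial objects in coherent categories\<close>

locale coherent_cat = category +
  assumes coherent: "coherent_category C"
begin

lemma finite_limits: "has_finite_limits C"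
  using coherent by (simp add: coherent_category_def)

lemma stable_finite_unions: "has_stable_unions finite C"
  using coherent by (simp add: coherent_category_def)

lemma ex_pullback:
  assumes "f \<in> hom C x z" "g \<in> hom C y z"
  shows "\<exists>p q. is_pullback C f g p q"
proof -
  let ?G = "cospan_fctr C x y z f g"
  have G: "is_functor cospan_cat C ?G" using functor_cospan[OF assms] .
  then obtain l t where "is_limit cospan_cat C ?G l t"
    using finite_limits finite_cospan unfolding has_finite_limits_def by blast
  then have "is_pullback C (FA ?G 3) (FA ?G 4) (t 0) (t 1)" using cospan_limit_pullback[OF G] by blast
  then show ?thesis by (auto simp: cospan_fctr_def Let_def)
qed

lemma ex_terminal: "\<exists>t\<in>Obj C. \<forall>x\<in>Obj C. \<exists>!f. f \<in> hom C x t"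
proof -
  define K :: "(nat, nat) cat" where
    "K = \<lparr>Obj = {}, Arr = {}, Dom = (\<lambda>n. n), Cod = (\<lambda>n. n), Ident = (\<lambda>n. n), Comp = (\<lambda>g f. f)\<rparr>"
  define G :: "(nat, nat, 'a, 'b) fctr" where "G = undefined"
  have "category K" by unfold_locales (auto simp: K_def)
  then have "is_functor K C G" using category_axioms unfolding is_functor_def by (simp add: K_def)
  moreover have "finite (Arr K)" by (simp add: K_def)
  ultimately obtain l t where L: "is_limit K C G l t"
    using finite_limits unfolding has_finite_limits_def by blast
  then have "\<forall>x\<in>Obj C. \<exists>!f. f \<in> hom C x l"
    unfolding is_limit_def is_cone_def by (simp add: K_def)
  moreover have "l \<in> Obj C" using L unfolding is_limit_def is_cone_def by blast
  ultimately show ?thesis by blast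
qed

lemma ex_binary_product:
  assumes x: "x \<in> Obj C" and y: "y \<in> Obj C"
  obtains r p q where "p \<in> hom C r x" "q \<in> hom C r y"
    "\<And>w s t. \<lbrakk>s \<in> hom C w x; t \<in> hom C w y\<rbrakk> \<Longrightarrow> \<exists>!u. u \<in> hom C w r \<and> p \<cdot> u = s \<and> q \<cdot> u = t"
proof -
  obtain c where c: "c \<in> Obj C" "\<And>x. x \<in> Obj C \<Longrightarrow> \<exists>!f. f \<in> hom C x c"
    using ex_terminal by metis
  obtain f g where fg: "f \<in> hom C x c" "g \<in> hom C y c" using c x y by metis
  then obtain p q where P: "is_pullback C f g p q" using ex_pullback by blast
  note D = is_pullbackD[OF P fg]
  have "f \<cdot> s = g \<cdot> t" if "s \<in> hom C w x" "t \<in> hom C w y" for w s t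
    using c(2)[of w] comp_hom[OF fg(1) that(1)] comp_hom[OF fg(2) that(2)] that hom_objs by blast
  then show thesis using that[OF D(1,2)] D(4) by blast
qed

lemma ex_preimage:
  assumes "f \<in> hom C y x" "a \<in> Sub C x"
  shows "\<exists>b. is_preimage C f a b"
  using ex_pullback[OF assms(1)] SubD[OF assms(2)] unfolding is_preimage_def by blast

lemma ex_finite_union:
  assumes "finite S" "S \<subseteq> Sub C x" "x \<in> Obj C"
  shows "\<exists>u. is_union C x S u"
  using assms stable_finite_unions unfolding has_stable_unions_def by blast

lemma union_preimage:
  assumes "finite S" "is_union C x S u" "f \<in> hom C y x" "is_preimage C f u v"
  shows "is_union C y {b. \<exists>a\<in>S. is_preimage C f a b} v"
proof -
  have "x \<in> Obj C" "S \<subseteq> Sub C x" using assms(2,3) hom_objs unfolding is_union_def by auto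
  then show ?thesis using stable_finite_unions assms unfolding has_stable_unions_def by blast
qed

text \<open>The object is the domain \<open>z\<close> of the least subobject of the terminal object. A subobject of \<open>z\<close> is
  also one of the terminal object, so the empty union of subobjects of \<open>z\<close> is \<open>z\<close> itself. By
  stability of the empty union this transfers to every \<open>x\<close> with an arrow to \<open>z\<close>: all monomorphisms
  into such an \<open>x\<close> split.\<close>

lemma ex_strict_object:
  obtains z where "z \<in> Obj C" "\<And>x f. f \<in> hom C x z \<Longrightarrow> is_union C x {} (Ident C x)"
proof -
  obtain t where t: "t \<in> Obj C" using ex_terminal by blast
  obtain u where u: "is_union C t {} u" using ex_finite_union[of "{}"] t by blast
  let ?z = "Dom C u"
  have uS: "u \<in> Sub C t" and ul: "\<And>v. v \<in> Sub C t \<Longrightarrow> sub_le C t u v"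
    using u unfolding is_union_def by auto
  have um: "mono_arr C u" "u \<in> hom C ?z t" using SubD[OF uS] by auto
  have z: "?z \<in> Obj C" using um hom_objs by blast
  have idS: "Ident C ?z \<in> Sub C ?z" using SubI[OF mono_ident ident_hom] z by blast
  have idU: "is_union C ?z {} (Ident C ?z)"
    unfolding is_union_def
  proof (intro conjI ballI impI)
    fix v assume v: "v \<in> Sub C ?z"
    have vm: "mono_arr C v" "v \<in> hom C (Dom C v) ?z" using SubD[OF v] by auto
    have uv: "u \<cdot> v \<in> hom C (Dom C v) t" using comp_hom um vm by blast
    have "u \<cdot> v \<in> Sub C t" using SubI[OF mono_comp[OF um vm] uv] .
    from ul[OF this] obtain h where h: "h \<in> hom C ?z (Dom C (u \<cdot> v))" "(u \<cdot> v) \<cdot> h = u"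
      by (rule sub_leE)
    have h': "h \<in> hom C ?z (Dom C v)" using h uv by (simp add: hom_def)
    have "u \<cdot> (v \<cdot> h) = u \<cdot> Ident C ?z"
      using assoc_hom[OF h' vm(2) um(2)] h(2) comp_ident[OF um(2)] by simp
    then have "v \<cdot> h = Ident C ?z"
      using mono_cancel[OF um comp_hom[OF vm(2) h'] ident_hom[OF z]] by blast
    then show "sub_le C ?z (Ident C ?z) v"
      using sub_leI[OF idS v, of h] h' ident_hom[OF z] by (simp add: hom_def)
  qed (use idS in auto)
  show thesis
  proof (rule that[OF z])
    fix x f assume f: "f \<in> hom C x ?z"
    have x: "x \<in> Obj C" using f hom_objs by blast
    have "is_pullback C f (Ident C ?z) (Ident C x) f"
    proof (rule is_pullbackI[OF f ident_hom[OF z] ident_hom[OF x] f])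
      show "f \<cdot> Ident C x = Ident C ?z \<cdot> f" using f comp_ident ident_comp by simp
      fix w s k assume "s \<in> hom C w x" "k \<in> hom C w ?z" "f \<cdot> s = Ident C ?z \<cdot> k"
      then show "\<exists>!u. u \<in> hom C w x \<and> Ident C x \<cdot> u = s \<and> f \<cdot> u = k"
        by (metis ident_comp)
    qed
    then have "is_union C x {b. \<exists>a\<in>{}. is_preimage C f a b} (Ident C x)"
      using union_preimage[OF _ idU f] unfolding is_preimage_def by blast
    then show "is_union C x {} (Ident C x)" by simp
  qed
qed

text \<open>Two arrows \<open>f, g : x \<rightarrow> y\<close> out of an object over the strict object \<open>z\<close> are equal: the graph of \<open>f\<close>
  is a monomorphism into \<open>x \<times> y\<close>, which is over \<open>z\<close> as well, so it splits and is inverse to the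
  projection to \<open>x\<close>. The graph of \<open>g\<close>, another section of that projection, must be the same. In
  particular the projection \<open>z \<times> y \<rightarrow> z\<close> is a monomorphism; it splits too, and this yields an arrow
  from \<open>z\<close> to \<open>y\<close>.\<close>

lemma ex_strict_initial:
  obtains z where "is_initial C z" "\<And>x y f g h. \<lbrakk>h \<in> hom C x z; f \<in> hom C x y; g \<in> hom C x y\<rbrakk> \<Longrightarrow> f = g"
proof -
  obtain z where z: "z \<in> Obj C" and degenerate: "\<And>x f. f \<in> hom C x z \<Longrightarrow> is_union C x {} (Ident C x)"
    using ex_strict_object by blast
  have split: "\<exists>h\<in>hom C x w. m \<cdot> h = Ident C x"
    if f: "f \<in> hom C x z" and m: "mono_arr C m" "m \<in> hom C w x" for x f m w
  proof -
    have x: "x \<in> Obj C" using f hom_objs by blast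
    have "sub_le C x (Ident C x) m" using degenerate[OF f] SubI[OF m] unfolding is_union_def by blast
    then show ?thesis by (rule sub_leE) (use m ident_hom[OF x] in \<open>auto simp: hom_def\<close>)
  qed
  have unique: "f = g" if h: "h \<in> hom C x z" and f: "f \<in> hom C x y" and g: "g \<in> hom C x y" for x y f g h
  proof -
    have xy: "x \<in> Obj C" "y \<in> Obj C" using f hom_objs by auto
    obtain r p q where r: "p \<in> hom C r x" "q \<in> hom C r y"
      "\<And>w s t. \<lbrakk>s \<in> hom C w x; t \<in> hom C w y\<rbrakk> \<Longrightarrow> \<exists>!u. u \<in> hom C w r \<and> p \<cdot> u = s \<and> q \<cdot> u = t"
      by (rule ex_binary_product[OF xy]) blast
    obtain a where a: "a \<in> hom C x r" "p \<cdot> a = Ident C x" "q \<cdot> a = f"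
      using r(3)[OF ident_hom[OF xy(1)] f] by blast
    obtain b where b: "b \<in> hom C x r" "p \<cdot> b = Ident C x" "q \<cdot> b = g"
      using r(3)[OF ident_hom[OF xy(1)] g] by blast
    have am: "mono_arr C a"
      using mono_left_factor[OF _ r(1) a(1)] a(2) mono_ident[OF xy(1)] by simp
    obtain k where k: "k \<in> hom C r x" "a \<cdot> k = Ident C r"
      using split[OF comp_hom[OF h r(1)] am a(1)] by blast
    have "p = p \<cdot> (a \<cdot> k)" using k comp_ident[OF r(1)] by simp
    also have "\<dots> = k" using assoc_hom[OF k(1) a(1) r(1)] a(2) ident_comp[OF k(1)] by simp
    finally have "a \<cdot> p = Ident C r" using k by simp
    then have "b = a"
      using assoc_hom[OF b(1) r(1) a(1)] b(2) comp_ident[OF a(1)] ident_comp[OF b(1)] by simp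
    then show "f = g" using a b by simp
  qed
  have "\<exists>f. f \<in> hom C z y" if y: "y \<in> Obj C" for y
  proof -
    obtain r p q where r: "p \<in> hom C r z" "q \<in> hom C r y"
      by (rule ex_binary_product[OF z y]) blast
    have "mono_arr C p" using unique comp_hom[OF r(1)] by (intro mono_arrI[OF r(1)]) blast
    then obtain h where "h \<in> hom C z r" using split[OF ident_hom[OF z] _ r(1)] by blast
    then show ?thesis using comp_hom[OF r(2)] by blast
  qed
  then have "is_initial C z" using z unique[OF ident_hom[OF z]] unfolding is_initial_def by metis
  then show thesis using that unique by blast
qed

text \<open>Strictness is how initiality is detected from here on, both for ultraproducts and for the
  products of which they are colimits.\<close>

theorem strict_initial:
  assumes z: "is_initial C z" and f: "f \<in> hom C x z"
  shows "is_initial C x"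
proof -
  obtain z0 where z0: "is_initial C z0"
    and un: "\<And>x y f g h. \<lbrakk>h \<in> hom C x z0; f \<in> hom C x y; g \<in> hom C x y\<rbrakk> \<Longrightarrow> f = g"
    by (rule ex_strict_initial) blast
  obtain k where "k \<in> hom C z z0" using z z0 unfolding is_initial_def by blast
  then have h: "k \<cdot> f \<in> hom C x z0" using comp_hom f by blast
  have "\<exists>!t. t \<in> hom C x y" if y: "y \<in> Obj C" for y
  proof -
    obtain t where "t \<in> hom C z y" using z y unfolding is_initial_def by blast
    then have "t \<cdot> f \<in> hom C x y" using comp_hom f by blast
    then show ?thesis using un[OF h] by blast
  qed
  then show ?thesis using f hom_objs unfolding is_initial_def by blast
qed

lemma empty_union_iff:
  assumes x: "x \<in> Obj C"
  shows "is_union C x {} u \<longleftrightarrow> u \<in> Sub C x \<and> is_initial C (Dom C u)"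
proof
  assume U: "is_union C x {} u"
  obtain z where z: "is_initial C z" by (rule ex_strict_initial) blast
  obtain k where k: "k \<in> hom C z x" using z x unfolding is_initial_def by blast
  have "s = t" if "s \<in> hom C w z" "t \<in> hom C w z" for s t w
    using strict_initial[OF z that(1)] that hom_objs unfolding is_initial_def by blast
  then have "mono_arr C k" by (intro mono_arrI[OF k])
  then have "k \<in> Sub C x" using SubI k by blast
  then have "sub_le C x u k" using U unfolding is_union_def by blast
  then obtain h where "h \<in> hom C (Dom C u) (Dom C k)" by (rule sub_leE)
  then have "h \<in> hom C (Dom C u) z" using k by (simp add: hom_def)
  then show "u \<in> Sub C x \<and> is_initial C (Dom C u)"
    using strict_initial[OF z] U unfolding is_union_def by blast
next
  assume u: "u \<in> Sub C x \<and> is_initial C (Dom C u)"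
  have uh: "u \<in> hom C (Dom C u) x" using u SubD by blast
  have "sub_le C x u v" if v: "v \<in> Sub C x" for v
  proof -
    have vh: "v \<in> hom C (Dom C v) x" using v SubD by blast
    then obtain h where h: "h \<in> hom C (Dom C u) (Dom C v)"
      using u hom_objs unfolding is_initial_def by blast
    then have "v \<cdot> h = u" using u x comp_hom[OF vh h] uh unfolding is_initial_def by blast
    then show ?thesis using sub_leI u v h by blast
  qed
  then show "is_union C x {} u" using u unfolding is_union_def by blast
qed

end


section \<open>Functors and change of index sets\<close>

lemma functor_obj: "\<lbrakk>is_functor C D F; a \<in> Obj C\<rbrakk> \<Longrightarrow> FO F a \<in> Obj D"
  unfolding is_functor_def by blast

lemma functor_comp:
  "\<lbrakk>is_functor C D F; f \<in> Arr C; g \<in> Arr C; Cod C f = Dom C g\<rbrakk> \<Longrightarrow>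
    FA F (g \<cdot>\<^bsub>C\<^esub> f) = FA F g \<cdot>\<^bsub>D\<^esub> FA F f"
  unfolding is_functor_def by blast

lemma is_functorI:
  assumes "category C" "category D" "\<And>a. a \<in> Obj C \<Longrightarrow> FO F a \<in> Obj D"
    "\<And>f. f \<in> Arr C \<Longrightarrow> FA F f \<in> hom D (FO F (Dom C f)) (FO F (Cod C f))"
    "\<And>a. a \<in> Obj C \<Longrightarrow> FA F (Ident C a) = Ident D (FO F a)"
    "\<And>f g. \<lbrakk>f \<in> Arr C; g \<in> Arr C; Cod C f = Dom C g\<rbrakk> \<Longrightarrow> FA F (g \<cdot>\<^bsub>C\<^esub> f) = FA F g \<cdot>\<^bsub>D\<^esub> FA F f"
  shows "is_functor C D F"
  using assms unfolding is_functor_def by blast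

lemma functor_categories: "is_functor C D F \<Longrightarrow> category C \<and> category D"
  unfolding is_functor_def by blast

lemma functor_comp_fctr:
  assumes F: "is_functor C D F" and G: "is_functor D E G"
  shows "is_functor C E (comp_fctr G F)"
proof (rule is_functorI)
  fix f assume f: "f \<in> Arr C"
  have Ff: "FA F f \<in> hom D (FO F (Dom C f)) (FO F (Cod C f))" using functor_hom[OF F f] by blast
  then show "FA (comp_fctr G F) f \<in> hom E (FO (comp_fctr G F) (Dom C f)) (FO (comp_fctr G F) (Cod C f))"
    using functor_hom[OF G] by (simp add: comp_fctr_def hom_def)
  fix g assume g: "g \<in> Arr C" "Cod C f = Dom C g"
  have "FA F g \<in> hom D (FO F (Dom C g)) (FO F (Cod C g))" using functor_hom[OF F g(1)] by blast
  then show "FA (comp_fctr G F) (g \<cdot>\<^bsub>C\<^esub> f) = FA (comp_fctr G F) g \<cdot>\<^bsub>E\<^esub> FA (comp_fctr G F) f"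
    using functor_comp[OF F f g] functor_comp[OF G, of "FA F f" "FA F g"] Ff g(2)
    by (simp add: comp_fctr_def hom_def)
next
  fix a assume a: "a \<in> Obj C"
  show "FO (comp_fctr G F) a \<in> Obj E" "FA (comp_fctr G F) (Ident C a) = Ident E (FO (comp_fctr G F) a)"
    using a functor_obj[OF F a] functor_obj[OF G] functor_ident[OF F a] functor_ident[OF G]
    by (simp_all add: comp_fctr_def)
qed (use functor_categories[OF F] functor_categories[OF G] in auto)

lemma category_prod_cat:
  assumes "category J" "category K"
  shows "category (prod_cat J K)"
proof -
  interpret J: category J by fact
  interpret K: category K by fact
  show ?thesis
    by unfold_locales
      (auto simp: prod_cat_def J.Dom_Obj J.Cod_Obj J.Ident_Arr J.Dom_Ident J.Cod_Ident J.Comp_Arr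
        J.Dom_Comp J.Cod_Comp J.Comp_Ident J.Ident_Comp J.Comp_assoc K.Dom_Obj K.Cod_Obj K.Ident_Arr
        K.Dom_Ident K.Cod_Ident K.Comp_Arr K.Dom_Comp K.Cod_Comp K.Comp_Ident K.Ident_Comp K.Comp_assoc)
qed

lemma functor_prod_cat:
  assumes N: "is_functor J' J N" and K: "category K"
  shows "is_functor (prod_cat J' K) (prod_cat J K) \<lparr>FO = map_prod (FO N) id, FA = map_prod (FA N) id\<rparr>"
    (is "is_functor _ _ ?N")
proof -
  interpret K: category K by fact
  show ?thesis
  proof (rule is_functorI)
    fix f assume f: "f \<in> Arr (prod_cat J' K)"
    then show "FA ?N f \<in> hom (prod_cat J K) (FO ?N (Dom (prod_cat J' K) f)) (FO ?N (Cod (prod_cat J' K) f))"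
      using functor_hom[OF N] by (cases f) (auto simp: prod_cat_def hom_def)
    fix g assume "g \<in> Arr (prod_cat J' K)" "Cod (prod_cat J' K) f = Dom (prod_cat J' K) g"
    then show "FA ?N (g \<cdot>\<^bsub>prod_cat J' K\<^esub> f) = FA ?N g \<cdot>\<^bsub>prod_cat J K\<^esub> FA ?N f"
      using f functor_comp[OF N] by (cases f, cases g) (auto simp: prod_cat_def)
  qed (use functor_obj[OF N] functor_ident[OF N] category_prod_cat functor_categories[OF N] K
      in \<open>auto simp: prod_cat_def\<close>)
qed


subsection \<open>Shapes of diagrams\<close>

locale relabelling = category J for J :: "('a, 'b) cat" +
  fixes \<psi> :: "'b \<Rightarrow> 'l"
  assumes inj: "inj_on \<psi> (Arr J)"
begin

abbreviation obj_name :: "'a \<Rightarrow> 'l" where "obj_name a \<equiv> \<psi> (Ident J a)"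

abbreviation arr_of :: "'l \<Rightarrow> 'b" where "arr_of t \<equiv> inv_into (Arr J) \<psi> t"

text \<open>
  The shape \<open>J\<close> is copied along an injection \<open>\<psi>\<close> of its arrows into the carrier of a cardinal. Objects
  are named by their identity arrows, so that no second injection is needed.
\<close>

definition relabel :: "('l, 'l) cat" where
  "relabel = \<lparr>Obj = obj_name ` Obj J, Arr = \<psi> ` Arr J,
     Dom = (\<lambda>t. obj_name (Dom J (arr_of t))), Cod = (\<lambda>t. obj_name (Cod J (arr_of t))),
     Ident = (\<lambda>t. t), Comp = (\<lambda>t s. \<psi> (arr_of t \<cdot>\<^bsub>J\<^esub> arr_of s))\<rparr>"

definition unlabel :: "('l, 'l, 'a, 'b) fctr" where
  "unlabel = \<lparr>FO = (\<lambda>t. Dom J (arr_of t)), FA = arr_of\<rparr>"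

lemma arr_of_name [simp]: "f \<in> Arr J \<Longrightarrow> arr_of (\<psi> f) = f"
  using inj by simp

lemma unlabel_simps [simp]:
  "f \<in> Arr J \<Longrightarrow> FA unlabel (\<psi> f) = f" "a \<in> Obj J \<Longrightarrow> FO unlabel (obj_name a) = a"
  by (simp_all add: unlabel_def Ident_Arr Dom_Ident)

lemma relabel_simps [simp]:
  "Obj relabel = obj_name ` Obj J" "Arr relabel = \<psi> ` Arr J" "Ident relabel t = t"
  "f \<in> Arr J \<Longrightarrow> Dom relabel (\<psi> f) = obj_name (Dom J f)"
  "f \<in> Arr J \<Longrightarrow> Cod relabel (\<psi> f) = obj_name (Cod J f)"
  "f \<in> Arr J \<Longrightarrow> g \<in> Arr J \<Longrightarrow> \<psi> g \<cdot>\<^bsub>relabel\<^esub> \<psi> f = \<psi> (g \<cdot>\<^bsub>J\<^esub> f)"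
  by (simp_all add: relabel_def)

lemma obj_name_eq [simp]: "\<lbrakk>a \<in> Obj J; b \<in> Obj J\<rbrakk> \<Longrightarrow> obj_name a = obj_name b \<longleftrightarrow> a = b"
  by (metis unlabel_simps(2))

lemma category_relabel: "category relabel"
  by unfold_locales
    (auto simp: Dom_Obj Cod_Obj Ident_Arr Dom_Ident Cod_Ident Comp_Arr Dom_Comp Cod_Comp
      Comp_Ident Ident_Comp Comp_assoc)

lemma hom_relabel:
  "\<lbrakk>a \<in> Obj J; b \<in> Obj J\<rbrakk> \<Longrightarrow> t \<in> hom relabel (obj_name a) (obj_name b) \<longleftrightarrow> (\<exists>f\<in>hom J a b. t = \<psi> f)"
  by (auto simp: hom_def Dom_Obj Cod_Obj)

lemma functor_unlabel: "is_functor relabel J unlabel"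
  by (rule is_functorI)
    (auto simp: hom_def Dom_Obj Cod_Obj Ident_Arr Comp_Arr category_relabel category_axioms)

lemma filtered_relabel:
  assumes "filtered J"
  shows "filtered relabel"
proof -
  have J: "Obj J \<noteq> {}" "\<And>a b. \<lbrakk>a \<in> Obj J; b \<in> Obj J\<rbrakk> \<Longrightarrow> \<exists>c f g. f \<in> hom J a c \<and> g \<in> hom J b c"
    "\<And>a b f g. \<lbrakk>f \<in> hom J a b; g \<in> hom J a b\<rbrakk> \<Longrightarrow> \<exists>c. \<exists>h\<in>hom J b c. h \<cdot>\<^bsub>J\<^esub> f = h \<cdot>\<^bsub>J\<^esub> g"
    using assms unfolding filtered_def by blast+
  interpret R: category relabel by (rule category_relabel)
  show ?thesis
    unfolding filtered_def
  proof (intro conjI ballI allI, rule category_relabel)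
    show "Obj relabel \<noteq> {}" using J(1) by simp
    fix s t assume "s \<in> Obj relabel" "t \<in> Obj relabel"
    then obtain a b where ab: "a \<in> Obj J" "b \<in> Obj J" "s = obj_name a" "t = obj_name b" by auto
    obtain c f g where "f \<in> hom J a c" "g \<in> hom J b c" using J(2)[OF ab(1,2)] by blast
    then show "\<exists>u f g. f \<in> hom relabel s u \<and> g \<in> hom relabel t u"
      using hom_relabel ab hom_objs by metis
  next
    fix s t u v assume uv: "u \<in> hom relabel s t" "v \<in> hom relabel s t"
    then have "s \<in> Obj relabel" "t \<in> Obj relabel" using R.hom_objs by blast+
    then obtain a b where ab: "a \<in> Obj J" "b \<in> Obj J" "s = obj_name a" "t = obj_name b" by auto
    obtain f g where f: "f \<in> hom J a b" "u = \<psi> f" and g: "g \<in> hom J a b" "v = \<psi> g"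
      using uv ab hom_relabel by metis
    obtain c h where h: "h \<in> hom J b c" "h \<cdot>\<^bsub>J\<^esub> f = h \<cdot>\<^bsub>J\<^esub> g" using J(3)[OF f(1) g(1)] by blast
    have "\<psi> h \<in> hom relabel t (obj_name c)" using hom_relabel ab h hom_objs by blast
    moreover have "\<psi> h \<cdot>\<^bsub>relabel\<^esub> u = \<psi> h \<cdot>\<^bsub>relabel\<^esub> v"
      using f g h by (simp add: hom_def)
    ultimately show "\<exists>w. \<exists>h\<in>hom relabel t w. h \<cdot>\<^bsub>relabel\<^esub> u = h \<cdot>\<^bsub>relabel\<^esub> v" by blast
  qed
qed

lemma cocone_relabel:
  "is_cocone relabel D (comp_fctr F unlabel) w r \<longleftrightarrow> is_cocone J D F w (\<lambda>a. r (obj_name a))"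
  by (simp add: is_cocone_def comp_fctr_def)

lemma colimit_relabel:
  "is_colimit relabel D (comp_fctr F unlabel) l q \<longleftrightarrow> is_colimit J D F l (\<lambda>a. q (obj_name a))"
proof
  assume L: "is_colimit relabel D (comp_fctr F unlabel) l q"
  show "is_colimit J D F l (\<lambda>a. q (obj_name a))"
    unfolding is_colimit_def
  proof (intro conjI allI impI)
    show "is_cocone J D F l (\<lambda>a. q (obj_name a))"
      using L unfolding is_colimit_def cocone_relabel by (rule conjunct1)
    fix w r assume r: "is_cocone J D F w r"
    let ?r = "\<lambda>t. r (FO unlabel t)"
    have "is_cocone J D F w (\<lambda>a. ?r (obj_name a))"
      using r by (simp add: is_cocone_def Dom_Obj Cod_Obj)
    then have "is_cocone relabel D (comp_fctr F unlabel) w ?r" by (simp only: cocone_relabel)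
    then have "\<exists>!u. u \<in> hom D l w \<and> (\<forall>k\<in>Obj relabel. u \<cdot>\<^bsub>D\<^esub> q k = ?r k)"
      using L unfolding is_colimit_def by blast
    then show "\<exists>!u. u \<in> hom D l w \<and> (\<forall>k\<in>Obj J. u \<cdot>\<^bsub>D\<^esub> q (obj_name k) = r k)" by simp
  qed
next
  assume L: "is_colimit J D F l (\<lambda>a. q (obj_name a))"
  show "is_colimit relabel D (comp_fctr F unlabel) l q"
    unfolding is_colimit_def
  proof (intro conjI allI impI)
    show "is_cocone relabel D (comp_fctr F unlabel) l q"
      using L unfolding is_colimit_def cocone_relabel by (rule conjunct1)
    fix w r assume "is_cocone relabel D (comp_fctr F unlabel) w r"
    then have "is_cocone J D F w (\<lambda>a. r (obj_name a))" by (simp only: cocone_relabel)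
    then have "\<exists>!u. u \<in> hom D l w \<and> (\<forall>k\<in>Obj J. u \<cdot>\<^bsub>D\<^esub> q (obj_name k) = r (obj_name k))"
      using L unfolding is_colimit_def by blast
    then show "\<exists>!u. u \<in> hom D l w \<and> (\<forall>k\<in>Obj relabel. u \<cdot>\<^bsub>D\<^esub> q k = r k)" by simp
  qed
qed

end

text \<open>The conditions on filtered colimits speak of shapes whose objects and arrows lie in one fixed type.
  The ultrafilter, as a category, lives in another type; this is the bridge.\<close>

lemma small_category_relabelling:
  fixes J :: "('a, 'b) cat" and lam :: "'l rel"
  assumes "category J" "Card_order lam" "|Arr J| <o lam"
  obtains \<psi> :: "'b \<Rightarrow> 'l" where "relabelling J \<psi>" "|\<psi> ` Arr J| <o lam"
proof -
  have "|Arr J| \<le>o |Field lam|"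
    using assms(2,3) by (metis card_of_Field_ordIso ordIso_symmetric ordLess_imp_ordLeq ordLeq_ordIso_trans)
  then obtain \<psi> :: "'b \<Rightarrow> 'l" where \<psi>: "inj_on \<psi> (Arr J)"
    unfolding card_of_ordLeq[symmetric] by blast
  moreover have "|\<psi> ` Arr J| <o lam" using card_of_image[of \<psi> "Arr J"] assms(3) ordLeq_ordLess_trans by blast
  moreover have "relabelling J \<psi>"
    using assms(1) \<psi> by (simp add: relabelling_def relabelling_axioms_def)
  ultimately show thesis using that by blast
qed

lemma ex_filtered_colimit:
  fixes J :: "('a, 'b) cat" and lam :: "'l rel"
  assumes D: "has_filtered_colimits lam D" and lam: "Card_order lam"
    and J: "filtered J" "|Arr J| <o lam" and F: "is_functor J D F"
  shows "\<exists>l q. is_colimit J D F l q"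
proof -
  have "category J" using J unfolding filtered_def by blast
  then obtain \<psi> :: "'b \<Rightarrow> 'l" where "relabelling J \<psi>" and small: "|\<psi> ` Arr J| <o lam"
    by (rule small_category_relabelling[OF _ lam J(2)])
  then interpret relabelling J \<psi> by blast
  have "is_functor relabel D (comp_fctr F unlabel)" using functor_comp_fctr[OF functor_unlabel F] .
  then obtain l q where "is_colimit relabel D (comp_fctr F unlabel) l q"
    using D[unfolded has_filtered_colimits_def, rule_format, of relabel]
      filtered_relabel[OF J(1)] small by simp blast
  then show ?thesis unfolding colimit_relabel by blast
qed

text \<open>The exactness condition for colimits of one shape \<open>J\<close>, whatever the type of its objects and arrows.\<close>

definition colimits_commute_with_finite_limits :: "('a, 'b) cat \<Rightarrow> ('o, 'm) cat \<Rightarrow> bool" where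
  "colimits_commute_with_finite_limits J D \<longleftrightarrow>
     (\<forall>(K :: (nat, nat) cat) F L p Q q M m N n u.
        category K \<and> finite (Arr K) \<and> is_functor (prod_cat J K) D F \<and>
        is_functor J D L \<and>
        (\<forall>j\<in>Obj J. is_limit K D (fix_fst J F j) (FO L j) (p j)) \<and>
        (\<forall>f\<in>Arr J. \<forall>k\<in>Obj K.
           p (Cod J f) k \<cdot>\<^bsub>D\<^esub> FA L f = FA F (f, Ident K k) \<cdot>\<^bsub>D\<^esub> p (Dom J f) k) \<and>
        is_functor K D Q \<and>
        (\<forall>k\<in>Obj K. is_colimit J D (fix_snd K F k) (FO Q k) (q k)) \<and>
        (\<forall>g\<in>Arr K. \<forall>j\<in>Obj J.
           FA Q g \<cdot>\<^bsub>D\<^esub> q (Dom K g) j = q (Cod K g) j \<cdot>\<^bsub>D\<^esub> FA F (Ident J j, g)) \<and>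
        is_colimit J D L M m \<and> is_limit K D Q N n \<and>
        u \<in> hom D M N \<and>
        (\<forall>j\<in>Obj J. \<forall>k\<in>Obj K. n k \<cdot>\<^bsub>D\<^esub> (u \<cdot>\<^bsub>D\<^esub> m j) = q k j \<cdot>\<^bsub>D\<^esub> p j k)
        \<longrightarrow> is_iso D u)"

lemma filtered_colimits_commute:
  fixes J :: "('a, 'b) cat" and lam :: "'l rel"
  assumes D: "filtered_colimits_commute_with_finite_limits lam D" and lam: "Card_order lam"
    and J: "filtered J" "|Arr J| <o lam"
  shows "colimits_commute_with_finite_limits J D"
  unfolding colimits_commute_with_finite_limits_def
proof (intro allI impI, elim conjE)
  fix K :: "(nat, nat) cat" and F L p Q q M m N n u
  assume K: "category K" "finite (Arr K)" and F: "is_functor (prod_cat J K) D F"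
    and L: "is_functor J D L" "\<forall>j\<in>Obj J. is_limit K D (fix_fst J F j) (FO L j) (p j)"
      "\<forall>f\<in>Arr J. \<forall>k\<in>Obj K. p (Cod J f) k \<cdot>\<^bsub>D\<^esub> FA L f = FA F (f, Ident K k) \<cdot>\<^bsub>D\<^esub> p (Dom J f) k"
    and Q: "is_functor K D Q" "\<forall>k\<in>Obj K. is_colimit J D (fix_snd K F k) (FO Q k) (q k)"
      "\<forall>g\<in>Arr K. \<forall>j\<in>Obj J. FA Q g \<cdot>\<^bsub>D\<^esub> q (Dom K g) j = q (Cod K g) j \<cdot>\<^bsub>D\<^esub> FA F (Ident J j, g)"
    and M: "is_colimit J D L M m" and N: "is_limit K D Q N n" and u: "u \<in> hom D M N"
      "\<forall>j\<in>Obj J. \<forall>k\<in>Obj K. n k \<cdot>\<^bsub>D\<^esub> (u \<cdot>\<^bsub>D\<^esub> m j) = q k j \<cdot>\<^bsub>D\<^esub> p j k"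
  have "category J" using J unfolding filtered_def by blast
  then obtain \<psi> :: "'b \<Rightarrow> 'l" where "relabelling J \<psi>" and small: "|\<psi> ` Arr J| <o lam"
    by (rule small_category_relabelling[OF _ lam J(2)])
  then interpret relabelling J \<psi> by blast
  let ?N = "\<lparr>FO = map_prod (FO unlabel) id, FA = map_prod (FA unlabel) id\<rparr>"
  let ?F = "comp_fctr F ?N" and ?L = "comp_fctr L unlabel"
  let ?p = "\<lambda>t. p (FO unlabel t)" and ?q = "\<lambda>k t. q k (FO unlabel t)" and ?m = "\<lambda>t. m (FO unlabel t)"
  have fst: "fix_fst relabel ?F (obj_name j) = fix_fst J F j" if "j \<in> Obj J" for j
    using that by (simp add: fix_fst_def comp_fctr_def Ident_Arr)
  have snd: "fix_snd K ?F k = comp_fctr (fix_snd K F k) unlabel" for k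
    by (simp add: fix_snd_def comp_fctr_def comp_def)
  have c: "is_colimit relabel D (comp_fctr G unlabel) l (\<lambda>t. r (FO unlabel t))"
    if "is_colimit J D G l r" for G l r
  proof -
    have "is_colimit J D G l (\<lambda>a. r (FO unlabel (obj_name a)))"
      using that unfolding is_colimit_def is_cocone_def by (simp add: Dom_Obj Cod_Obj)
    then show ?thesis by (simp only: colimit_relabel)
  qed
  have 1: "filtered relabel" "|Arr relabel| <o lam"
    using filtered_relabel[OF J(1)] small by auto
  have 2: "is_functor (prod_cat relabel K) D ?F" "is_functor relabel D ?L"
    using functor_comp_fctr[OF functor_prod_cat[OF functor_unlabel K(1)] F]
      functor_comp_fctr[OF functor_unlabel L(1)] by auto
  have 3: "\<forall>j\<in>Obj relabel. is_limit K D (fix_fst relabel ?F j) (FO ?L j) (?p j)"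
    using L(2) fst by (simp add: comp_fctr_def)
  have 4: "\<forall>f\<in>Arr relabel. \<forall>k\<in>Obj K.
      ?p (Cod relabel f) k \<cdot>\<^bsub>D\<^esub> FA ?L f = FA ?F (f, Ident K k) \<cdot>\<^bsub>D\<^esub> ?p (Dom relabel f) k"
    using L(3) by (simp add: comp_fctr_def Dom_Obj Cod_Obj)
  have 5: "\<forall>k\<in>Obj K. is_colimit relabel D (fix_snd K ?F k) (FO Q k) (?q k)"
    using Q(2) c snd by simp
  have 6: "\<forall>g\<in>Arr K. \<forall>j\<in>Obj relabel.
      FA Q g \<cdot>\<^bsub>D\<^esub> ?q (Dom K g) j = ?q (Cod K g) j \<cdot>\<^bsub>D\<^esub> FA ?F (Ident relabel j, g)"
    using Q(3) by (simp add: comp_fctr_def Ident_Arr)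
  have 7: "\<forall>j\<in>Obj relabel. \<forall>k\<in>Obj K. n k \<cdot>\<^bsub>D\<^esub> (u \<cdot>\<^bsub>D\<^esub> ?m j) = ?q k j \<cdot>\<^bsub>D\<^esub> ?p j k"
    using u(2) by simp
  show "is_iso D u"
    using D[unfolded filtered_colimits_commute_with_finite_limits_def, rule_format,
        of relabel K ?F ?L ?p Q ?q M ?m N n u]
      1 2 3 4 5 6 7 K Q(1) c[OF M] N u(1) by blast
qed


subsection \<open>Index sets of products and meets\<close>

lemma product_reindex:
  assumes h: "inj_on h J" and x: "\<And>i. i \<in> J \<Longrightarrow> x' (h i) = x i" and p: "\<And>i. i \<in> J \<Longrightarrow> p' (h i) = p i"
  shows "is_product D (h ` J) x' P p' \<longleftrightarrow> is_product D J x P p"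
proof -
  have "(\<forall>r. (\<forall>i\<in>h ` J. r i \<in> hom D w (x' i)) \<longrightarrow> (\<exists>!u. u \<in> hom D w P \<and> (\<forall>i\<in>h ` J. p' i \<cdot>\<^bsub>D\<^esub> u = r i)))
    \<longleftrightarrow> (\<forall>r. (\<forall>i\<in>J. r i \<in> hom D w (x i)) \<longrightarrow> (\<exists>!u. u \<in> hom D w P \<and> (\<forall>i\<in>J. p i \<cdot>\<^bsub>D\<^esub> u = r i)))"
    (is "?l \<longleftrightarrow> ?r") for w
  proof
    assume l: ?l
    show ?r
    proof (intro allI impI)
      fix r assume r: "\<forall>i\<in>J. r i \<in> hom D w (x i)"
      then show "\<exists>!u. u \<in> hom D w P \<and> (\<forall>i\<in>J. p i \<cdot>\<^bsub>D\<^esub> u = r i)"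
        using l[THEN spec, of "\<lambda>t. r (inv_into J h t)"] h x p by simp
    qed
  next
    assume l: ?r
    show ?l
    proof (intro allI impI)
      fix r assume r: "\<forall>i\<in>h ` J. r i \<in> hom D w (x' i)"
      then show "\<exists>!u. u \<in> hom D w P \<and> (\<forall>i\<in>h ` J. p' i \<cdot>\<^bsub>D\<^esub> u = r i)"
        using l[THEN spec, of "\<lambda>i. r (h i)"] h x p by simp
    qed
  qed
  then show ?thesis using x p unfolding is_product_def by simp
qed

lemma small_index_embedding:
  fixes I :: "'i set" and \<kappa> :: "'k rel"
  assumes \<kappa>: "Card_order \<kappa>" and I: "|I| <o \<kappa>"
  obtains h :: "'i \<Rightarrow> 'k" where "inj_on h I" "\<And>J. J \<subseteq> I \<Longrightarrow> |h ` J| <o \<kappa>"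
proof -
  have "|I| \<le>o |Field \<kappa>|"
    using assms by (metis card_of_Field_ordIso ordIso_symmetric ordLess_imp_ordLeq ordLeq_ordIso_trans)
  then obtain h :: "'i \<Rightarrow> 'k" where h: "inj_on h I"
    unfolding card_of_ordLeq[symmetric] by blast
  moreover have "|h ` J| <o \<kappa>" if "J \<subseteq> I" for J
    using card_of_image[of h J] card_of_mono1[OF that] I by (meson ordLeq_ordLess_trans ordLeq_transitive)
  ultimately show thesis using that by blast
qed

text \<open>This is where \<open>2\<^sup>\<gamma> < \<lambda>\<close> enters: there are at most \<open>2 ^ |I|\<close> sets in an ultrafilter on \<open>I\<close>.\<close>

lemma ultra_cat_small:
  fixes I :: "'i set" and \<kappa> :: "'k rel" and lam :: "'l rel"
  assumes \<kappa>: "Card_order \<kappa>" and lam: "Cinfinite lam" and I: "|I| <o \<kappa>"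
    and exp: "\<And>A :: 'k set. |A| <o \<kappa> \<Longrightarrow> ctwo ^c |A| <o lam" and U: "U \<subseteq> Pow I"
  shows "|Arr (ultra_cat U)| <o lam"
proof -
  obtain h :: "'i \<Rightarrow> 'k" where h: "inj_on h I" and small: "\<And>J. J \<subseteq> I \<Longrightarrow> |h ` J| <o \<kappa>"
    by (rule small_index_embedding[OF \<kappa> I]) blast
  have "|Pow (h ` I)| =o ctwo ^c |h ` I|"
    using card_of_Pow_Func[of "h ` I"] by (simp add: cexp_def ctwo_def Field_card_of)
  then have "|Pow (h ` I)| <o lam" using exp[OF small[OF subset_refl]] ordIso_ordLess_trans by blast
  moreover have "|U| \<le>o |Pow (h ` I)|"
  proof -
    have "inj_on ((`) h) U" using inj_on_image_Pow[OF h] U by (rule inj_on_subset)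
    moreover have "((`) h) ` U \<subseteq> Pow (h ` I)" using U by auto
    ultimately show ?thesis unfolding card_of_ordLeq[symmetric] by blast
  qed
  ultimately have U: "|U| <o lam" using ordLeq_ordLess_trans by blast
  have "|U \<times> U| <o lam"
  proof (cases "finite U")
    case True
    then show ?thesis
      using lam card_order_on_well_order_on[of "Field lam" lam] card_of_Well_order
      unfolding cinfinite_def by (intro finite_ordLess_infinite) (auto simp: Field_card_of)
  next
    case False
    then show ?thesis using card_of_Times_same_infinite U ordIso_ordLess_trans by blast
  qed
  moreover have "Arr (ultra_cat U) \<subseteq> U \<times> U" by (auto simp: ultra_cat_def)
  ultimately show ?thesis using card_of_mono1 ordLeq_ordLess_trans by blast
qed


section \<open>Products of families\<close>

lemma limit_cong:
  assumes "\<And>k. k \<in> Obj K \<Longrightarrow> FO F k = FO G k" "\<And>g. g \<in> Arr K \<Longrightarrow> FA F g = FA G g"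
  shows "is_limit K D F l p \<longleftrightarrow> is_limit K D G l p"
proof -
  have "is_cone K D F w r \<longleftrightarrow> is_cone K D G w r" for w r
    using assms by (simp add: is_cone_def)
  then show ?thesis by (simp add: is_limit_def)
qed

lemma colimit_cong:
  assumes "\<And>k. k \<in> Obj K \<Longrightarrow> FO F k = FO G k" "\<And>g. g \<in> Arr K \<Longrightarrow> FA F g = FA G g"
  shows "is_colimit K D F l p \<longleftrightarrow> is_colimit K D G l p"
proof -
  have "is_cocone K D F w r \<longleftrightarrow> is_cocone K D G w r" for w r
    using assms by (simp add: is_cocone_def)
  then show ?thesis by (simp add: is_colimit_def)
qed

lemma limit_unique_arrow:
  assumes "is_limit K D F l p" "u \<in> hom D w l" "v \<in> hom D w l" "is_cone K D F w (\<lambda>k. p k \<cdot>\<^bsub>D\<^esub> v)"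
    "\<And>k. k \<in> Obj K \<Longrightarrow> p k \<cdot>\<^bsub>D\<^esub> u = p k \<cdot>\<^bsub>D\<^esub> v"
  shows "u = v"
  using assms unfolding is_limit_def by blast

locale small_products = category D for D :: "('o, 'm) cat" (structure) +
  fixes I :: "'i set"
  assumes ex_product: "\<lbrakk>J \<subseteq> I; \<forall>i\<in>J. x i \<in> Obj D\<rbrakk> \<Longrightarrow> \<exists>P p. is_product D J x P p"
begin

lemma prod_is_product:
  assumes "J \<subseteq> I" "\<forall>i\<in>J. x i \<in> Obj D"
  shows "is_product D J x (prod_obj D J x) (prod_proj D J x)"
proof -
  have "\<exists>c. case c of (P, p) \<Rightarrow> is_product D J x P p" using ex_product[of J x] assms by simp
  then have "case prod_cone D J x of (P, p) \<Rightarrow> is_product D J x P p"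
    unfolding prod_cone_def by (rule someI_ex)
  then show ?thesis by (simp add: prod_obj_def prod_proj_def split: prod.splits)
qed

lemma prod_obj: "\<lbrakk>J \<subseteq> I; \<forall>i\<in>J. x i \<in> Obj D\<rbrakk> \<Longrightarrow> prod_obj D J x \<in> Obj D"
  using prod_is_product unfolding is_product_def by blast

lemma proj_hom:
  "\<lbrakk>J \<subseteq> I; \<forall>i\<in>J. x i \<in> Obj D; i \<in> J\<rbrakk> \<Longrightarrow> prod_proj D J x i \<in> hom D (prod_obj D J x) (x i)"
  using prod_is_product unfolding is_product_def by blast

lemma prod_tuple:
  assumes "J \<subseteq> I" "\<forall>i\<in>J. r i \<in> hom D w (x i)" "w \<in> Obj D"
  shows "\<exists>!t. t \<in> hom D w (prod_obj D J x) \<and> (\<forall>i\<in>J. prod_proj D J x i \<cdot> t = r i)"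
proof -
  have "is_product D J x (prod_obj D J x) (prod_proj D J x)"
    using prod_is_product[OF assms(1)] assms(2) hom_objs by blast
  then show ?thesis using assms(2,3) unfolding is_product_def by blast
qed

lemma prod_ext:
  assumes J: "J \<subseteq> I" and x: "\<forall>i\<in>J. x i \<in> Obj D"
    and s: "s \<in> hom D w (prod_obj D J x)" and t: "t \<in> hom D w (prod_obj D J x)"
    and eq: "\<And>i. i \<in> J \<Longrightarrow> prod_proj D J x i \<cdot> s = prod_proj D J x i \<cdot> t"
  shows "s = t"
proof -
  have "\<exists>!u. u \<in> hom D w (prod_obj D J x) \<and> (\<forall>i\<in>J. prod_proj D J x i \<cdot> u = prod_proj D J x i \<cdot> s)"
    using comp_hom[OF proj_hom[OF J x] s] s hom_objs by (intro prod_tuple[OF J]) blast+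
  then show ?thesis using s t eq by metis
qed

lemma prod_map_spec:
  assumes J: "J \<subseteq> I" and f: "\<forall>i\<in>J. f i \<in> hom D (x i) (y i)"
  shows "prod_map D J x y f \<in> hom D (prod_obj D J x) (prod_obj D J y) \<and>
    (\<forall>i\<in>J. prod_proj D J y i \<cdot> prod_map D J x y f = f i \<cdot> prod_proj D J x i)"
proof -
  have x: "\<forall>i\<in>J. x i \<in> Obj D" using f hom_objs by blast
  have "\<exists>!t. t \<in> hom D (prod_obj D J x) (prod_obj D J y) \<and>
      (\<forall>i\<in>J. prod_proj D J y i \<cdot> t = f i \<cdot> prod_proj D J x i)"
    using comp_hom[OF bspec[OF f] proj_hom[OF J x]] prod_obj[OF J x] by (intro prod_tuple[OF J]) blast+
  from theI'[OF this] show ?thesis unfolding prod_map_def .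
qed

lemma prod_map_hom:
  "\<lbrakk>J \<subseteq> I; \<forall>i\<in>J. f i \<in> hom D (x i) (y i)\<rbrakk> \<Longrightarrow>
    prod_map D J x y f \<in> hom D (prod_obj D J x) (prod_obj D J y)"
  using prod_map_spec by blast

lemma prod_map_proj:
  "\<lbrakk>J \<subseteq> I; \<forall>i\<in>J. f i \<in> hom D (x i) (y i); i \<in> J\<rbrakk> \<Longrightarrow>
    prod_proj D J y i \<cdot> prod_map D J x y f = f i \<cdot> prod_proj D J x i"
  using prod_map_spec by blast

lemma prod_restrict_spec:
  assumes J: "J \<subseteq> I" "J' \<subseteq> J" and x: "\<forall>i\<in>J. x i \<in> Obj D"
  shows "prod_restrict D J J' x \<in> hom D (prod_obj D J x) (prod_obj D J' x) \<and>
    (\<forall>i\<in>J'. prod_proj D J' x i \<cdot> prod_restrict D J J' x = prod_proj D J x i)"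
proof -
  have J': "J' \<subseteq> I" using J by blast
  have "\<exists>!t. t \<in> hom D (prod_obj D J x) (prod_obj D J' x) \<and>
      (\<forall>i\<in>J'. prod_proj D J' x i \<cdot> t = prod_proj D J x i)"
    using proj_hom[OF J(1) x] J(2) prod_obj[OF J(1) x] by (intro prod_tuple[OF J']) blast+
  from theI'[OF this] show ?thesis unfolding prod_restrict_def .
qed

lemma prod_restrict_hom:
  "\<lbrakk>J \<subseteq> I; J' \<subseteq> J; \<forall>i\<in>J. x i \<in> Obj D\<rbrakk> \<Longrightarrow>
    prod_restrict D J J' x \<in> hom D (prod_obj D J x) (prod_obj D J' x)"
  using prod_restrict_spec by blast

lemma prod_restrict_proj:
  "\<lbrakk>J \<subseteq> I; J' \<subseteq> J; \<forall>i\<in>J. x i \<in> Obj D; i \<in> J'\<rbrakk> \<Longrightarrow>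
    prod_proj D J' x i \<cdot> prod_restrict D J J' x = prod_proj D J x i"
  using prod_restrict_spec by blast

text \<open>The maps and objects chosen for a product depend on the families as total functions, but the
  induced arrow depends on the arrows \<open>f i\<close> only for \<open>i \<in> J\<close>.\<close>

lemma prod_map_cong:
  "(\<And>i. i \<in> J \<Longrightarrow> f i = g i) \<Longrightarrow> prod_map D J x y f = prod_map D J x y g"
  unfolding prod_map_def by (rule arg_cong[of _ _ The]) (auto simp: fun_eq_iff)

lemma prod_map_comp:
  assumes J: "J \<subseteq> I" and f: "\<forall>i\<in>J. f i \<in> hom D (x i) (y i)"
    and g: "\<forall>i\<in>J. g i \<in> hom D (y i) (z i)"
  shows "prod_map D J x z (\<lambda>i. g i \<cdot> f i) = prod_map D J y z g \<cdot> prod_map D J x y f"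
proof -
  have x: "\<forall>i\<in>J. x i \<in> Obj D" and y: "\<forall>i\<in>J. y i \<in> Obj D"
    and z: "\<forall>i\<in>J. z i \<in> Obj D" using f g hom_objs by blast+
  have gf: "\<forall>i\<in>J. g i \<cdot> f i \<in> hom D (x i) (z i)" using comp_hom f g by blast
  note hf = prod_map_hom[OF J f] and hg = prod_map_hom[OF J g]
  show ?thesis
  proof (rule prod_ext[OF J z prod_map_hom[OF J gf] comp_hom[OF hg hf]])
    fix i assume i: "i \<in> J"
    have "prod_proj D J z i \<cdot> (prod_map D J y z g \<cdot> prod_map D J x y f)
        = (g i \<cdot> prod_proj D J y i) \<cdot> prod_map D J x y f"
      using assoc_hom[OF hf hg proj_hom[OF J z i]] prod_map_proj[OF J g i] by simp
    also have "\<dots> = g i \<cdot> (f i \<cdot> prod_proj D J x i)"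
      using assoc_hom[OF hf proj_hom[OF J y i] bspec[OF g i]] prod_map_proj[OF J f i] by simp
    also have "\<dots> = prod_proj D J z i \<cdot> prod_map D J x z (\<lambda>i. g i \<cdot> f i)"
      using assoc_hom[OF proj_hom[OF J x i] bspec[OF f i] bspec[OF g i]] prod_map_proj[OF J gf i] by simp
    finally show "prod_proj D J z i \<cdot> prod_map D J x z (\<lambda>i. g i \<cdot> f i) =
        prod_proj D J z i \<cdot> (prod_map D J y z g \<cdot> prod_map D J x y f)" by simp
  qed
qed

lemma prod_map_ident:
  assumes J: "J \<subseteq> I" and x: "\<forall>i\<in>J. x i \<in> Obj D"
  shows "prod_map D J x x (\<lambda>i. Ident D (x i)) = Ident D (prod_obj D J x)"
proof -
  have i: "\<forall>i\<in>J. Ident D (x i) \<in> hom D (x i) (x i)" using x ident_hom by blast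
  show ?thesis
    using prod_map_proj[OF J i] comp_ident[OF proj_hom[OF J x]] ident_comp[OF proj_hom[OF J x]]
    by (intro prod_ext[OF J x prod_map_hom[OF J i] ident_hom[OF prod_obj[OF J x]]]) simp
qed

lemma prod_restrict_self:
  assumes J: "J \<subseteq> I" and x: "\<forall>i\<in>J. x i \<in> Obj D"
  shows "prod_restrict D J J x = Ident D (prod_obj D J x)"
  using prod_restrict_proj[OF J subset_refl x] comp_ident[OF proj_hom[OF J x]]
  by (intro prod_ext[OF J x prod_restrict_hom[OF J subset_refl x] ident_hom[OF prod_obj[OF J x]]]) simp

lemma prod_restrict_trans:
  assumes J: "J \<subseteq> I" "J' \<subseteq> J" "J'' \<subseteq> J'" and x: "\<forall>i\<in>J. x i \<in> Obj D"
  shows "prod_restrict D J' J'' x \<cdot> prod_restrict D J J' x = prod_restrict D J J'' x"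
proof -
  have J': "J' \<subseteq> I" "J'' \<subseteq> I" "J'' \<subseteq> J" and x': "\<forall>i\<in>J'. x i \<in> Obj D"
    and x'': "\<forall>i\<in>J''. x i \<in> Obj D" using J x by auto
  note h1 = prod_restrict_hom[OF J(1,2) x] and h2 = prod_restrict_hom[OF J'(1) J(3) x']
  show ?thesis
  proof (rule prod_ext[OF J'(2) x'' comp_hom[OF h2 h1] prod_restrict_hom[OF J(1) J'(3) x]])
    fix i assume i: "i \<in> J''"
    then have "prod_proj D J'' x i \<cdot> (prod_restrict D J' J'' x \<cdot> prod_restrict D J J' x)
        = prod_proj D J' x i \<cdot> prod_restrict D J J' x"
      using assoc_hom[OF h1 h2 proj_hom[OF J'(2) x'' i]] prod_restrict_proj[OF J'(1) J(3) x' i] by simp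
    also have "\<dots> = prod_proj D J'' x i \<cdot> prod_restrict D J J'' x"
      using prod_restrict_proj[OF J(1,2) x, of i] prod_restrict_proj[OF J(1) J'(3) x i] i J by auto
    finally show "prod_proj D J'' x i \<cdot> (prod_restrict D J' J'' x \<cdot> prod_restrict D J J' x)
        = prod_proj D J'' x i \<cdot> prod_restrict D J J'' x" .
  qed
qed

lemma prod_restrict_natural:
  assumes J: "J \<subseteq> I" "J' \<subseteq> J" and f: "\<forall>i\<in>J. f i \<in> hom D (x i) (y i)"
  shows "prod_restrict D J J' y \<cdot> prod_map D J x y f = prod_map D J' x y f \<cdot> prod_restrict D J J' x"
proof -
  have J': "J' \<subseteq> I" and f': "\<forall>i\<in>J'. f i \<in> hom D (x i) (y i)" using J f by auto
  have x: "\<forall>i\<in>J. x i \<in> Obj D" and y: "\<forall>i\<in>J. y i \<in> Obj D" using f hom_objs by blast+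
  have x': "\<forall>i\<in>J'. x i \<in> Obj D" and y': "\<forall>i\<in>J'. y i \<in> Obj D" using J x y by blast+
  note rx = prod_restrict_hom[OF J x] and ry = prod_restrict_hom[OF J y]
  note fJ = prod_map_hom[OF J(1) f] and fJ' = prod_map_hom[OF J' f']
  show ?thesis
  proof (rule prod_ext[OF J' y' comp_hom[OF ry fJ] comp_hom[OF fJ' rx]])
    fix i assume i: "i \<in> J'"
    then have iJ: "i \<in> J" using J by blast
    have "prod_proj D J' y i \<cdot> (prod_restrict D J J' y \<cdot> prod_map D J x y f)
        = f i \<cdot> prod_proj D J x i"
      using assoc_hom[OF fJ ry proj_hom[OF J' y' i]] prod_restrict_proj[OF J y i]
        prod_map_proj[OF J(1) f iJ] by simp
    also have "\<dots> = f i \<cdot> (prod_proj D J' x i \<cdot> prod_restrict D J J' x)"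
      using prod_restrict_proj[OF J x i] by simp
    also have "\<dots> = prod_proj D J' y i \<cdot> (prod_map D J' x y f \<cdot> prod_restrict D J J' x)"
      using assoc_hom[OF rx proj_hom[OF J' x' i] bspec[OF f' i]] assoc_hom[OF rx fJ' proj_hom[OF J' y' i]]
        prod_map_proj[OF J' f' i] by simp
    finally show "prod_proj D J' y i \<cdot> (prod_restrict D J J' y \<cdot> prod_map D J x y f) =
        prod_proj D J' y i \<cdot> (prod_map D J' x y f \<cdot> prod_restrict D J J' x)" .
  qed
qed

definition prod_fctr ::
    "('p, 'n) cat \<Rightarrow> 'i set \<Rightarrow> ('i \<Rightarrow> ('p, 'n, 'o, 'm) fctr) \<Rightarrow> ('p, 'n, 'o, 'm) fctr" where
  "prod_fctr K J H = \<lparr>FO = (\<lambda>k. prod_obj D J (\<lambda>i. FO (H i) k)),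
     FA = (\<lambda>g. prod_map D J (\<lambda>i. FO (H i) (Dom K g)) (\<lambda>i. FO (H i) (Cod K g)) (\<lambda>i. FA (H i) g))\<rparr>"

text \<open>Limits commute with products: a cone over the product diagram is a family of cones over the factors.\<close>

lemma prod_limit:
  assumes J: "J \<subseteq> I" and H: "\<And>i. i \<in> J \<Longrightarrow> is_functor K D (H i)"
    and K: "category K"
    and L: "\<And>i. i \<in> J \<Longrightarrow> is_limit K D (H i) (l i) (p i)"
  shows "is_limit K D (prod_fctr K J H) (prod_obj D J l)
    (\<lambda>k. prod_map D J l (\<lambda>i. FO (H i) k) (\<lambda>i. p i k))"
proof -
  interpret K: category K by fact
  let ?H = "\<lambda>k i. FO (H i) k"
  let ?p = "\<lambda>k. prod_map D J l (?H k) (\<lambda>i. p i k)"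
  have cone: "\<And>i. i \<in> J \<Longrightarrow> is_cone K D (H i) (l i) (p i)" using L unfolding is_limit_def by blast
  have l: "\<forall>i\<in>J. l i \<in> Obj D" using cone unfolding is_cone_def by blast
  have p: "\<And>k. k \<in> Obj K \<Longrightarrow> \<forall>i\<in>J. p i k \<in> hom D (l i) (?H k i)"
    using cone unfolding is_cone_def by blast
  have pn: "\<And>i g. \<lbrakk>i \<in> J; g \<in> Arr K\<rbrakk> \<Longrightarrow> FA (H i) g \<cdot> p i (Dom K g) = p i (Cod K g)"
    using cone unfolding is_cone_def by blast
  have h: "\<And>g. g \<in> Arr K \<Longrightarrow> \<forall>i\<in>J. FA (H i) g \<in> hom D (?H (Dom K g) i) (?H (Cod K g) i)"
    using functor_hom[OF H] by blast
  have o: "\<And>k. k \<in> Obj K \<Longrightarrow> \<forall>i\<in>J. ?H k i \<in> Obj D" using functor_obj[OF H] by blast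
  note ph = prod_map_hom[OF J p]
  have proj: "prod_proj D J (?H k) i \<cdot> (?p k \<cdot> t) = p i k \<cdot> (prod_proj D J l i \<cdot> t)"
    if "k \<in> Obj K" "i \<in> J" "t \<in> hom D w (prod_obj D J l)" for k i t w
    using assoc_hom[OF that(3) ph[OF that(1)] proj_hom[OF J o[OF that(1)] that(2)]]
      assoc_hom[OF that(3) proj_hom[OF J l that(2)] bspec[OF p[OF that(1)] that(2)]]
      prod_map_proj[OF J p[OF that(1)] that(2)] that(1) by simp
  show ?thesis
    unfolding is_limit_def
  proof (intro conjI allI impI)
    show "is_cone K D (prod_fctr K J H) (prod_obj D J l) ?p"
      unfolding is_cone_def
    proof (intro conjI ballI)
      show "prod_obj D J l \<in> Obj D" using prod_obj[OF J l] .
      show "?p k \<in> hom D (prod_obj D J l) (FO (prod_fctr K J H) k)" if "k \<in> Obj K" for k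
        using ph[OF that] that by (simp add: prod_fctr_def)
      fix g assume g: "g \<in> Arr K"
      have "FA (prod_fctr K J H) g \<cdot> ?p (Dom K g)
          = prod_map D J l (?H (Cod K g)) (\<lambda>i. FA (H i) g \<cdot> p i (Dom K g))"
        using prod_map_comp[OF J p h] g K.Dom_Obj by (simp add: prod_fctr_def)
      also have "\<dots> = ?p (Cod K g)"
        using pn g by (intro prod_map_cong) simp
      finally show "FA (prod_fctr K J H) g \<cdot> ?p (Dom K g) = ?p (Cod K g)" .
    qed
    fix w r assume r: "is_cone K D (prod_fctr K J H) w r"
    have w: "w \<in> Obj D" using r unfolding is_cone_def by blast
    have rh: "\<And>k. k \<in> Obj K \<Longrightarrow> r k \<in> hom D w (prod_obj D J (?H k))"
      using r unfolding is_cone_def by (simp add: prod_fctr_def)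
    have rn: "\<And>g. g \<in> Arr K \<Longrightarrow>
        prod_map D J (?H (Dom K g)) (?H (Cod K g)) (\<lambda>i. FA (H i) g) \<cdot> r (Dom K g) = r (Cod K g)"
      using r unfolding is_cone_def by (simp add: prod_fctr_def)
    have ri: "is_cone K D (H i) w (\<lambda>k. prod_proj D J (?H k) i \<cdot> r k)" if i: "i \<in> J" for i
      unfolding is_cone_def
    proof (intro conjI ballI, rule w)
      show "prod_proj D J (?H k) i \<cdot> r k \<in> hom D w (?H k i)" if "k \<in> Obj K" for k
        using comp_hom[OF proj_hom[OF J o i] rh] that by simp
      fix g assume g: "g \<in> Arr K"
      then have dc: "Dom K g \<in> Obj K" "Cod K g \<in> Obj K" using K.Dom_Obj K.Cod_Obj by auto
      let ?m = "prod_map D J (?H (Dom K g)) (?H (Cod K g)) (\<lambda>i. FA (H i) g)"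
      have m: "?m \<in> hom D (prod_obj D J (?H (Dom K g))) (prod_obj D J (?H (Cod K g)))"
        using prod_map_hom[OF J h[OF g]] by simp
      have "prod_proj D J (?H (Cod K g)) i \<cdot> r (Cod K g) = (prod_proj D J (?H (Cod K g)) i \<cdot> ?m) \<cdot> r (Dom K g)"
        using assoc_hom[OF rh[OF dc(1)] m proj_hom[OF J o[OF dc(2)] i]] rn[OF g] dc(2) by simp
      also have "\<dots> = FA (H i) g \<cdot> (prod_proj D J (?H (Dom K g)) i \<cdot> r (Dom K g))"
        using assoc_hom[OF rh[OF dc(1)] proj_hom[OF J o[OF dc(1)] i] bspec[OF h[OF g] i]]
          prod_map_proj[OF J h[OF g] i] dc by simp
      finally show "FA (H i) g \<cdot> (prod_proj D J (?H (Dom K g)) i \<cdot> r (Dom K g)) =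
          prod_proj D J (?H (Cod K g)) i \<cdot> r (Cod K g)" by simp
    qed
    then have "\<forall>i\<in>J. \<exists>u. u \<in> hom D w (l i) \<and> (\<forall>k\<in>Obj K. p i k \<cdot> u = prod_proj D J (?H k) i \<cdot> r k)"
      using L unfolding is_limit_def by blast
    then obtain v where v: "\<forall>i\<in>J. v i \<in> hom D w (l i)"
      "\<And>i k. \<lbrakk>i \<in> J; k \<in> Obj K\<rbrakk> \<Longrightarrow> p i k \<cdot> v i = prod_proj D J (?H k) i \<cdot> r k"
      by metis
    obtain t where t: "t \<in> hom D w (prod_obj D J l)" "\<forall>i\<in>J. prod_proj D J l i \<cdot> t = v i"
      using prod_tuple[OF J v(1) w] by blast
    show "\<exists>!u. u \<in> hom D w (prod_obj D J l) \<and> (\<forall>k\<in>Obj K. ?p k \<cdot> u = r k)"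
    proof (intro ex1I conjI ballI, rule t(1))
      fix k assume k: "k \<in> Obj K"
      show "?p k \<cdot> t = r k"
        by (rule prod_ext[OF J o[OF k] comp_hom[OF ph[OF k] t(1)] rh[OF k]])
          (simp_all add: proj[OF k _ t(1)] t(2) v(2) k)
    next
      fix u assume u: "u \<in> hom D w (prod_obj D J l) \<and> (\<forall>k\<in>Obj K. ?p k \<cdot> u = r k)"
      then have uh: "u \<in> hom D w (prod_obj D J l)" and ur: "\<And>k. k \<in> Obj K \<Longrightarrow> ?p k \<cdot> u = r k" by auto
      show "u = t"
      proof (rule prod_ext[OF J l uh t(1)])
        fix i assume i: "i \<in> J"
        show "prod_proj D J l i \<cdot> u = prod_proj D J l i \<cdot> t"
        proof (rule limit_unique_arrow[OF L[OF i]])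
          show "prod_proj D J l i \<cdot> u \<in> hom D w (l i)" "prod_proj D J l i \<cdot> t \<in> hom D w (l i)"
            using comp_hom[OF proj_hom[OF J l i]] uh t(1) by blast+
          show "p i k \<cdot> (prod_proj D J l i \<cdot> u) = p i k \<cdot> (prod_proj D J l i \<cdot> t)" if "k \<in> Obj K" for k
            using proj[OF that i uh] ur[OF that] bspec[OF t(2) i] v(2)[OF i that] by simp
          show "is_cone K D (H i) w (\<lambda>k. p i k \<cdot> (prod_proj D J l i \<cdot> t))"
            using ri[OF i] bspec[OF t(2) i] v(2)[OF i] K.Dom_Obj K.Cod_Obj unfolding is_cone_def by simp
        qed
      qed
    qed
  qed
qed

end


section \<open>Functoriality of ultraproducts\<close>

lemma ultra_cat_simps [simp]:
  "Obj (ultra_cat U) = U" "Arr (ultra_cat U) = {(J, J'). J \<in> U \<and> J' \<in> U \<and> J' \<subseteq> J}"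
  "Dom (ultra_cat U) = fst" "Cod (ultra_cat U) = snd" "Ident (ultra_cat U) J = (J, J)"
  "g \<cdot>\<^bsub>ultra_cat U\<^esub> f = (fst f, snd g)"
  by (simp_all add: ultra_cat_def)

lemma category_ultra_cat: "category (ultra_cat U)"
  by unfold_locales fastforce+

lemma filtered_ultra_cat:
  assumes "is_ultrafilter I U"
  shows "filtered (ultra_cat U)"
proof -
  have U: "U \<noteq> {}" "\<And>A B. \<lbrakk>A \<in> U; B \<in> U\<rbrakk> \<Longrightarrow> A \<inter> B \<in> U"
    using assms unfolding is_ultrafilter_def by auto
  show ?thesis
    unfolding filtered_def
  proof (intro conjI ballI allI, rule category_ultra_cat)
    show "Obj (ultra_cat U) \<noteq> {}" using U by simp
    fix a b assume "a \<in> Obj (ultra_cat U)" "b \<in> Obj (ultra_cat U)"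
    then have "(a, a \<inter> b) \<in> hom (ultra_cat U) a (a \<inter> b)" "(b, a \<inter> b) \<in> hom (ultra_cat U) b (a \<inter> b)"
      using U(2) by (auto simp: hom_def)
    then show "\<exists>c f g. f \<in> hom (ultra_cat U) a c \<and> g \<in> hom (ultra_cat U) b c" by blast
  next
    fix a b f g assume "f \<in> hom (ultra_cat U) a b" "g \<in> hom (ultra_cat U) a b"
    then have "f = g" "(b, b) \<in> hom (ultra_cat U) b b" by (auto simp: hom_def)
    then show "\<exists>c. \<exists>h\<in>hom (ultra_cat U) b c. h \<cdot>\<^bsub>ultra_cat U\<^esub> f = h \<cdot>\<^bsub>ultra_cat U\<^esub> g" by blast
  qed
qed

text \<open>Only the colimits of the shape \<open>U\<close> are assumed here, in order to keep cardinals out of the way.\<close>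

locale ultraproducts = small_products D I for D :: "('o, 'm) cat" (structure) and I :: "'i set" +
  fixes U :: "'i set set"
  assumes ultrafilter: "is_ultrafilter I U"
    and ex_ultra_colimit: "is_functor (ultra_cat U) D F \<Longrightarrow> \<exists>l q. is_colimit (ultra_cat U) D F l q"
begin

lemma U_subset: "J \<in> U \<Longrightarrow> J \<subseteq> I"
  and U_Int: "\<lbrakk>J \<in> U; J' \<in> U\<rbrakk> \<Longrightarrow> J \<inter> J' \<in> U"
  and U_nonempty: "J \<in> U \<Longrightarrow> J \<noteq> {}"
  and U_I: "I \<in> U"
  and U_compl: "J \<subseteq> I \<Longrightarrow> J \<in> U \<or> I - J \<in> U"
  using ultrafilter unfolding is_ultrafilter_def by blast+

lemma on_index: "\<lbrakk>J \<in> U; \<forall>i\<in>I. P i\<rbrakk> \<Longrightarrow> \<forall>i\<in>J. P i"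
  using U_subset by blast

lemma functor_ultra_diagram:
  assumes x: "\<forall>i\<in>I. x i \<in> Obj D"
  shows "is_functor (ultra_cat U) D (ultra_diagram D x)"
proof (rule is_functorI[OF category_ultra_cat category_axioms])
  fix f assume "f \<in> Arr (ultra_cat U)"
  then obtain J J' where f: "f = (J, J')" "J \<in> U" "J' \<in> U" "J' \<subseteq> J" by auto
  show "FA (ultra_diagram D x) f \<in> hom D (FO (ultra_diagram D x) (Dom (ultra_cat U) f))
      (FO (ultra_diagram D x) (Cod (ultra_cat U) f))"
    using prod_restrict_hom[OF U_subset[OF f(2)] f(4) on_index[OF f(2) x]] f
    by (simp add: ultra_diagram_def)
  fix g assume "g \<in> Arr (ultra_cat U)" "Cod (ultra_cat U) f = Dom (ultra_cat U) g"
  then obtain J'' where g: "g = (J', J'')" "J'' \<in> U" "J'' \<subseteq> J'" using f by auto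
  show "FA (ultra_diagram D x) (g \<cdot>\<^bsub>ultra_cat U\<^esub> f) = FA (ultra_diagram D x) g \<cdot> FA (ultra_diagram D x) f"
    using prod_restrict_trans[OF U_subset[OF f(2)] f(4) g(3) on_index[OF f(2) x]] f g
    by (simp add: ultra_diagram_def)
next
  fix J assume "J \<in> Obj (ultra_cat U)"
  then have J: "J \<in> U" by simp
  show "FO (ultra_diagram D x) J \<in> Obj D"
    using prod_obj[OF U_subset[OF J] on_index[OF J x]] by (simp add: ultra_diagram_def)
  show "FA (ultra_diagram D x) (Ident (ultra_cat U) J) = Ident D (FO (ultra_diagram D x) J)"
    using prod_restrict_self[OF U_subset[OF J] on_index[OF J x]] by (simp add: ultra_diagram_def)
qed

lemma ultra_is_colimit:
  assumes x: "\<forall>i\<in>I. x i \<in> Obj D"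
  shows "is_colimit (ultra_cat U) D (ultra_diagram D x) (ultra_obj D U x) (ultra_inj D U x)"
proof -
  have "\<exists>c. case c of (c, q) \<Rightarrow> is_colimit (ultra_cat U) D (ultra_diagram D x) c q"
    using ex_ultra_colimit[OF functor_ultra_diagram[OF x]] by simp
  then have "case ultra_cocone D U x of (c, q) \<Rightarrow> is_colimit (ultra_cat U) D (ultra_diagram D x) c q"
    unfolding ultra_cocone_def by (rule someI_ex)
  then show ?thesis by (simp add: ultra_obj_def ultra_inj_def split: prod.splits)
qed

lemma ultra_cocone_iff:
  "is_cocone (ultra_cat U) D (ultra_diagram D x) w r \<longleftrightarrow> w \<in> Obj D \<and>
    (\<forall>J\<in>U. r J \<in> hom D (prod_obj D J x) w) \<and>
    (\<forall>J\<in>U. \<forall>J'\<in>U. J' \<subseteq> J \<longrightarrow> r J' \<cdot> prod_restrict D J J' x = r J)"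
  by (auto simp: is_cocone_def ultra_diagram_def)

lemma ultra_obj: "\<forall>i\<in>I. x i \<in> Obj D \<Longrightarrow> ultra_obj D U x \<in> Obj D"
  and ultra_inj_hom: "\<lbrakk>\<forall>i\<in>I. x i \<in> Obj D; J \<in> U\<rbrakk> \<Longrightarrow>
    ultra_inj D U x J \<in> hom D (prod_obj D J x) (ultra_obj D U x)"
  and ultra_inj_restrict: "\<lbrakk>\<forall>i\<in>I. x i \<in> Obj D; J \<in> U; J' \<in> U; J' \<subseteq> J\<rbrakk> \<Longrightarrow>
    ultra_inj D U x J' \<cdot> prod_restrict D J J' x = ultra_inj D U x J"
  using ultra_is_colimit[of x] unfolding is_colimit_def ultra_cocone_iff by blast+

lemma ultra_desc:
  assumes x: "\<forall>i\<in>I. x i \<in> Obj D" and w: "w \<in> Obj D"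
    and r: "\<And>J. J \<in> U \<Longrightarrow> r J \<in> hom D (prod_obj D J x) w"
    and rr: "\<And>J J'. \<lbrakk>J \<in> U; J' \<in> U; J' \<subseteq> J\<rbrakk> \<Longrightarrow> r J' \<cdot> prod_restrict D J J' x = r J"
  shows "\<exists>!u. u \<in> hom D (ultra_obj D U x) w \<and> (\<forall>J\<in>U. u \<cdot> ultra_inj D U x J = r J)"
proof -
  have "is_cocone (ultra_cat U) D (ultra_diagram D x) w r"
    using w r rr unfolding ultra_cocone_iff by blast
  then show ?thesis using ultra_is_colimit[OF x] unfolding is_colimit_def by simp
qed

lemma ultra_ext:
  assumes x: "\<forall>i\<in>I. x i \<in> Obj D"
    and s: "s \<in> hom D (ultra_obj D U x) w" and t: "t \<in> hom D (ultra_obj D U x) w"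
    and eq: "\<And>J. J \<in> U \<Longrightarrow> s \<cdot> ultra_inj D U x J = t \<cdot> ultra_inj D U x J"
  shows "s = t"
proof -
  have "\<exists>!u. u \<in> hom D (ultra_obj D U x) w \<and> (\<forall>J\<in>U. u \<cdot> ultra_inj D U x J = s \<cdot> ultra_inj D U x J)"
  proof (rule ultra_desc[OF x])
    show "w \<in> Obj D" using s hom_objs by blast
    show "s \<cdot> ultra_inj D U x J \<in> hom D (prod_obj D J x) w" if "J \<in> U" for J
      using comp_hom[OF s ultra_inj_hom[OF x that]] .
    show "(s \<cdot> ultra_inj D U x J') \<cdot> prod_restrict D J J' x = s \<cdot> ultra_inj D U x J"
      if J: "J \<in> U" "J' \<in> U" "J' \<subseteq> J" for J J'
      using assoc_hom[OF prod_restrict_hom[OF U_subset[OF J(1)] J(3) on_index[OF J(1) x]]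
          ultra_inj_hom[OF x J(2)] s] ultra_inj_restrict[OF x J] by simp
  qed
  then show ?thesis using s t eq by metis
qed

lemma ultra_map_spec:
  assumes f: "\<forall>i\<in>I. f i \<in> hom D (x i) (y i)"
  shows "ultra_map D U x y f \<in> hom D (ultra_obj D U x) (ultra_obj D U y) \<and>
    (\<forall>J\<in>U. ultra_map D U x y f \<cdot> ultra_inj D U x J = ultra_inj D U y J \<cdot> prod_map D J x y f)"
proof -
  have x: "\<forall>i\<in>I. x i \<in> Obj D" and y: "\<forall>i\<in>I. y i \<in> Obj D" using f hom_objs by blast+
  have "\<exists>!t. t \<in> hom D (ultra_obj D U x) (ultra_obj D U y) \<and>
      (\<forall>J\<in>U. t \<cdot> ultra_inj D U x J = ultra_inj D U y J \<cdot> prod_map D J x y f)"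
  proof (rule ultra_desc[OF x ultra_obj[OF y]])
    show "ultra_inj D U y J \<cdot> prod_map D J x y f \<in> hom D (prod_obj D J x) (ultra_obj D U y)"
      if J: "J \<in> U" for J
      using comp_hom[OF ultra_inj_hom[OF y J] prod_map_hom[OF U_subset[OF J] on_index[OF J f]]] .
    fix J J' assume J: "J \<in> U" "J' \<in> U" "J' \<subseteq> J"
    note JI = U_subset[OF J(1)] U_subset[OF J(2)]
    note h = prod_restrict_hom[OF JI(1) J(3)]
    have "(ultra_inj D U y J' \<cdot> prod_map D J' x y f) \<cdot> prod_restrict D J J' x
        = ultra_inj D U y J' \<cdot> (prod_restrict D J J' y \<cdot> prod_map D J x y f)"
      using assoc_hom[OF h[OF on_index[OF J(1) x]] prod_map_hom[OF JI(2) on_index[OF J(2) f]]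
          ultra_inj_hom[OF y J(2)]]
        prod_restrict_natural[OF JI(1) J(3) on_index[OF J(1) f]] by simp
    also have "\<dots> = ultra_inj D U y J \<cdot> prod_map D J x y f"
      using assoc_hom[OF prod_map_hom[OF JI(1) on_index[OF J(1) f]] h[OF on_index[OF J(1) y]]
          ultra_inj_hom[OF y J(2)]] ultra_inj_restrict[OF y J] by simp
    finally show "(ultra_inj D U y J' \<cdot> prod_map D J' x y f) \<cdot> prod_restrict D J J' x
        = ultra_inj D U y J \<cdot> prod_map D J x y f" .
  qed
  from theI'[OF this] show ?thesis unfolding ultra_map_def .
qed

lemma ultra_map_hom:
  "\<forall>i\<in>I. f i \<in> hom D (x i) (y i) \<Longrightarrow> ultra_map D U x y f \<in> hom D (ultra_obj D U x) (ultra_obj D U y)"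
  using ultra_map_spec by blast

lemma ultra_map_inj:
  "\<lbrakk>\<forall>i\<in>I. f i \<in> hom D (x i) (y i); J \<in> U\<rbrakk> \<Longrightarrow>
    ultra_map D U x y f \<cdot> ultra_inj D U x J = ultra_inj D U y J \<cdot> prod_map D J x y f"
  using ultra_map_spec by blast

lemma ultra_map_cong:
  assumes "\<And>i. i \<in> I \<Longrightarrow> f i = g i"
  shows "ultra_map D U x y f = ultra_map D U x y g"
proof -
  have "prod_map D J x y f = prod_map D J x y g" if "J \<in> U" for J
    using assms U_subset[OF that] by (intro prod_map_cong) blast
  then show ?thesis unfolding ultra_map_def by (intro arg_cong[of _ _ The]) (simp add: fun_eq_iff)
qed

lemma ultra_map_comp:
  assumes f: "\<forall>i\<in>I. f i \<in> hom D (x i) (y i)" and g: "\<forall>i\<in>I. g i \<in> hom D (y i) (z i)"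
  shows "ultra_map D U x z (\<lambda>i. g i \<cdot> f i) = ultra_map D U y z g \<cdot> ultra_map D U x y f"
proof -
  have x: "\<forall>i\<in>I. x i \<in> Obj D" and y: "\<forall>i\<in>I. y i \<in> Obj D" and z: "\<forall>i\<in>I. z i \<in> Obj D"
    using f g hom_objs by blast+
  have gf: "\<forall>i\<in>I. g i \<cdot> f i \<in> hom D (x i) (z i)" using comp_hom f g by blast
  note hf = ultra_map_hom[OF f] and hg = ultra_map_hom[OF g]
  show ?thesis
  proof (rule ultra_ext[OF x ultra_map_hom[OF gf] comp_hom[OF hg hf]])
    fix J assume J: "J \<in> U"
    note pf = prod_map_hom[OF U_subset[OF J] on_index[OF J f]]
      and pg = prod_map_hom[OF U_subset[OF J] on_index[OF J g]]
    have "(ultra_map D U y z g \<cdot> ultra_map D U x y f) \<cdot> ultra_inj D U x J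
        = ultra_map D U y z g \<cdot> (ultra_inj D U y J \<cdot> prod_map D J x y f)"
      using assoc_hom[OF ultra_inj_hom[OF x J] hf hg] ultra_map_inj[OF f J] by simp
    also have "\<dots> = ultra_inj D U z J \<cdot> (prod_map D J y z g \<cdot> prod_map D J x y f)"
      using assoc_hom[OF pf ultra_inj_hom[OF y J] hg] assoc_hom[OF pf pg ultra_inj_hom[OF z J]]
        ultra_map_inj[OF g J] by simp
    also have "\<dots> = ultra_map D U x z (\<lambda>i. g i \<cdot> f i) \<cdot> ultra_inj D U x J"
      using ultra_map_inj[OF gf J] prod_map_comp[OF U_subset[OF J] on_index[OF J f] on_index[OF J g]]
      by simp
    finally show "ultra_map D U x z (\<lambda>i. g i \<cdot> f i) \<cdot> ultra_inj D U x J
        = (ultra_map D U y z g \<cdot> ultra_map D U x y f) \<cdot> ultra_inj D U x J" by simp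
  qed
qed

lemma ultra_map_ident:
  assumes x: "\<forall>i\<in>I. x i \<in> Obj D"
  shows "ultra_map D U x x (\<lambda>i. Ident D (x i)) = Ident D (ultra_obj D U x)"
proof -
  have i: "\<forall>i\<in>I. Ident D (x i) \<in> hom D (x i) (x i)" using x ident_hom by blast
  show ?thesis
    using ultra_map_inj[OF i] comp_ident[OF ultra_inj_hom[OF x]] ident_comp[OF ultra_inj_hom[OF x]]
      prod_map_ident[OF U_subset on_index[OF _ x]]
    by (intro ultra_ext[OF x ultra_map_hom[OF i] ident_hom[OF ultra_obj[OF x]]]) simp
qed

lemma functor_ultra_fctr:
  assumes C: "category C" and F: "\<And>i. i \<in> I \<Longrightarrow> is_functor C D (F i)"
  shows "is_functor C D (ultra_fctr C D U F)"
proof -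
  interpret C: category C by fact
  have h: "\<forall>i\<in>I. FA (F i) f \<in> hom D (FO (F i) (Dom C f)) (FO (F i) (Cod C f))" if "f \<in> Arr C" for f
    using functor_hom[OF F that] by blast
  have o: "\<forall>i\<in>I. FO (F i) a \<in> Obj D" if "a \<in> Obj C" for a using functor_obj[OF F that] by blast
  show ?thesis
  proof (rule is_functorI[OF C category_axioms])
    fix f assume f: "f \<in> Arr C"
    show "FA (ultra_fctr C D U F) f \<in> hom D (FO (ultra_fctr C D U F) (Dom C f)) (FO (ultra_fctr C D U F) (Cod C f))"
      using ultra_map_hom[OF h[OF f]] by (simp add: ultra_fctr_def)
    fix g assume g: "g \<in> Arr C" "Cod C f = Dom C g"
    have gh: "\<forall>i\<in>I. FA (F i) g \<in> hom D (FO (F i) (Cod C f)) (FO (F i) (Cod C g))"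
      using h[OF g(1)] g(2) by simp
    have "ultra_map D U (\<lambda>i. FO (F i) (Dom C f)) (\<lambda>i. FO (F i) (Cod C g)) (\<lambda>i. FA (F i) (g \<cdot>\<^bsub>C\<^esub> f))
      = ultra_map D U (\<lambda>i. FO (F i) (Dom C f)) (\<lambda>i. FO (F i) (Cod C g)) (\<lambda>i. FA (F i) g \<cdot> FA (F i) f)"
      using functor_comp[OF F f g] by (intro ultra_map_cong) blast
    then show "FA (ultra_fctr C D U F) (g \<cdot>\<^bsub>C\<^esub> f) = FA (ultra_fctr C D U F) g \<cdot> FA (ultra_fctr C D U F) f"
      using ultra_map_comp[OF h[OF f] gh] C.Dom_Comp[OF f g] C.Cod_Comp[OF f g] g(2)
      by (simp add: ultra_fctr_def)
  next
    fix a assume a: "a \<in> Obj C"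
    show "FO (ultra_fctr C D U F) a \<in> Obj D" using ultra_obj[OF o[OF a]] by (simp add: ultra_fctr_def)
    have "ultra_map D U (\<lambda>i. FO (F i) a) (\<lambda>i. FO (F i) a) (\<lambda>i. FA (F i) (Ident C a))
      = ultra_map D U (\<lambda>i. FO (F i) a) (\<lambda>i. FO (F i) a) (\<lambda>i. Ident D (FO (F i) a))"
      using functor_ident[OF F a] by (intro ultra_map_cong) blast
    then show "FA (ultra_fctr C D U F) (Ident C a) = Ident D (FO (ultra_fctr C D U F) a)"
      using ultra_map_ident[OF o[OF a]] a by (simp add: ultra_fctr_def C.Dom_Ident C.Cod_Ident)
  qed
qed

end


section \<open>Ultraproducts preserve finite limits\<close>

locale exact_ultraproducts = ultraproducts D I U + coherent_cat D
  for D :: "('o, 'm) cat" (structure) and I :: "'i set" and U :: "'i set set" +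
  assumes commute: "colimits_commute_with_finite_limits (ultra_cat U) D"
begin

text \<open>The functor \<open>(J, k) \<mapsto> \<Prod>\<^sub>i\<^sub>\<in>\<^sub>J H i k\<close>, to which the exactness of filtered colimits is applied.\<close>

definition bi_fctr :: "('p, 'n) cat \<Rightarrow> ('i \<Rightarrow> ('p, 'n, 'o, 'm) fctr) \<Rightarrow>
    ('i set \<times> 'p, ('i set \<times> 'i set) \<times> 'n, 'o, 'm) fctr" where
  "bi_fctr K H = \<lparr>FO = (\<lambda>(J, k). FO (prod_fctr K J H) k),
     FA = (\<lambda>((J, J'), g). FA (prod_fctr K J' H) g \<cdot> prod_restrict D J J' (\<lambda>i. FO (H i) (Dom K g)))\<rparr>"

lemma functor_bi_fctr:
  assumes K: "category K" and H: "\<And>i. i \<in> I \<Longrightarrow> is_functor K D (H i)"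
  shows "is_functor (prod_cat (ultra_cat U) K) D (bi_fctr K H)"
proof -
  interpret K: category K by fact
  let ?H = "\<lambda>k i. FO (H i) k"
  let ?m = "\<lambda>J g. prod_map D J (?H (Dom K g)) (?H (Cod K g)) (\<lambda>i. FA (H i) g)"
  have h: "\<forall>i\<in>I. FA (H i) g \<in> hom D (?H (Dom K g) i) (?H (Cod K g) i)" if "g \<in> Arr K" for g
    using functor_hom[OF H that] by blast
  have o: "\<forall>i\<in>I. ?H k i \<in> Obj D" if "k \<in> Obj K" for k using functor_obj[OF H that] by blast
  have mh: "?m J g \<in> hom D (prod_obj D J (?H (Dom K g))) (prod_obj D J (?H (Cod K g)))"
    if "J \<in> U" "g \<in> Arr K" for J g
    using prod_map_hom[OF U_subset[OF that(1)] on_index[OF that(1) h[OF that(2)]]] .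
  have rh: "prod_restrict D J J' (?H k) \<in> hom D (prod_obj D J (?H k)) (prod_obj D J' (?H k))"
    if "J \<in> U" "J' \<subseteq> J" "k \<in> Obj K" for J J' k
    using prod_restrict_hom[OF U_subset[OF that(1)] that(2) on_index[OF that(1) o[OF that(3)]]] .
  show ?thesis
  proof (rule is_functorI[OF category_prod_cat[OF category_ultra_cat K] category_axioms])
    fix f assume "f \<in> Arr (prod_cat (ultra_cat U) K)"
    then obtain J J' g where f: "f = ((J, J'), g)" "J \<in> U" "J' \<in> U" "J' \<subseteq> J" "g \<in> Arr K"
      by (auto simp: prod_cat_def)
    have d: "Dom K g \<in> Obj K" using K.Dom_Obj f by blast
    show "FA (bi_fctr K H) f \<in> hom D (FO (bi_fctr K H) (Dom (prod_cat (ultra_cat U) K) f))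
        (FO (bi_fctr K H) (Cod (prod_cat (ultra_cat U) K) f))"
      using comp_hom[OF mh[OF f(3,5)] rh[OF f(2,4) d]] f
      by (simp add: bi_fctr_def prod_cat_def prod_fctr_def)
    fix f' assume "f' \<in> Arr (prod_cat (ultra_cat U) K)"
      "Cod (prod_cat (ultra_cat U) K) f = Dom (prod_cat (ultra_cat U) K) f'"
    then obtain J'' g' where f': "f' = ((J', J''), g')" "J'' \<in> U" "J'' \<subseteq> J'" "g' \<in> Arr K"
        "Cod K g = Dom K g'"
      using f by (auto simp: prod_cat_def)
    have d': "Dom K g' \<in> Obj K" using K.Dom_Obj f' by blast
    note JI = U_subset[OF f(2)] U_subset[OF f(3)] U_subset[OF f'(2)]
    have m': "?m J' g \<in> hom D (prod_obj D J' (?H (Dom K g))) (prod_obj D J' (?H (Dom K g')))"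
      "?m J'' g \<in> hom D (prod_obj D J'' (?H (Dom K g))) (prod_obj D J'' (?H (Dom K g')))"
      using mh[OF f(3,5)] mh[OF f'(2) f(5)] f'(5) by simp_all
    have h': "\<forall>i\<in>I. FA (H i) g \<in> hom D (?H (Dom K g) i) (?H (Dom K g') i)"
      using h[OF f(5)] f'(5) by simp
    note r1 = rh[OF f(2,4) d] and r2 = rh[OF f(3) f'(3) d] and r2' = rh[OF f(3) f'(3) d']
    have "(?m J'' g' \<cdot> prod_restrict D J' J'' (?H (Dom K g'))) \<cdot> (?m J' g \<cdot> prod_restrict D J J' (?H (Dom K g)))
      = ?m J'' g' \<cdot> (prod_restrict D J' J'' (?H (Dom K g')) \<cdot> (?m J' g \<cdot> prod_restrict D J J' (?H (Dom K g))))"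
      using assoc_hom[OF comp_hom[OF m'(1) r1] r2' mh[OF f'(2,4)]] .
    also have "\<dots> = ?m J'' g' \<cdot> ((prod_restrict D J' J'' (?H (Dom K g')) \<cdot> ?m J' g) \<cdot> prod_restrict D J J' (?H (Dom K g)))"
      using assoc_hom[OF r1 m'(1) r2'] by simp
    also have "\<dots> = ?m J'' g' \<cdot> (?m J'' g \<cdot> (prod_restrict D J' J'' (?H (Dom K g)) \<cdot> prod_restrict D J J' (?H (Dom K g))))"
      using prod_restrict_natural[OF JI(2) f'(3) on_index[OF f(3) h']] assoc_hom[OF r1 r2 m'(2)] f'(5)
      by simp
    also have "\<dots> = ?m J'' g' \<cdot> (?m J'' g \<cdot> prod_restrict D J J'' (?H (Dom K g)))"
      using prod_restrict_trans[OF JI(1) f(4) f'(3) on_index[OF f(2) o[OF d]]] by simp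
    also have "\<dots> = (?m J'' g' \<cdot> ?m J'' g) \<cdot> prod_restrict D J J'' (?H (Dom K g))"
      using assoc_hom[OF rh[OF f(2) _ d] m'(2) mh[OF f'(2,4)]] f(4) f'(3) by auto
    also have "?m J'' g' \<cdot> ?m J'' g = ?m J'' (g' \<cdot>\<^bsub>K\<^esub> g)"
    proof -
      have "?m J'' (g' \<cdot>\<^bsub>K\<^esub> g) = prod_map D J'' (?H (Dom K g)) (?H (Cod K g')) (\<lambda>i. FA (H i) (g' \<cdot>\<^bsub>K\<^esub> g))"
        using K.Dom_Comp K.Cod_Comp f(5) f'(4,5) by simp
      also have "\<dots> = prod_map D J'' (?H (Dom K g)) (?H (Cod K g')) (\<lambda>i. FA (H i) g' \<cdot> FA (H i) g)"
        using functor_comp[OF H f(5) f'(4,5)] JI(3) by (intro prod_map_cong) blast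
      also have "\<dots> = ?m J'' g' \<cdot> ?m J'' g"
        using prod_map_comp[OF JI(3) on_index[OF f'(2) h'] on_index[OF f'(2) h[OF f'(4)]]] f'(5) by simp
      finally show ?thesis by simp
    qed
    finally show "FA (bi_fctr K H) (f' \<cdot>\<^bsub>prod_cat (ultra_cat U) K\<^esub> f) = FA (bi_fctr K H) f' \<cdot> FA (bi_fctr K H) f"
      using f f' K.Dom_Comp by (simp add: bi_fctr_def prod_cat_def prod_fctr_def)
  next
    fix a assume "a \<in> Obj (prod_cat (ultra_cat U) K)"
    then obtain J k where a: "a = (J, k)" "J \<in> U" "k \<in> Obj K" by (auto simp: prod_cat_def)
    note JI = U_subset[OF a(2)] and oJ = on_index[OF a(2) o[OF a(3)]]
    show "FO (bi_fctr K H) a \<in> Obj D"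
      using prod_obj[OF JI oJ] a by (simp add: bi_fctr_def prod_fctr_def)
    have "?m J (Ident K k) = prod_map D J (?H k) (?H k) (\<lambda>i. Ident D (?H k i))"
      using functor_ident[OF H a(3)] JI a(3) K.Dom_Ident K.Cod_Ident by (simp, intro prod_map_cong) blast
    then have "?m J (Ident K k) = Ident D (prod_obj D J (?H k))"
      using prod_map_ident[OF JI oJ] by simp
    then show "FA (bi_fctr K H) (Ident (prod_cat (ultra_cat U) K) a) = Ident D (FO (bi_fctr K H) a)"
      using prod_restrict_self[OF JI oJ] ident_comp[OF ident_hom[OF prod_obj[OF JI oJ]]] a K.Dom_Ident
      by (simp add: bi_fctr_def prod_cat_def prod_fctr_def)
  qed
qed

text \<open>The product over \<open>i \<in> J\<close> of the limits \<open>l i\<close> is the limit of the products of the diagrams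
  \<open>H i\<close>; then the colimit over \<open>J \<in> U\<close> commutes with the limit over \<open>K\<close>. The comparison arrow \<open>v\<close> is the one
  induced by the cone of ultraproducts of the given legs, and as it is an isomorphism that cone is a
  limit cone.\<close>

theorem ultra_limit:
  fixes K :: "(nat, nat) cat"
  assumes K: "category K" "finite (Arr K)" and H: "\<And>i. i \<in> I \<Longrightarrow> is_functor K D (H i)"
    and L: "\<And>i. i \<in> I \<Longrightarrow> is_limit K D (H i) (l i) (p i)"
  shows "is_limit K D (ultra_fctr K D U H) (ultra_obj D U l)
    (\<lambda>k. ultra_map D U l (\<lambda>i. FO (H i) k) (\<lambda>i. p i k))"
proof -
  interpret K: category K by fact
  let ?H = "\<lambda>k i. FO (H i) k"
  let ?p = "\<lambda>J k. prod_map D J l (?H k) (\<lambda>i. p i k)"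
  let ?u = "\<lambda>k. ultra_map D U l (?H k) (\<lambda>i. p i k)"
  let ?Q = "ultra_fctr K D U H"
  have h: "\<forall>i\<in>I. FA (H i) g \<in> hom D (?H (Dom K g) i) (?H (Cod K g) i)" if "g \<in> Arr K" for g
    using functor_hom[OF H that] by blast
  have o: "\<forall>i\<in>I. ?H k i \<in> Obj D" if "k \<in> Obj K" for k using functor_obj[OF H that] by blast
  have cone: "\<And>i. i \<in> I \<Longrightarrow> is_cone K D (H i) (l i) (p i)" using L unfolding is_limit_def by blast
  have l: "\<forall>i\<in>I. l i \<in> Obj D" using cone unfolding is_cone_def by blast
  have p: "\<And>k. k \<in> Obj K \<Longrightarrow> \<forall>i\<in>I. p i k \<in> hom D (l i) (?H k i)"
    using cone unfolding is_cone_def by blast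
  have pn: "\<And>i g. \<lbrakk>i \<in> I; g \<in> Arr K\<rbrakk> \<Longrightarrow> FA (H i) g \<cdot> p i (Dom K g) = p i (Cod K g)"
    using cone unfolding is_cone_def by blast
  have ident: "prod_map D J (?H k) (?H k) (\<lambda>i. FA (H i) (Ident K k)) = Ident D (prod_obj D J (?H k))"
    if J: "J \<in> U" and k: "k \<in> Obj K" for J k
  proof -
    have "prod_map D J (?H k) (?H k) (\<lambda>i. FA (H i) (Ident K k))
        = prod_map D J (?H k) (?H k) (\<lambda>i. Ident D (?H k i))"
      using functor_ident[OF H k] U_subset[OF J] by (intro prod_map_cong) blast
    then show ?thesis using prod_map_ident[OF U_subset[OF J] on_index[OF J o[OF k]]] by simp
  qed
  have Q: "is_functor K D ?Q" using functor_ultra_fctr[OF K(1) H] .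
  have u: "?u k \<in> hom D (ultra_obj D U l) (FO ?Q k)" if "k \<in> Obj K" for k
    using ultra_map_hom[OF p[OF that]] by (simp add: ultra_fctr_def)
  have ucone: "is_cone K D ?Q (ultra_obj D U l) ?u"
    unfolding is_cone_def
  proof (intro conjI ballI, rule ultra_obj[OF l], erule u)
    fix g assume g: "g \<in> Arr K"
    have "FA ?Q g \<cdot> ?u (Dom K g) = ultra_map D U l (?H (Cod K g)) (\<lambda>i. FA (H i) g \<cdot> p i (Dom K g))"
      using ultra_map_comp[OF p[OF K.Dom_Obj[OF g]] h[OF g]] by (simp add: ultra_fctr_def)
    also have "\<dots> = ?u (Cod K g)" using pn[OF _ g] by (intro ultra_map_cong) simp
    finally show "FA ?Q g \<cdot> ?u (Dom K g) = ?u (Cod K g)" .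
  qed
  obtain N n where N: "is_limit K D ?Q N n"
    using finite_limits K(2) Q unfolding has_finite_limits_def by blast
  obtain v where v: "v \<in> hom D (ultra_obj D U l) N" "\<And>k. k \<in> Obj K \<Longrightarrow> n k \<cdot> v = ?u k"
    using N ucone unfolding is_limit_def by blast
  have n: "n k \<in> hom D N (FO ?Q k)" if "k \<in> Obj K" for k
    using N that unfolding is_limit_def is_cone_def by blast

  have 1: "\<forall>J\<in>Obj (ultra_cat U). is_limit K D (fix_fst (ultra_cat U) (bi_fctr K H) J)
      (FO (ultra_diagram D l) J) (?p J)"
  proof
    fix J assume "J \<in> Obj (ultra_cat U)"
    then have J: "J \<in> U" by simp
    have "FA (fix_fst (ultra_cat U) (bi_fctr K H) J) g = FA (prod_fctr K J H) g" if g: "g \<in> Arr K" for g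
      using prod_restrict_self[OF U_subset[OF J] on_index[OF J o[OF K.Dom_Obj[OF g]]]]
        comp_ident[OF prod_map_hom[OF U_subset[OF J] on_index[OF J h[OF g]]]]
      by (simp add: fix_fst_def bi_fctr_def prod_fctr_def)
    moreover have "FO (fix_fst (ultra_cat U) (bi_fctr K H) J) k = FO (prod_fctr K J H) k" for k
      by (simp add: fix_fst_def bi_fctr_def)
    ultimately have "is_limit K D (fix_fst (ultra_cat U) (bi_fctr K H) J) (prod_obj D J l) (?p J)
        \<longleftrightarrow> is_limit K D (prod_fctr K J H) (prod_obj D J l) (?p J)"
      by (intro limit_cong) auto
    moreover have "is_limit K D (prod_fctr K J H) (prod_obj D J l) (?p J)"
      using prod_limit[OF U_subset[OF J] _ K(1), of H l p] H L U_subset[OF J] by blast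
    ultimately show "is_limit K D (fix_fst (ultra_cat U) (bi_fctr K H) J) (FO (ultra_diagram D l) J) (?p J)"
      by (simp add: ultra_diagram_def)
  qed
  have 2: "\<forall>f\<in>Arr (ultra_cat U). \<forall>k\<in>Obj K. ?p (Cod (ultra_cat U) f) k \<cdot> FA (ultra_diagram D l) f
      = FA (bi_fctr K H) (f, Ident K k) \<cdot> ?p (Dom (ultra_cat U) f) k"
  proof (intro ballI)
    fix f k assume "f \<in> Arr (ultra_cat U)" and k: "k \<in> Obj K"
    then obtain J J' where f: "f = (J, J')" "J \<in> U" "J' \<in> U" "J' \<subseteq> J" by auto
    have r: "prod_restrict D J J' (?H k) \<in> hom D (prod_obj D J (?H k)) (prod_obj D J' (?H k))"
      using prod_restrict_hom[OF U_subset[OF f(2)] f(4) on_index[OF f(2) o[OF k]]] .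
    show "?p (Cod (ultra_cat U) f) k \<cdot> FA (ultra_diagram D l) f
      = FA (bi_fctr K H) (f, Ident K k) \<cdot> ?p (Dom (ultra_cat U) f) k"
      using prod_restrict_natural[OF U_subset[OF f(2)] f(4) on_index[OF f(2) p[OF k]]]
        ident[OF f(3) k] ident_comp[OF r] f k K.Dom_Ident K.Cod_Ident
      by (simp add: ultra_diagram_def bi_fctr_def prod_fctr_def)
  qed
  have 3: "\<forall>k\<in>Obj K. is_colimit (ultra_cat U) D (fix_snd K (bi_fctr K H) k) (FO ?Q k) (ultra_inj D U (?H k))"
  proof
    fix k assume k: "k \<in> Obj K"
    have "FA (fix_snd K (bi_fctr K H) k) f = FA (ultra_diagram D (?H k)) f" if fA: "f \<in> Arr (ultra_cat U)" for f
    proof -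
      obtain J J' where f: "f = (J, J')" "J \<in> U" "J' \<in> U" "J' \<subseteq> J" using fA by auto
      have "prod_restrict D J J' (?H k) \<in> hom D (prod_obj D J (?H k)) (prod_obj D J' (?H k))"
        using prod_restrict_hom[OF U_subset[OF f(2)] f(4) on_index[OF f(2) o[OF k]]] .
      then show ?thesis
        using f ident[OF f(3) k] ident_comp K.Dom_Ident K.Cod_Ident k
        by (simp add: fix_snd_def bi_fctr_def prod_fctr_def ultra_diagram_def)
    qed
    moreover have "FO (fix_snd K (bi_fctr K H) k) J = FO (ultra_diagram D (?H k)) J" for J
      by (simp add: fix_snd_def bi_fctr_def prod_fctr_def ultra_diagram_def)
    ultimately have "is_colimit (ultra_cat U) D (fix_snd K (bi_fctr K H) k) (FO ?Q k) (ultra_inj D U (?H k))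
      \<longleftrightarrow> is_colimit (ultra_cat U) D (ultra_diagram D (?H k)) (FO ?Q k) (ultra_inj D U (?H k))"
      by (intro colimit_cong) auto
    then show "is_colimit (ultra_cat U) D (fix_snd K (bi_fctr K H) k) (FO ?Q k) (ultra_inj D U (?H k))"
      using ultra_is_colimit[OF o[OF k]] by (simp add: ultra_fctr_def)
  qed
  have 4: "\<forall>g\<in>Arr K. \<forall>J\<in>Obj (ultra_cat U). FA ?Q g \<cdot> ultra_inj D U (?H (Dom K g)) J
      = ultra_inj D U (?H (Cod K g)) J \<cdot> FA (bi_fctr K H) (Ident (ultra_cat U) J, g)"
  proof (intro ballI)
    fix g J assume g: "g \<in> Arr K" and "J \<in> Obj (ultra_cat U)"
    then have J: "J \<in> U" by simp
    show "FA ?Q g \<cdot> ultra_inj D U (?H (Dom K g)) J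
      = ultra_inj D U (?H (Cod K g)) J \<cdot> FA (bi_fctr K H) (Ident (ultra_cat U) J, g)"
      using ultra_map_inj[OF h[OF g] J]
        prod_restrict_self[OF U_subset[OF J] on_index[OF J o[OF K.Dom_Obj[OF g]]]]
        comp_ident[OF prod_map_hom[OF U_subset[OF J] on_index[OF J h[OF g]]]]
      by (simp add: ultra_fctr_def bi_fctr_def prod_fctr_def)
  qed
  have 5: "\<forall>J\<in>Obj (ultra_cat U). \<forall>k\<in>Obj K. n k \<cdot> (v \<cdot> ultra_inj D U l J) = ultra_inj D U (?H k) J \<cdot> ?p J k"
  proof (intro ballI)
    fix J k assume "J \<in> Obj (ultra_cat U)" and k: "k \<in> Obj K"
    then have J: "J \<in> U" by simp
    show "n k \<cdot> (v \<cdot> ultra_inj D U l J) = ultra_inj D U (?H k) J \<cdot> ?p J k"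
      using assoc_hom[OF ultra_inj_hom[OF l J] v(1) n[OF k]] v(2)[OF k] ultra_map_inj[OF p[OF k] J] by simp
  qed
  have B: "is_functor (prod_cat (ultra_cat U) K) D (bi_fctr K H)"
    by (rule functor_bi_fctr[OF K(1) H])
  have iso: "is_iso D v"
    using commute[unfolded colimits_commute_with_finite_limits_def, rule_format,
        of K "bi_fctr K H" "ultra_diagram D l" ?p ?Q "\<lambda>k. ultra_inj D U (?H k)"
          "ultra_obj D U l" "ultra_inj D U l" N n v]
      1 2 3 4 5 K B functor_ultra_diagram[OF l] Q ultra_is_colimit[OF l] N v(1)
    by blast
  show ?thesis
    using limit_transport_iso[OF N iso v(1)] v(2) functor_hom[OF Q] K.Dom_Obj K.Cod_Obj by simp
qed

end


context category begin

text \<open>The two arrows of the kernel pair of \<open>e\<close> are among the pairs that \<open>e\<close> identifies, and \<open>e\<close> is their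
  coequalizer.\<close>

lemma effective_epi_factor:
  assumes e: "effective_epi C e" "e \<in> hom C x y" and k: "k \<in> hom C x w"
    and eq: "\<And>v s t. \<lbrakk>s \<in> hom C v x; t \<in> hom C v x; e \<cdot> s = e \<cdot> t\<rbrakk> \<Longrightarrow> k \<cdot> s = k \<cdot> t"
  shows "\<exists>!u. u \<in> hom C y w \<and> u \<cdot> e = k"
proof -
  obtain p q where P: "is_pullback C e e p q" and Q: "is_coequalizer C p q e"
    using e(1) unfolding effective_epi_def by blast
  have xy: "Dom C e = x" "Cod C e = y" using e(2) by (auto simp: hom_def)
  have "k \<cdot> p = k \<cdot> q" using is_pullbackD[OF P e(2,2)] eq by blast
  then show ?thesis using Q k unfolding is_coequalizer_def xy by blast
qed

lemma preimage_le:
  assumes f: "f \<in> hom C y x" and a: "a \<in> Sub C x" and b: "is_preimage C f a b" "is_preimage C f a c"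
  shows "sub_le C y b c"
  using preimage_le_iff[OF f a b(1)] preimage_le_iff[OF f a b(2)] sub_le_refl by blast

lemma union_insertI:
  assumes "is_union C x S v" "is_union C x {a, v} u"
  shows "is_union C x (insert a S) u"
  using assms unfolding is_union_def by (simp, meson sub_le_trans)

end


context exact_ultraproducts begin

lemma ultra_pullback:
  assumes P: "\<forall>i\<in>I. is_pullback D (f i) (g i) (p i) (q i)"
    and f: "\<forall>i\<in>I. f i \<in> hom D (x i) (z i)" and g: "\<forall>i\<in>I. g i \<in> hom D (y i) (z i)"
    and p: "\<forall>i\<in>I. p i \<in> hom D (r i) (x i)"
  shows "is_pullback D (ultra_map D U x z f) (ultra_map D U y z g) (ultra_map D U r x p) (ultra_map D U r y q)"
proof -
  let ?H = "\<lambda>i. cospan_fctr D (x i) (y i) (z i) (f i) (g i)"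
  let ?t = "\<lambda>i n. if n = 0 then p i else if n = 1 then q i else f i \<cdot> p i"
  have H: "is_functor cospan_cat D (?H i)" if "i \<in> I" for i
    using functor_cospan f g that by blast
  have L: "is_limit cospan_cat D (?H i) (r i) (?t i)" if i: "i \<in> I" for i
  proof -
    have "FA (?H i) 3 = f i" "FA (?H i) 4 = g i" by (simp_all add: cospan_fctr_def)
    moreover have "Dom D (p i) = r i" using p i by (simp add: hom_def)
    ultimately show ?thesis
      using pullback_cospan_limit[OF H[OF i], of "p i" "q i"] P i by (simp cong: if_cong)
  qed
  have "is_limit cospan_cat D (ultra_fctr cospan_cat D U ?H) (ultra_obj D U r)
      (\<lambda>k. ultra_map D U r (\<lambda>i. FO (?H i) k) (\<lambda>i. ?t i k))"
    by (rule ultra_limit[OF category_cospan finite_cospan H L])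
  from cospan_limit_pullback[OF functor_ultra_fctr[OF category_cospan H] this]
  show ?thesis by (simp add: ultra_fctr_def cospan_fctr_def cospan_cat_def)
qed

text \<open>A monomorphism is an arrow whose kernel pair is trivial, which is a finite limit condition.\<close>

lemma ultra_mono:
  assumes m: "\<forall>i\<in>I. mono_arr D (m i)" and h: "\<forall>i\<in>I. m i \<in> hom D (x i) (y i)"
  shows "mono_arr D (ultra_map D U x y m)"
proof -
  have x: "\<forall>i\<in>I. x i \<in> Obj D" using h hom_objs by blast
  have "\<forall>i\<in>I. is_pullback D (m i) (m i) (Ident D (x i)) (Ident D (x i))"
    using m h mono_iff_pullback by blast
  moreover have "\<forall>i\<in>I. Ident D (x i) \<in> hom D (x i) (x i)" using x ident_hom by blast
  ultimately have "is_pullback D (ultra_map D U x y m) (ultra_map D U x y m)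
      (ultra_map D U x x (\<lambda>i. Ident D (x i))) (ultra_map D U x x (\<lambda>i. Ident D (x i)))"
    by (rule ultra_pullback[OF _ h h])
  then show ?thesis
    using ultra_map_ident[OF x] mono_iff_pullback[OF ultra_map_hom[OF h]] by simp
qed

lemma ultra_Sub:
  "\<lbrakk>\<forall>i\<in>I. mono_arr D (m i); \<forall>i\<in>I. m i \<in> hom D (x i) (y i)\<rbrakk> \<Longrightarrow>
    ultra_map D U x y m \<in> Sub D (ultra_obj D U y)"
  using SubI ultra_mono ultra_map_hom by blast

text \<open>
  Because \<open>v\<close> is a monomorphism, the factorizations on the products over the sets \<open>J \<in> U\<close> are
  automatically compatible, so they assemble to a factorization on the colimit.
\<close>

lemma ultra_leI:
  assumes c: "\<forall>i\<in>I. mono_arr D (c i)" "\<forall>i\<in>I. c i \<in> hom D (A i) (X i)"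
    and v: "v \<in> Sub D (ultra_obj D U X)"
    and fac: "\<And>J. J \<in> U \<Longrightarrow> \<exists>g\<in>hom D (prod_obj D J A) (Dom D v).
      v \<cdot> g = ultra_inj D U X J \<cdot> prod_map D J A X c"
  shows "sub_le D (ultra_obj D U X) (ultra_map D U A X c) v"
proof -
  have A: "\<forall>i\<in>I. A i \<in> Obj D" and X: "\<forall>i\<in>I. X i \<in> Obj D" using c hom_objs by blast+
  have vm: "mono_arr D v" "v \<in> hom D (Dom D v) (ultra_obj D U X)" using SubD[OF v] by auto
  have ch: "ultra_map D U A X c \<in> hom D (ultra_obj D U A) (ultra_obj D U X)" using ultra_map_hom[OF c(2)] .
  obtain g where g: "\<And>J. J \<in> U \<Longrightarrow> g J \<in> hom D (prod_obj D J A) (Dom D v)"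
    "\<And>J. J \<in> U \<Longrightarrow> v \<cdot> g J = ultra_inj D U X J \<cdot> prod_map D J A X c"
    using fac by metis
  have "\<exists>!u. u \<in> hom D (ultra_obj D U A) (Dom D v) \<and> (\<forall>J\<in>U. u \<cdot> ultra_inj D U A J = g J)"
  proof (rule ultra_desc[OF A _ g(1)])
    show "Dom D v \<in> Obj D" using vm hom_objs by blast
    fix J J' assume J: "J \<in> U" "J' \<in> U" "J' \<subseteq> J"
    note JI = U_subset[OF J(1)] U_subset[OF J(2)]
    note rA = prod_restrict_hom[OF JI(1) J(3) on_index[OF J(1) A]]
      and rX = prod_restrict_hom[OF JI(1) J(3) on_index[OF J(1) X]]
      and cJ = prod_map_hom[OF JI(1) on_index[OF J(1) c(2)]]
      and cJ' = prod_map_hom[OF JI(2) on_index[OF J(2) c(2)]]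
    have "v \<cdot> (g J' \<cdot> prod_restrict D J J' A) = (ultra_inj D U X J' \<cdot> prod_map D J' A X c) \<cdot> prod_restrict D J J' A"
      using assoc_hom[OF rA g(1)[OF J(2)] vm(2)] g(2)[OF J(2)] by simp
    also have "\<dots> = ultra_inj D U X J' \<cdot> (prod_restrict D J J' X \<cdot> prod_map D J A X c)"
      using assoc_hom[OF rA cJ' ultra_inj_hom[OF X J(2)]]
        prod_restrict_natural[OF JI(1) J(3) on_index[OF J(1) c(2)]] by simp
    also have "\<dots> = v \<cdot> g J"
      using assoc_hom[OF cJ rX ultra_inj_hom[OF X J(2)]] ultra_inj_restrict[OF X J] g(2)[OF J(1)] by simp
    finally show "g J' \<cdot> prod_restrict D J J' A = g J"
      using mono_cancel[OF vm comp_hom[OF g(1)[OF J(2)] rA] g(1)[OF J(1)]] by simp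
  qed
  then obtain u where u: "u \<in> hom D (ultra_obj D U A) (Dom D v)" "\<And>J. J \<in> U \<Longrightarrow> u \<cdot> ultra_inj D U A J = g J"
    by blast
  have "v \<cdot> u = ultra_map D U A X c"
  proof (rule ultra_ext[OF A comp_hom[OF vm(2) u(1)] ch])
    show "(v \<cdot> u) \<cdot> ultra_inj D U A J = ultra_map D U A X c \<cdot> ultra_inj D U A J" if J: "J \<in> U" for J
      using assoc_hom[OF ultra_inj_hom[OF A J] u(1) vm(2)] u(2)[OF J] g(2)[OF J] ultra_map_inj[OF c(2) J]
      by simp
  qed
  then show ?thesis using sub_leI[OF ultra_Sub[OF c] v] u(1) ch by (simp add: hom_def)
qed

text \<open>Every \<open>J' \<in> U\<close> meets \<open>J\<close>, so the product over \<open>J'\<close> projects to an initial object and is initial by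
  strictness. Hence the ultraproduct maps to an initial object as well.\<close>

lemma ultra_initial:
  assumes x: "\<forall>i\<in>I. x i \<in> Obj D" and J: "J \<in> U" and init: "\<forall>i\<in>J. is_initial D (x i)"
  shows "is_initial D (ultra_obj D U x)"
proof -
  have prod: "is_initial D (prod_obj D J' x)" if J': "J' \<in> U" for J'
  proof -
    obtain i where "i \<in> J" "i \<in> J'" using U_nonempty[OF U_Int[OF J J']] by blast
    then show ?thesis using strict_initial init proj_hom[OF U_subset[OF J'] on_index[OF J' x]] by blast
  qed
  obtain i where i: "i \<in> J" using U_nonempty[OF J] by blast
  then have z: "x i \<in> Obj D" using x U_subset[OF J] by blast
  have "\<forall>J'\<in>U. \<exists>r. r \<in> hom D (prod_obj D J' x) (x i)"
    using prod z unfolding is_initial_def by blast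
  then obtain r where r: "\<And>J'. J' \<in> U \<Longrightarrow> r J' \<in> hom D (prod_obj D J' x) (x i)" by metis
  have "\<exists>!u. u \<in> hom D (ultra_obj D U x) (x i) \<and> (\<forall>J'\<in>U. u \<cdot> ultra_inj D U x J' = r J')"
  proof (rule ultra_desc[OF x z r])
    fix J' J'' assume J': "J' \<in> U" "J'' \<in> U" "J'' \<subseteq> J'"
    have "r J'' \<cdot> prod_restrict D J' J'' x \<in> hom D (prod_obj D J' x) (x i)"
      using comp_hom[OF r[OF J'(2)] prod_restrict_hom[OF U_subset[OF J'(1)] J'(3) on_index[OF J'(1) x]]] .
    then show "r J'' \<cdot> prod_restrict D J' J'' x = r J'"
      using prod[OF J'(1)] r[OF J'(1)] z unfolding is_initial_def by blast
  qed
  then show ?thesis using strict_initial i init by blast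
qed

end


section \<open>Effective epimorphisms, unions and inclusions\<close>

text \<open>The remaining conditions on the category, for index sets contained in \<open>I\<close>.\<close>

locale boolean_ultraproducts = exact_ultraproducts D I U
  for D :: "('o, 'm) cat" (structure) and I :: "'i set" and U :: "'i set set" +
  assumes prod_effective_epi: "\<lbrakk>J \<subseteq> I; \<forall>i\<in>J. effective_epi D (e i); \<forall>i\<in>J. e i \<in> hom D (x i) (y i)\<rbrakk> \<Longrightarrow>
      effective_epi D (prod_map D J x y e)"
    and prod_noninitial: "\<lbrakk>J \<subseteq> I; \<forall>i\<in>J. x i \<in> Obj D; \<forall>i\<in>J. \<not> is_initial D (x i)\<rbrakk> \<Longrightarrow>
      \<not> is_initial D (prod_obj D J x)"
    and meets_distribute: "\<lbrakk>J \<subseteq> I; P \<in> Obj D; \<forall>i\<in>J. is_union D P {a False i, a True i} (u i);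
      is_meet D P (u ` J) m; \<forall>\<epsilon>\<in>J \<rightarrow>\<^sub>E UNIV. is_meet D P ((\<lambda>i. a (\<epsilon> i) i) ` J) (n \<epsilon>)\<rbrakk> \<Longrightarrow>
      is_union D P (n ` (J \<rightarrow>\<^sub>E UNIV)) m"
    and weakly_Boolean: "weakly_Boolean D"
begin

text \<open>The kernel pair of the ultraproduct is the ultraproduct of the kernel pairs. An arrow \<open>h\<close> that
  coequalizes it also coequalizes, on each product over \<open>J \<in> U\<close>, the kernel pair of the product of the
  \<open>e i\<close>, and that product is an effective epimorphism. The resulting factorizations are unique, hence
  compatible, and they define the factorization of \<open>h\<close> on the colimit.\<close>

lemma ultra_effective_epi:
  assumes e: "\<forall>i\<in>I. effective_epi D (e i)" "\<forall>i\<in>I. e i \<in> hom D (x i) (y i)"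
  shows "effective_epi D (ultra_map D U x y e)"
proof -
  have x: "\<forall>i\<in>I. x i \<in> Obj D" and y: "\<forall>i\<in>I. y i \<in> Obj D" using e(2) hom_objs by blast+
  have "\<forall>i\<in>I. \<exists>p q. is_pullback D (e i) (e i) p q" using e(1) unfolding effective_epi_def by blast
  then obtain p q where P: "\<forall>i\<in>I. is_pullback D (e i) (e i) (p i) (q i)" by metis
  let ?r = "\<lambda>i. Dom D (p i)"
  have p: "\<forall>i\<in>I. p i \<in> hom D (?r i) (x i)" and q: "\<forall>i\<in>I. q i \<in> hom D (?r i) (x i)"
    using is_pullbackD(1,2) P e(2) by blast+
  have r: "\<forall>i\<in>I. ?r i \<in> Obj D" using p hom_objs by blast
  let ?E = "ultra_map D U x y e" and ?P = "ultra_map D U ?r x p" and ?Q = "ultra_map D U ?r x q"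
  have K: "is_pullback D ?E ?E ?P ?Q" using ultra_pullback[OF P e(2) e(2) p] .
  note E = ultra_map_hom[OF e(2)] and Ph = ultra_map_hom[OF p] and Qh = ultra_map_hom[OF q]
  have univ: "\<exists>!u. u \<in> hom D (ultra_obj D U y) w \<and> u \<cdot> ?E = h"
    if h: "h \<in> hom D (ultra_obj D U x) w" and hPQ: "h \<cdot> ?P = h \<cdot> ?Q" for h w
  proof -
    note k = comp_hom[OF h ultra_inj_hom[OF x]]
    have eJ: "prod_map D J x y e \<in> hom D (prod_obj D J x) (prod_obj D J y)" if "J \<in> U" for J
      using prod_map_hom[OF U_subset[OF that] on_index[OF that e(2)]] .
    have uniq: "\<exists>!u. u \<in> hom D (prod_obj D J y) w \<and> u \<cdot> prod_map D J x y e = h \<cdot> ultra_inj D U x J"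
      if J: "J \<in> U" for J
    proof (rule effective_epi_factor[OF _ eJ[OF J] k[OF J]])
      note JI = U_subset[OF J]
      note xJ = on_index[OF J x] and yJ = on_index[OF J y] and rJ = on_index[OF J r]
        and pJ = on_index[OF J p] and qJ = on_index[OF J q] and eJ' = on_index[OF J e(2)]
      show "effective_epi D (prod_map D J x y e)"
        using prod_effective_epi[OF JI on_index[OF J e(1)] on_index[OF J e(2)]] .
      fix v s t assume s: "s \<in> hom D v (prod_obj D J x)" and t: "t \<in> hom D v (prod_obj D J x)"
        and st: "prod_map D J x y e \<cdot> s = prod_map D J x y e \<cdot> t"
      \<comment> \<open>the kernel pair of the product is the product of the kernel pairs\<close>
      have "\<exists>a. a \<in> hom D v (?r i) \<and> p i \<cdot> a = prod_proj D J x i \<cdot> s \<and> q i \<cdot> a = prod_proj D J x i \<cdot> t"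
        if i: "i \<in> J" for i
      proof -
        have eq: "e i \<cdot> (prod_proj D J x i \<cdot> s') = prod_proj D J y i \<cdot> (prod_map D J x y e \<cdot> s')"
          if "s' \<in> hom D v (prod_obj D J x)" for s'
          using assoc_hom[OF that proj_hom[OF JI xJ i] bspec[OF eJ' i]]
            assoc_hom[OF that eJ[OF J] proj_hom[OF JI yJ i]] prod_map_proj[OF JI eJ' i] by simp
        have "i \<in> I" using i JI by blast
        then show ?thesis
          using is_pullbackD(4)[OF bspec[OF P] bspec[OF e(2)] bspec[OF e(2)]
              comp_hom[OF proj_hom[OF JI xJ i] s] comp_hom[OF proj_hom[OF JI xJ i] t]]
            eq[OF s] eq[OF t] st by auto
      qed
      then obtain a where a: "\<forall>i\<in>J. a i \<in> hom D v (?r i)"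
        "\<forall>i\<in>J. p i \<cdot> a i = prod_proj D J x i \<cdot> s" "\<forall>i\<in>J. q i \<cdot> a i = prod_proj D J x i \<cdot> t"
        by metis
      have v: "v \<in> Obj D" using s hom_objs by blast
      obtain b where b: "b \<in> hom D v (prod_obj D J ?r)" "\<forall>i\<in>J. prod_proj D J ?r i \<cdot> b = a i"
        using prod_tuple[OF JI a(1) v] by blast
      have lift: "s' = prod_map D J ?r x p' \<cdot> b"
        if p': "\<forall>i\<in>J. p' i \<in> hom D (?r i) (x i)" and s': "s' \<in> hom D v (prod_obj D J x)"
          and ps: "\<forall>i\<in>J. p' i \<cdot> a i = prod_proj D J x i \<cdot> s'" for p' s'
      proof (rule prod_ext[OF JI xJ s' comp_hom[OF prod_map_hom[OF JI p'] b(1)]])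
        show "prod_proj D J x i \<cdot> s' = prod_proj D J x i \<cdot> (prod_map D J ?r x p' \<cdot> b)" if i: "i \<in> J" for i
          using assoc_hom[OF b(1) prod_map_hom[OF JI p'] proj_hom[OF JI xJ i]]
            assoc_hom[OF b(1) proj_hom[OF JI rJ i] bspec[OF p' i]] prod_map_proj[OF JI p' i]
            bspec[OF ps i] bspec[OF b(2) i] by simp
      qed
      have hI: "(h \<cdot> ultra_inj D U x J) \<cdot> (prod_map D J ?r x p' \<cdot> b)
          = (h \<cdot> ultra_map D U ?r x p') \<cdot> (ultra_inj D U ?r J \<cdot> b)"
        if p': "\<forall>i\<in>I. p' i \<in> hom D (?r i) (x i)" for p'
      proof -
        note m = prod_map_hom[OF JI on_index[OF J p']] and ij = ultra_inj_hom[OF x J]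
          and ir = ultra_inj_hom[OF r J] and M = ultra_map_hom[OF p']
        have "(h \<cdot> ultra_inj D U x J) \<cdot> (prod_map D J ?r x p' \<cdot> b)
            = h \<cdot> ((ultra_inj D U x J \<cdot> prod_map D J ?r x p') \<cdot> b)"
          using assoc_hom[OF comp_hom[OF m b(1)] ij h] assoc_hom[OF b(1) m ij] by simp
        also have "\<dots> = h \<cdot> (ultra_map D U ?r x p' \<cdot> (ultra_inj D U ?r J \<cdot> b))"
          using ultra_map_inj[OF p' J] assoc_hom[OF b(1) ir M] by simp
        also have "\<dots> = (h \<cdot> ultra_map D U ?r x p') \<cdot> (ultra_inj D U ?r J \<cdot> b)"
          using assoc_hom[OF comp_hom[OF ir b(1)] M h] by simp
        finally show ?thesis .
      qed
      show "(h \<cdot> ultra_inj D U x J) \<cdot> s = (h \<cdot> ultra_inj D U x J) \<cdot> t"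
        unfolding lift[OF pJ s a(2)] lift[OF qJ t a(3)] hI[OF p] hI[OF q] hPQ ..
    qed
    then obtain g where g: "\<And>J. J \<in> U \<Longrightarrow> g J \<in> hom D (prod_obj D J y) w"
      "\<And>J. J \<in> U \<Longrightarrow> g J \<cdot> prod_map D J x y e = h \<cdot> ultra_inj D U x J"
      by metis
    have gu: "g' = g J" if "J \<in> U" "g' \<in> hom D (prod_obj D J y) w"
        "g' \<cdot> prod_map D J x y e = h \<cdot> ultra_inj D U x J" for g' J
      using uniq[OF that(1)] g[OF that(1)] that(2,3) by blast
    have "\<exists>!u. u \<in> hom D (ultra_obj D U y) w \<and> (\<forall>J\<in>U. u \<cdot> ultra_inj D U y J = g J)"
    proof (rule ultra_desc[OF y _ g(1)])
      show "w \<in> Obj D" using h hom_objs by blast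
      fix J J' assume J: "J \<in> U" "J' \<in> U" "J' \<subseteq> J"
      note ry = prod_restrict_hom[OF U_subset[OF J(1)] J(3) on_index[OF J(1) y]]
        and rx = prod_restrict_hom[OF U_subset[OF J(1)] J(3) on_index[OF J(1) x]]
      have "(g J' \<cdot> prod_restrict D J J' y) \<cdot> prod_map D J x y e = g J' \<cdot> (prod_map D J' x y e \<cdot> prod_restrict D J J' x)"
        using assoc_hom[OF eJ[OF J(1)] ry g(1)[OF J(2)]]
          prod_restrict_natural[OF U_subset[OF J(1)] J(3) on_index[OF J(1) e(2)]] by simp
      also have "\<dots> = (h \<cdot> ultra_inj D U x J') \<cdot> prod_restrict D J J' x"
        using assoc_hom[OF rx eJ[OF J(2)] g(1)[OF J(2)]] g(2)[OF J(2)] by simp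
      also have "\<dots> = h \<cdot> ultra_inj D U x J"
        using assoc_hom[OF rx ultra_inj_hom[OF x J(2)] h] ultra_inj_restrict[OF x J] by simp
      finally show "g J' \<cdot> prod_restrict D J J' y = g J"
        using gu[OF J(1) comp_hom[OF g(1)[OF J(2)] ry]] by blast
    qed
    then obtain u where u: "u \<in> hom D (ultra_obj D U y) w" "\<And>J. J \<in> U \<Longrightarrow> u \<cdot> ultra_inj D U y J = g J"
      by blast
    have EI: "(v \<cdot> ?E) \<cdot> ultra_inj D U x J = (v \<cdot> ultra_inj D U y J) \<cdot> prod_map D J x y e"
      if v: "v \<in> hom D (ultra_obj D U y) w" and J: "J \<in> U" for v J
      using assoc_hom[OF ultra_inj_hom[OF x J] E v] ultra_map_inj[OF e(2) J]
        assoc_hom[OF eJ[OF J] ultra_inj_hom[OF y J] v] by simp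
    show ?thesis
    proof (intro ex1I conjI, rule u(1))
      show "u \<cdot> ?E = h"
        using EI[OF u(1)] u(2) g(2) by (intro ultra_ext[OF x comp_hom[OF u(1) E] h]) simp
      fix v assume v: "v \<in> hom D (ultra_obj D U y) w \<and> v \<cdot> ?E = h"
      then have vh: "v \<in> hom D (ultra_obj D U y) w" by blast
      have "v \<cdot> ultra_inj D U y J = u \<cdot> ultra_inj D U y J" if J: "J \<in> U" for J
        using gu[OF J comp_hom[OF vh ultra_inj_hom[OF y J]]] EI[OF vh J] v u(2)[OF J] by simp
      then show "v = u" by (rule ultra_ext[OF y vh u(1)])
    qed
  qed
  have "is_coequalizer D ?P ?Q ?E"
    unfolding is_coequalizer_def
    using E Ph Qh is_pullbackD(3)[OF K E E] univ by (auto simp: hom_def)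
  then show ?thesis using K unfolding effective_epi_def by blast
qed

end


context small_products begin

lemma prod_mono:
  assumes J: "J \<subseteq> I" and a: "\<forall>i\<in>J. mono_arr D (a i)" "\<forall>i\<in>J. a i \<in> hom D (A i) (X i)"
  shows "mono_arr D (prod_map D J A X a)"
proof -
  have A: "\<forall>i\<in>J. A i \<in> Obj D" and X: "\<forall>i\<in>J. X i \<in> Obj D" using a hom_objs by blast+
  note aJ = prod_map_hom[OF J a(2)]
  show ?thesis
  proof (rule mono_arrI[OF aJ])
    fix w s t assume st: "s \<in> hom D w (prod_obj D J A)" "t \<in> hom D w (prod_obj D J A)"
      "prod_map D J A X a \<cdot> s = prod_map D J A X a \<cdot> t"
    show "s = t"
    proof (rule prod_ext[OF J A st(1,2)])
      fix i assume i: "i \<in> J"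
      have eq: "a i \<cdot> (prod_proj D J A i \<cdot> s') = prod_proj D J X i \<cdot> (prod_map D J A X a \<cdot> s')"
        if "s' \<in> hom D w (prod_obj D J A)" for s'
        using assoc_hom[OF that proj_hom[OF J A i] bspec[OF a(2) i]]
          assoc_hom[OF that aJ proj_hom[OF J X i]] prod_map_proj[OF J a(2) i] by simp
      show "prod_proj D J A i \<cdot> s = prod_proj D J A i \<cdot> t"
        using mono_cancel[OF bspec[OF a(1) i] bspec[OF a(2) i] comp_hom[OF proj_hom[OF J A i] st(1)]
            comp_hom[OF proj_hom[OF J A i] st(2)]] eq[OF st(1)] eq[OF st(2)] st(3) by simp
    qed
  qed
qed

text \<open>An arrow into the product of the \<open>X i\<close> factors through the product of the \<open>a i\<close> if and only if each
  of its components factors through \<open>a i\<close>.\<close>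

lemma prod_is_meet:
  assumes J: "J \<subseteq> I" and a: "\<forall>i\<in>J. mono_arr D (a i)" "\<forall>i\<in>J. a i \<in> hom D (A i) (X i)"
    and b: "\<forall>i\<in>J. is_preimage D (prod_proj D J X i) (a i) (b i)"
  shows "is_meet D (prod_obj D J X) (b ` J) (prod_map D J A X a)"
proof -
  have A: "\<forall>i\<in>J. A i \<in> Obj D" and X: "\<forall>i\<in>J. X i \<in> Obj D" using a hom_objs by blast+
  note aJ = prod_map_hom[OF J a(2)]
  have aS: "prod_map D J A X a \<in> Sub D (prod_obj D J X)" using SubI[OF prod_mono[OF J a] aJ] .
  have ai: "a i \<in> Sub D (X i)" "Dom D (a i) = A i" if "i \<in> J" for i
    using SubI a that by (blast, auto simp: hom_def)
  have bS: "b i \<in> Sub D (prod_obj D J X)" and le: "w \<in> Sub D (prod_obj D J X) \<Longrightarrow>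
      sub_le D (prod_obj D J X) w (b i) \<longleftrightarrow> (\<exists>h\<in>hom D (Dom D w) (A i). a i \<cdot> h = prod_proj D J X i \<cdot> w)"
    if i: "i \<in> J" for i w
    using preimage_le_iff[OF proj_hom[OF J X i] ai(1)[OF i] bspec[OF b i]] ai(2)[OF i] by auto
  show ?thesis
    unfolding is_meet_def
  proof (intro conjI ballI impI, use bS in blast, rule aS)
    fix c assume "c \<in> b ` J"
    then obtain i where i: "i \<in> J" "c = b i" by blast
    have "Dom D (prod_map D J A X a) = prod_obj D J A" using aJ by (simp add: hom_def)
    then show "sub_le D (prod_obj D J X) (prod_map D J A X a) c"
      using le[OF i(1) aS] i(2) proj_hom[OF J A i(1)] prod_map_proj[OF J a(2) i(1)] by auto
  next
    fix v assume v: "v \<in> Sub D (prod_obj D J X)" and "\<forall>c\<in>b ` J. sub_le D (prod_obj D J X) v c"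
    then have "\<forall>i\<in>J. \<exists>h\<in>hom D (Dom D v) (A i). a i \<cdot> h = prod_proj D J X i \<cdot> v" using le by blast
    then obtain h where h: "\<forall>i\<in>J. h i \<in> hom D (Dom D v) (A i)" "\<forall>i\<in>J. a i \<cdot> h i = prod_proj D J X i \<cdot> v"
      by metis
    have vh: "v \<in> hom D (Dom D v) (prod_obj D J X)" using SubD[OF v] by blast
    then obtain t where t: "t \<in> hom D (Dom D v) (prod_obj D J A)" "\<forall>i\<in>J. prod_proj D J A i \<cdot> t = h i"
      using prod_tuple[OF J h(1)] hom_objs by blast
    have "prod_map D J A X a \<cdot> t = v"
    proof (rule prod_ext[OF J X comp_hom[OF aJ t(1)] vh])
      fix i assume i: "i \<in> J"
      show "prod_proj D J X i \<cdot> (prod_map D J A X a \<cdot> t) = prod_proj D J X i \<cdot> v"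
        using assoc_hom[OF t(1) aJ proj_hom[OF J X i]] prod_map_proj[OF J a(2) i]
          assoc_hom[OF t(1) proj_hom[OF J A i] bspec[OF a(2) i]] bspec[OF t(2) i] bspec[OF h(2) i]
        by simp
    qed
    then show "sub_le D (prod_obj D J X) v (prod_map D J A X a)"
      using sub_leI[OF v aS] t(1) aJ by (simp add: hom_def)
  qed
qed

end


context boolean_ultraproducts begin

text \<open>
  The product of the \<open>c i\<close> is the meet of their preimages under the projections. By stability of
  unions these are the unions of the preimages of \<open>a False i\<close> and \<open>a True i\<close>, and distributivity
  turns the meet of the unions into a union of meets, each of which is again a product.
\<close>

lemma prod_union:
  assumes J: "J \<subseteq> I" and a: "\<And>s. \<forall>i\<in>J. mono_arr D (a s i)" "\<And>s. \<forall>i\<in>J. a s i \<in> hom D (A s i) (X i)"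
    and c: "\<forall>i\<in>J. c i \<in> hom D (C i) (X i)" and cu: "\<forall>i\<in>J. is_union D (X i) {a False i, a True i} (c i)"
  shows "is_union D (prod_obj D J X)
    ((\<lambda>\<epsilon>. prod_map D J (\<lambda>i. A (\<epsilon> i) i) X (\<lambda>i. a (\<epsilon> i) i)) ` (J \<rightarrow>\<^sub>E UNIV)) (prod_map D J C X c)"
proof -
  have X: "\<forall>i\<in>J. X i \<in> Obj D" using c hom_objs by blast
  let ?P = "prod_obj D J X"
  have aS: "a s i \<in> Sub D (X i)" if "i \<in> J" for s i using SubI a that by blast
  have cS: "c i \<in> Sub D (X i)" if "i \<in> J" for i using cu that unfolding is_union_def by blast
  have cm: "\<forall>i\<in>J. mono_arr D (c i)" using cS SubD by blast
  note pr = proj_hom[OF J X]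
  have "\<forall>i\<in>J. \<forall>s. \<exists>b. is_preimage D (prod_proj D J X i) (a s i) b" using ex_preimage pr aS by blast
  then obtain b where "\<forall>i\<in>J. \<forall>s. is_preimage D (prod_proj D J X i) (a s i) (b i s)" by metis
  then have b: "\<forall>i\<in>J. is_preimage D (prod_proj D J X i) (a s i) (b i s)" for s by blast
  have "\<forall>i\<in>J. \<exists>u. is_preimage D (prod_proj D J X i) (c i) u" using ex_preimage pr cS by blast
  then obtain u where u: "\<forall>i\<in>J. is_preimage D (prod_proj D J X i) (c i) (u i)" by metis
  have "\<forall>i\<in>J. is_union D ?P {b i False, b i True} (u i)"
  proof
    fix i assume i: "i \<in> J"
    have "is_union D ?P {b'. \<exists>a'\<in>{a False i, a True i}. is_preimage D (prod_proj D J X i) a' b'} (u i)"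
      using union_preimage[OF _ bspec[OF cu i] pr[OF i] bspec[OF u i]] by simp
    then show "is_union D ?P {b i False, b i True} (u i)"
    proof (rule union_cong)
      have bi: "is_preimage D (prod_proj D J X i) (a s i) (b i s)" for s using b i by blast
      show "{b i False, b i True} \<subseteq> Sub D ?P"
        using preimage_le_iff(1)[OF pr[OF i] aS[OF i] bi] by blast
      show "\<exists>b''\<in>{b i False, b i True}. sub_le D ?P b' b''"
        if "b' \<in> {b'. \<exists>a'\<in>{a False i, a True i}. is_preimage D (prod_proj D J X i) a' b'}" for b'
        using that preimage_le[OF pr[OF i] aS[OF i] _ bi] by blast
      show "\<exists>b'\<in>{b'. \<exists>a'\<in>{a False i, a True i}. is_preimage D (prod_proj D J X i) a' b'}. sub_le D ?P b'' b'"
        if "b'' \<in> {b i False, b i True}" for b''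
        using that bi preimage_le[OF pr[OF i] aS[OF i] bi bi] by blast
    qed
  qed
  moreover have "is_meet D ?P (u ` J) (prod_map D J C X c)" using prod_is_meet[OF J cm c u] .
  moreover have "\<forall>\<epsilon>\<in>J \<rightarrow>\<^sub>E UNIV. is_meet D ?P ((\<lambda>i. b i (\<epsilon> i)) ` J)
      (prod_map D J (\<lambda>i. A (\<epsilon> i) i) X (\<lambda>i. a (\<epsilon> i) i))"
    using a b by (intro ballI prod_is_meet[OF J]) blast+
  ultimately show ?thesis
    by (rule meets_distribute[OF J prod_obj[OF J X], where a = "\<lambda>s i. b i s"])
qed

text \<open>Let \<open>v\<close> contain the ultraproducts of both families. The product of the \<open>c i\<close> over \<open>J \<in> U\<close> is the union
  of the products of the \<open>a (\<epsilon> i) i\<close>, where \<open>\<epsilon>\<close> is a choice of sides. On some set \<open>J0 \<in> U\<close> the choice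
  \<open>\<epsilon>\<close> has a constant value \<open>s\<close>, so that the corresponding product lies in the preimage of the
  ultraproduct of \<open>a s\<close> and therefore in the preimage of \<open>v\<close>.\<close>

lemma ultra_binary_union:
  assumes a: "\<And>s. \<forall>i\<in>I. a s i \<in> hom D (A s i) (X i)" and c: "\<forall>i\<in>I. c i \<in> hom D (C i) (X i)"
    and cu: "\<forall>i\<in>I. is_union D (X i) {a False i, a True i} (c i)"
  shows "is_union D (ultra_obj D U X) {ultra_map D U (A False) X (a False), ultra_map D U (A True) X (a True)}
    (ultra_map D U C X c)"
proof -
  let ?X = "ultra_obj D U X" and ?a = "\<lambda>s. ultra_map D U (A s) X (a s)" and ?c = "ultra_map D U C X c"
  have A: "\<forall>i\<in>I. A s i \<in> Obj D" for s using a hom_objs by blast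
  have X: "\<forall>i\<in>I. X i \<in> Obj D" and C: "\<forall>i\<in>I. C i \<in> Obj D" using c hom_objs by blast+
  have "\<forall>i\<in>I. a s i \<in> Sub D (X i) \<and> c i \<in> Sub D (X i)" for s
    using cu unfolding is_union_def by (cases s) auto
  then have am: "\<forall>i\<in>I. mono_arr D (a s i)" and cm: "\<forall>i\<in>I. mono_arr D (c i)" for s using SubD by blast+
  have aS: "?a s \<in> Sub D ?X" for s using ultra_Sub[OF am a] .
  have cS: "?c \<in> Sub D ?X" using ultra_Sub[OF cm c] .
  note ah = ultra_map_hom[OF a] and ch = ultra_map_hom[OF c]
  have upper: "sub_le D ?X (?a s) ?c" for s
  proof -
    have "\<forall>i\<in>I. sub_le D (X i) (a s i) (c i)" using cu unfolding is_union_def by (cases s) auto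
    then have "\<forall>i\<in>I. \<exists>h. h \<in> hom D (Dom D (a s i)) (Dom D (c i)) \<and> a s i = c i \<cdot> h"
      unfolding sub_le_def by blast
    then obtain h where h: "\<forall>i\<in>I. h i \<in> hom D (Dom D (a s i)) (Dom D (c i))" "\<forall>i\<in>I. a s i = c i \<cdot> h i"
      by metis
    have "\<forall>i\<in>I. h i \<in> hom D (A s i) (C i)" using h(1) a[of s] c by (simp add: hom_def)
    then have "?c \<cdot> ultra_map D U (A s) C h = ?a s"
      and "ultra_map D U (A s) C h \<in> hom D (ultra_obj D U (A s)) (ultra_obj D U C)"
      using ultra_map_comp[OF _ c, of h "A s"] ultra_map_hom ultra_map_cong[of "a s" "\<lambda>i. c i \<cdot> h i"] h(2)
      by auto
    then show ?thesis using sub_leI[OF aS cS] ah[of s] ch by (simp add: hom_def)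
  qed
  have least: "sub_le D ?X ?c v" if v: "v \<in> Sub D ?X" and av: "\<And>s. sub_le D ?X (?a s) v" for v
  proof (rule ultra_leI[OF cm c v])
    fix J assume J: "J \<in> U"
    note JI = U_subset[OF J] and XJ = on_index[OF J X] and cJ = on_index[OF J c]
    have vm: "mono_arr D v" "v \<in> hom D (Dom D v) ?X" using SubD[OF v] by auto
    note inj = ultra_inj_hom[OF X J]
    have "\<exists>k. k \<in> hom D (ultra_obj D U (A s)) (Dom D v) \<and> v \<cdot> k = ?a s" for s
      using av[of s] ah[of s] unfolding sub_le_def by (auto simp: hom_def)
    then obtain k where k: "\<And>s. k s \<in> hom D (ultra_obj D U (A s)) (Dom D v)" "\<And>s. v \<cdot> k s = ?a s"
      by metis
    obtain w where w: "is_preimage D (ultra_inj D U X J) v w" using ex_preimage[OF inj v] by blast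
    let ?A = "\<lambda>\<epsilon> i. A (\<epsilon> i) i" and ?a\<epsilon> = "\<lambda>\<epsilon> i. a (\<epsilon> i) i"
    have "sub_le D (prod_obj D J X) (prod_map D J (?A \<epsilon>) X (?a\<epsilon> \<epsilon>)) w" for \<epsilon>
    proof -
      \<comment> \<open>one of the two halves of \<open>J\<close> on which \<open>\<epsilon>\<close> is constant belongs to the ultrafilter\<close>
      obtain s where s: "{i \<in> J. \<epsilon> i = s} \<in> U"
      proof (cases "{i \<in> J. \<epsilon> i} \<in> U")
        case True
        then show ?thesis using that[of True] by simp
      next
        case False
        have "{i \<in> J. \<epsilon> i} \<subseteq> I" using JI by blast
        then have "I - {i \<in> J. \<epsilon> i} \<in> U" using False U_compl by blast
        then have "(I - {i \<in> J. \<epsilon> i}) \<inter> J \<in> U" using U_Int J by blast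
        moreover have "(I - {i \<in> J. \<epsilon> i}) \<inter> J = {i \<in> J. \<epsilon> i = False}" using JI by auto
        ultimately show ?thesis using that[of False] by simp
      qed
      define J0 where "J0 = {i \<in> J. \<epsilon> i = s}"
      have J0: "J0 \<in> U" "J0 \<subseteq> J" "\<And>i. i \<in> J0 \<Longrightarrow> \<epsilon> i = s" using s by (auto simp: J0_def)
      note J0I = U_subset[OF J0(1)] and XJ0 = on_index[OF J0(1) X]
        and aJ0 = on_index[OF J0(1) a[of s]] and AJ0 = on_index[OF J0(1) A[of s]]
      have ae: "\<forall>i\<in>J. ?a\<epsilon> \<epsilon> i \<in> hom D (?A \<epsilon> i) (X i)" and aem: "\<forall>i\<in>J. mono_arr D (?a\<epsilon> \<epsilon> i)"
        using a am JI by blast+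
      then have Ae: "\<forall>i\<in>J. ?A \<epsilon> i \<in> Obj D" using hom_objs by blast
      note ne = prod_map_hom[OF JI ae]
      have nS: "prod_map D J (?A \<epsilon>) X (?a\<epsilon> \<epsilon>) \<in> Sub D (prod_obj D J X)"
        using SubI[OF prod_mono[OF JI aem ae] ne] .
      have "\<forall>i\<in>J0. prod_proj D J (?A \<epsilon>) i \<in> hom D (prod_obj D J (?A \<epsilon>)) (A s i)"
        using proj_hom[OF JI Ae] J0(2,3) by fastforce
      then obtain m where m: "m \<in> hom D (prod_obj D J (?A \<epsilon>)) (prod_obj D J0 (A s))"
          "\<forall>i\<in>J0. prod_proj D J0 (A s) i \<cdot> m = prod_proj D J (?A \<epsilon>) i"
        using prod_tuple[OF J0I _ prod_obj[OF JI Ae]] by blast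
      note aM = prod_map_hom[OF J0I aJ0] and rX = prod_restrict_hom[OF JI J0(2) XJ]
      have restr: "prod_map D J0 (A s) X (a s) \<cdot> m = prod_restrict D J J0 X \<cdot> prod_map D J (?A \<epsilon>) X (?a\<epsilon> \<epsilon>)"
      proof (rule prod_ext[OF J0I XJ0 comp_hom[OF aM m(1)] comp_hom[OF rX ne]])
        fix i assume i: "i \<in> J0"
        then have iJ: "i \<in> J" using J0 by blast
        have "prod_proj D J0 X i \<cdot> (prod_map D J0 (A s) X (a s) \<cdot> m) = a s i \<cdot> prod_proj D J (?A \<epsilon>) i"
          using assoc_hom[OF m(1) aM proj_hom[OF J0I XJ0 i]] prod_map_proj[OF J0I aJ0 i]
            assoc_hom[OF m(1) proj_hom[OF J0I AJ0 i] bspec[OF aJ0 i]] bspec[OF m(2) i] by simp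
        also have "\<dots> = prod_proj D J X i \<cdot> prod_map D J (?A \<epsilon>) X (?a\<epsilon> \<epsilon>)"
          using prod_map_proj[OF JI ae iJ] J0(3)[OF i] by simp
        also have "\<dots> = prod_proj D J0 X i \<cdot> (prod_restrict D J J0 X \<cdot> prod_map D J (?A \<epsilon>) X (?a\<epsilon> \<epsilon>))"
          using assoc_hom[OF ne rX proj_hom[OF J0I XJ0 i]] prod_restrict_proj[OF JI J0(2) XJ i] by simp
        finally show "prod_proj D J0 X i \<cdot> (prod_map D J0 (A s) X (a s) \<cdot> m)
            = prod_proj D J0 X i \<cdot> (prod_restrict D J J0 X \<cdot> prod_map D J (?A \<epsilon>) X (?a\<epsilon> \<epsilon>))" .
      qed
      note iA = ultra_inj_hom[OF A[of s] J0(1)] and iX = ultra_inj_hom[OF X J0(1)]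
      let ?h = "k s \<cdot> (ultra_inj D U (A s) J0 \<cdot> m)"
      have h: "?h \<in> hom D (prod_obj D J (?A \<epsilon>)) (Dom D v)" using comp_hom[OF k(1) comp_hom[OF iA m(1)]] .
      have "v \<cdot> ?h = (?a s \<cdot> ultra_inj D U (A s) J0) \<cdot> m"
        using assoc_hom[OF comp_hom[OF iA m(1)] k(1) vm(2)] k(2) assoc_hom[OF m(1) iA ah] by simp
      also have "\<dots> = ultra_inj D U X J0 \<cdot> (prod_restrict D J J0 X \<cdot> prod_map D J (?A \<epsilon>) X (?a\<epsilon> \<epsilon>))"
        using ultra_map_inj[OF a J0(1)] assoc_hom[OF m(1) aM iX] restr by simp
      also have "\<dots> = ultra_inj D U X J \<cdot> prod_map D J (?A \<epsilon>) X (?a\<epsilon> \<epsilon>)"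
        using assoc_hom[OF ne rX iX] ultra_inj_restrict[OF X J J0(1,2)] by simp
      finally show ?thesis
        using preimage_le_iff(2)[OF inj v w nS] h ne by (auto simp: hom_def)
    qed
    moreover have "w \<in> Sub D (prod_obj D J X)" using preimage_le_iff(1)[OF inj v w] .
    moreover have "is_union D (prod_obj D J X)
        ((\<lambda>\<epsilon>. prod_map D J (?A \<epsilon>) X (?a\<epsilon> \<epsilon>)) ` (J \<rightarrow>\<^sub>E UNIV)) (prod_map D J C X c)"
      using prod_union[OF JI on_index[OF J am] on_index[OF J a] cJ on_index[OF J cu]] .
    ultimately have le: "sub_le D (prod_obj D J X) (prod_map D J C X c) w"
      unfolding is_union_def by blast
    then have "prod_map D J C X c \<in> Sub D (prod_obj D J X)" unfolding sub_le_def by blast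
    from preimage_le_iff(2)[OF inj v w this] le
    show "\<exists>g\<in>hom D (prod_obj D J C) (Dom D v). v \<cdot> g = ultra_inj D U X J \<cdot> prod_map D J C X c"
      using prod_map_hom[OF JI cJ] by (auto simp: hom_def)
  qed
  show ?thesis
    unfolding is_union_def
  proof (intro conjI ballI impI, use aS in blast, rule cS)
    show "sub_le D ?X b ?c" if "b \<in> {?a False, ?a True}" for b using that upper by blast
    fix v assume v: "v \<in> Sub D ?X" "\<forall>b\<in>{?a False, ?a True}. sub_le D ?X b v"
    have "sub_le D ?X (?a s) v" for s using v(2) by (cases s) auto
    then show "sub_le D ?X ?c v" using least v(1) by blast
  qed
qed

text \<open>Adding one subobject at a time reduces finite unions to binary ones; the empty union is a
  subobject with initial domain.\<close>

lemma ultra_finite_union: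
  assumes "finite S" and a: "\<forall>s\<in>S. \<forall>i\<in>I. a s i \<in> hom D (A s i) (X i)"
    and X: "\<forall>i\<in>I. X i \<in> Obj D" and u: "\<forall>i\<in>I. u i \<in> hom D (V i) (X i)"
    and uu: "\<forall>i\<in>I. is_union D (X i) ((\<lambda>s. a s i) ` S) (u i)"
  shows "is_union D (ultra_obj D U X) ((\<lambda>s. ultra_map D U (A s) X (a s)) ` S) (ultra_map D U V X u)"
  using assms(1) a u uu
proof (induction S arbitrary: u V rule: finite_induct)
  case empty
  then have e: "\<forall>i\<in>I. is_union D (X i) {} (u i)" by simp
  then have um: "\<forall>i\<in>I. mono_arr D (u i)" using SubD unfolding is_union_def by blast
  have uh: "\<forall>i\<in>I. u i \<in> hom D (V i) (X i)" using empty by blast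
  then have "\<forall>i\<in>I. Dom D (u i) = V i" by (simp add: hom_def)
  then have "\<forall>i\<in>I. is_initial D (V i)" using e X empty_union_iff by metis
  moreover have "\<forall>i\<in>I. V i \<in> Obj D" using uh hom_objs by blast
  ultimately have "is_initial D (ultra_obj D U V)" using ultra_initial U_I by blast
  then show ?case
    using empty_union_iff[OF ultra_obj[OF X]] ultra_Sub[OF um uh] ultra_map_hom[OF uh]
    by (simp add: hom_def)
next
  case (insert t S)
  have aS: "\<forall>s\<in>S. \<forall>i\<in>I. a s i \<in> hom D (A s i) (X i)" and at: "\<forall>i\<in>I. a t i \<in> hom D (A t i) (X i)"
    and un: "\<And>i. i \<in> I \<Longrightarrow> is_union D (X i) (insert (a t i) ((\<lambda>s. a s i) ` S)) (u i)"
    and uh: "\<forall>i\<in>I. u i \<in> hom D (V i) (X i)"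
    using insert.prems by auto
  have "\<forall>i\<in>I. \<exists>v. is_union D (X i) ((\<lambda>s. a s i) ` S) v"
  proof
    fix i assume i: "i \<in> I"
    have "(\<lambda>s. a s i) ` S \<subseteq> Sub D (X i)" using un[OF i] unfolding is_union_def by blast
    then show "\<exists>v. is_union D (X i) ((\<lambda>s. a s i) ` S) v"
      using ex_finite_union finite_imageI[OF insert.hyps(1)] X i by blast
  qed
  then obtain v where v: "\<forall>i\<in>I. is_union D (X i) ((\<lambda>s. a s i) ` S) (v i)" by metis
  have vh: "\<forall>i\<in>I. v i \<in> hom D (Dom D (v i)) (X i)" using v SubD unfolding is_union_def by blast
  let ?b = "\<lambda>s. if s then a t else v" and ?B = "\<lambda>s. if s then A t else (\<lambda>i. Dom D (v i))"
  have bh: "\<forall>i\<in>I. ?b s i \<in> hom D (?B s i) (X i)" for s using at vh by simp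
  have "\<forall>i\<in>I. is_union D (X i) {?b False i, ?b True i} (u i)"
    using union_insert[OF un] v by (simp add: insert_commute)
  from ultra_binary_union[of ?b ?B, OF bh uh this]
  have "is_union D (ultra_obj D U X) {ultra_map D U (A t) X (a t), ultra_map D U (\<lambda>i. Dom D (v i)) X v}
      (ultra_map D U V X u)" by (simp add: insert_commute)
  then show ?case
    using union_insertI[OF insert.IH[OF aS vh v]] by simp
qed

text \<open>The factorizations exist on the set \<open>G\<close> of good indices, so on the product over \<open>J \<in> U\<close> one first
  restricts to \<open>J \<inter> G \<in> U\<close>.\<close>

lemma ultra_le:
  assumes a: "\<forall>i\<in>I. mono_arr D (a i)" "\<forall>i\<in>I. a i \<in> hom D (A i) (X i)"
    and b: "\<forall>i\<in>I. mono_arr D (b i)" "\<forall>i\<in>I. b i \<in> hom D (B i) (X i)"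
    and G: "{i \<in> I. sub_le D (X i) (a i) (b i)} \<in> U" (is "?G \<in> U")
  shows "sub_le D (ultra_obj D U X) (ultra_map D U A X a) (ultra_map D U B X b)"
proof (rule ultra_leI[OF a ultra_Sub[OF b]])
  have A: "\<forall>i\<in>I. A i \<in> Obj D" and B: "\<forall>i\<in>I. B i \<in> Obj D" and X: "\<forall>i\<in>I. X i \<in> Obj D"
    using a b hom_objs by blast+
  have "\<forall>i\<in>?G. \<exists>h. h \<in> hom D (A i) (B i) \<and> b i \<cdot> h = a i"
  proof
    fix i assume i: "i \<in> ?G"
    then have "Dom D (a i) = A i" "Dom D (b i) = B i" using a(2) b(2) by (auto simp: hom_def)
    moreover obtain h where "h \<in> hom D (Dom D (a i)) (Dom D (b i))" "b i \<cdot> h = a i"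
      using i by (auto elim: sub_leE)
    ultimately show "\<exists>h. h \<in> hom D (A i) (B i) \<and> b i \<cdot> h = a i" by metis
  qed
  from bchoice[OF this] obtain h where
    h: "\<forall>i\<in>?G. h i \<in> hom D (A i) (B i)" "\<forall>i\<in>?G. b i \<cdot> h i = a i" by blast
  fix J assume J: "J \<in> U"
  define J' where "J' = J \<inter> ?G"
  have J': "J' \<in> U" "J' \<subseteq> J" using U_Int[OF J G] by (auto simp: J'_def)
  have hJ: "\<forall>i\<in>J'. h i \<in> hom D (A i) (B i)" using h by (auto simp: J'_def)
  note JI = U_subset[OF J] and JI' = U_subset[OF J'(1)]
  note bJ = on_index[OF J'(1) b(2)]
  note ph = prod_map_hom[OF JI' hJ] and pb = prod_map_hom[OF JI' bJ]
    and pa = prod_map_hom[OF JI' on_index[OF J'(1) a(2)]] and pa' = prod_map_hom[OF JI on_index[OF J a(2)]]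
    and rA = prod_restrict_hom[OF JI J'(2) on_index[OF J A]] and rX = prod_restrict_hom[OF JI J'(2) on_index[OF J X]]
    and iB = ultra_inj_hom[OF B J'(1)] and iX = ultra_inj_hom[OF X J'(1)] and M = ultra_map_hom[OF b(2)]
  let ?g = "ultra_inj D U B J' \<cdot> (prod_map D J' A B h \<cdot> prod_restrict D J J' A)"
  have g: "?g \<in> hom D (prod_obj D J A) (ultra_obj D U B)" using comp_hom[OF iB comp_hom[OF ph rA]] .
  have ba: "prod_map D J' B X b \<cdot> prod_map D J' A B h = prod_map D J' A X a"
    using prod_map_comp[OF JI' hJ bJ] h(2) prod_map_cong[of J' "\<lambda>i. b i \<cdot> h i" a] by (simp add: J'_def)
  have "ultra_map D U B X b \<cdot> ?g = (ultra_inj D U X J' \<cdot> prod_map D J' B X b) \<cdot> (prod_map D J' A B h \<cdot> prod_restrict D J J' A)"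
    using assoc_hom[OF comp_hom[OF ph rA] iB M] ultra_map_inj[OF b(2) J'(1)] by simp
  also have "\<dots> = ultra_inj D U X J' \<cdot> (prod_map D J' A X a \<cdot> prod_restrict D J J' A)"
    using assoc_hom[OF comp_hom[OF ph rA] pb iX] assoc_hom[OF rA ph pb] ba by simp
  also have "\<dots> = (ultra_inj D U X J' \<cdot> prod_restrict D J J' X) \<cdot> prod_map D J A X a"
    using prod_restrict_natural[OF JI J'(2) on_index[OF J a(2)]] assoc_hom[OF pa' rX iX] by simp
  also have "\<dots> = ultra_inj D U X J \<cdot> prod_map D J A X a"
    using ultra_inj_restrict[OF X J J'] by simp
  finally show "\<exists>g\<in>hom D (prod_obj D J A) (Dom D (ultra_map D U B X b)).
      ultra_map D U B X b \<cdot> g = ultra_inj D U X J \<cdot> prod_map D J A X a"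
    using g M by (auto simp: hom_def)
qed

text \<open>Otherwise the set \<open>J\<close> of indices where the inclusion fails belongs to \<open>U\<close>, and for \<open>i \<in> J\<close> weak
  Booleanness provides a non-initial \<open>u i \<le> a i\<close> that is disjoint from \<open>b i\<close>. The intersection of the
  ultraproducts of \<open>u\<close> and \<open>b\<close> is initial, being the ultraproduct of the intersections. But the former is
  contained in the latter, so the ultraproduct of \<open>u\<close> is initial. By strictness so is the product of
  the \<open>u i\<close> over \<open>J\<close>, although its factors are not.\<close>

lemma ultra_le_imp:
  assumes a: "\<forall>i\<in>I. mono_arr D (a i)" "\<forall>i\<in>I. a i \<in> hom D (A i) (X i)"
    and b: "\<forall>i\<in>I. mono_arr D (b i)" "\<forall>i\<in>I. b i \<in> hom D (B i) (X i)"
    and le: "sub_le D (ultra_obj D U X) (ultra_map D U A X a) (ultra_map D U B X b)"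
  shows "{i \<in> I. sub_le D (X i) (a i) (b i)} \<in> U"
proof (rule ccontr)
  assume "{i \<in> I. sub_le D (X i) (a i) (b i)} \<notin> U"
  moreover define J where "J = I - {i \<in> I. sub_le D (X i) (a i) (b i)}"
  ultimately have J: "J \<in> U" using U_compl[of "{i \<in> I. sub_le D (X i) (a i) (b i)}"] by blast
  have JI: "J \<subseteq> I" and nle: "\<And>i. i \<in> J \<Longrightarrow> \<not> sub_le D (X i) (a i) (b i)" by (auto simp: J_def)
  have X: "\<forall>i\<in>I. X i \<in> Obj D" using a hom_objs by blast
  have aS: "\<And>i. i \<in> I \<Longrightarrow> a i \<in> Sub D (X i)" and bS: "\<And>i. i \<in> I \<Longrightarrow> b i \<in> Sub D (X i)"
    using a b SubI by blast+
  have "\<forall>i\<in>I. \<exists>u. sub_le D (X i) u (a i) \<and> (i \<in> J \<longrightarrow> \<not> is_initial D (Dom D u) \<and>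
      (\<exists>m. is_meet D (X i) {u, b i} m \<and> is_initial D (Dom D m)))"
  proof
    fix i assume i: "i \<in> I"
    show "\<exists>u. sub_le D (X i) u (a i) \<and> (i \<in> J \<longrightarrow> \<not> is_initial D (Dom D u) \<and>
      (\<exists>m. is_meet D (X i) {u, b i} m \<and> is_initial D (Dom D m)))"
    proof (cases "i \<in> J")
      case True
      then show ?thesis
        using weakly_Boolean X i aS[OF i] bS[OF i] nle unfolding weakly_Boolean_def by blast
    next
      case False
      \<comment> \<open>outside \<open>J\<close> the choice does not affect the ultraproduct\<close>
      then show ?thesis using sub_le_refl[OF aS[OF i]] by blast
    qed
  qed
  then obtain u where ua: "\<And>i. i \<in> I \<Longrightarrow> sub_le D (X i) (u i) (a i)"
    and ub: "\<And>i. i \<in> J \<Longrightarrow> \<not> is_initial D (Dom D (u i))"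
      "\<And>i. i \<in> J \<Longrightarrow> \<exists>m. is_meet D (X i) {u i, b i} m \<and> is_initial D (Dom D m)"
    using JI by (metis subsetD)
  let ?V = "\<lambda>i. Dom D (u i)"
  have "\<forall>i\<in>I. u i \<in> Sub D (X i)" using ua unfolding sub_le_def by blast
  then have um: "\<forall>i\<in>I. mono_arr D (u i)" and uh: "\<forall>i\<in>I. u i \<in> hom D (?V i) (X i)"
    using SubD by blast+
  have V: "\<forall>i\<in>I. ?V i \<in> Obj D" using uh hom_objs by blast
  have "\<forall>i\<in>I. \<exists>p q. is_pullback D (u i) (b i) p q" using ex_pullback uh b(2) by blast
  then obtain p q where P: "\<forall>i\<in>I. is_pullback D (u i) (b i) (p i) (q i)" by metis
  let ?R = "\<lambda>i. Dom D (p i)"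
  have ph: "\<forall>i\<in>I. p i \<in> hom D (?R i) (?V i)" and qh: "\<forall>i\<in>I. q i \<in> hom D (?R i) (B i)"
    and pq: "\<forall>i\<in>I. u i \<cdot> p i = b i \<cdot> q i"
  proof -
    have "p i \<in> hom D (?R i) (?V i) \<and> q i \<in> hom D (?R i) (B i) \<and> u i \<cdot> p i = b i \<cdot> q i" if i: "i \<in> I" for i
      using is_pullbackD(1-3)[OF bspec[OF P i] bspec[OF uh i] bspec[OF b(2) i]] by blast
    then show "\<forall>i\<in>I. p i \<in> hom D (?R i) (?V i)" "\<forall>i\<in>I. q i \<in> hom D (?R i) (B i)"
      "\<forall>i\<in>I. u i \<cdot> p i = b i \<cdot> q i" by blast+
  qed
  have R: "\<forall>i\<in>I. ?R i \<in> Obj D" using ph hom_objs by blast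
  have "\<forall>i\<in>J. is_initial D (?R i)"
  proof
    fix i assume i: "i \<in> J"
    then have iI: "i \<in> I" using JI by blast
    obtain m where m: "is_meet D (X i) {u i, b i} m" "is_initial D (Dom D m)" using ub(2)[OF i] by blast
    have uS: "u i \<in> Sub D (X i)" using ua[OF iI] unfolding sub_le_def by blast
    note uhi = bspec[OF uh iI] and phi = bspec[OF ph iI] and qhi = bspec[OF qh iI]
    have c: "u i \<cdot> p i \<in> hom D (?R i) (X i)" using comp_hom[OF uhi phi] .
    have "mono_arr D (p i)" using mono_pullback P b(1) iI by blast
    then have cS: "u i \<cdot> p i \<in> Sub D (X i)"
      using SubI[OF mono_comp[OF bspec[OF um iI] uhi _ phi] c] by blast
    have d: "Dom D (u i \<cdot> p i) = ?R i" using c by (simp add: hom_def)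
    have "Dom D (b i) = B i" using b(2) iI by (simp add: hom_def)
    then have "q i \<in> hom D (Dom D (u i \<cdot> p i)) (Dom D (b i))" using qhi d by simp
    from sub_leI[OF cS bS[OF iI] this] have "sub_le D (X i) (u i \<cdot> p i) (b i)" using bspec[OF pq iI] by simp
    moreover have "sub_le D (X i) (u i \<cdot> p i) (u i)"
      by (rule sub_leI[OF cS uS _ refl]) (simp only: d phi)
    ultimately have "sub_le D (X i) (u i \<cdot> p i) m" using m(1) cS unfolding is_meet_def by blast
    then obtain h where "h \<in> hom D (?R i) (Dom D m)" using d unfolding sub_le_def by auto
    then show "is_initial D (?R i)" using strict_initial m(2) by blast
  qed
  then have R0: "is_initial D (ultra_obj D U ?R)" using ultra_initial[OF R J] by blast
  have "{i \<in> I. sub_le D (X i) (u i) (a i)} = I" using ua by blast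
  then have "sub_le D (ultra_obj D U X) (ultra_map D U ?V X u) (ultra_map D U A X a)"
    using ultra_le[OF um uh a] U_I by simp
  then have uleb: "sub_le D (ultra_obj D U X) (ultra_map D U ?V X u) (ultra_map D U B X b)"
    using le sub_le_trans by blast
  note uM = ultra_map_hom[OF uh] and bM = ultra_map_hom[OF b(2)]
  obtain k where k: "k \<in> hom D (ultra_obj D U ?V) (ultra_obj D U B)"
      "ultra_map D U ?V X u = ultra_map D U B X b \<cdot> k"
  proof -
    obtain k where "k \<in> hom D (Dom D (ultra_map D U ?V X u)) (Dom D (ultra_map D U B X b))"
        "ultra_map D U B X b \<cdot> k = ultra_map D U ?V X u"
      using uleb by (rule sub_leE)
    moreover have "Dom D (ultra_map D U ?V X u) = ultra_obj D U ?V" "Dom D (ultra_map D U B X b) = ultra_obj D U B"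
      using uM bM by (auto simp: hom_def)
    ultimately show thesis using that by metis
  qed
  have V': "ultra_obj D U ?V \<in> Obj D" using ultra_obj[OF V] .
  note PB = ultra_pullback[OF P uh b(2) ph]
  have "ultra_map D U ?V X u \<cdot> Ident D (ultra_obj D U ?V) = ultra_map D U B X b \<cdot> k"
    using k(2) comp_ident[OF uM] by simp
  then obtain t where "t \<in> hom D (ultra_obj D U ?V) (Dom D (ultra_map D U ?R ?V p))"
    using is_pullbackD(4)[OF PB uM bM ident_hom[OF V'] k(1)] by blast
  then have "t \<in> hom D (ultra_obj D U ?V) (ultra_obj D U ?R)"
    using ultra_map_hom[OF ph] by (simp add: hom_def)
  then have "is_initial D (ultra_obj D U ?V)" using strict_initial R0 by blast
  then have "is_initial D (prod_obj D J ?V)" using strict_initial ultra_inj_hom[OF V J] by blast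
  moreover have "\<not> is_initial D (prod_obj D J ?V)"
    using prod_noninitial[OF JI on_index[OF J V]] ub(1) by blast
  ultimately show False by blast
qed

end


lemma limit_legs_cong:
  assumes "category K" "\<And>k. k \<in> Obj K \<Longrightarrow> p k = q k"
  shows "is_limit K D F l p \<longleftrightarrow> is_limit K D F l q"
proof -
  interpret category K by fact
  have "is_cone K D F l p \<longleftrightarrow> is_cone K D F l q"
    using assms(2) Dom_Obj Cod_Obj by (simp add: is_cone_def)
  then show ?thesis using assms(2) by (simp add: is_limit_def)
qed

context boolean_ultraproducts begin

text \<open>A functor from \<open>K\<close> followed by the ultraproduct of the \<open>F i\<close> is the ultraproduct of the functors
  \<open>F i\<close> composed with it, so preservation of limits by the \<open>F i\<close> can be used one index at a time.\<close>

theorem coherent_ultra_fctr: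
  assumes C: "category C" and F: "\<And>i. i \<in> I \<Longrightarrow> coherent_functor C D (F i)"
  shows "coherent_functor C D (ultra_fctr C D U F)"
proof -
  interpret C: category C by fact
  let ?F = "ultra_fctr C D U F"
  have func: "\<And>i. i \<in> I \<Longrightarrow> is_functor C D (F i)"
    and lim: "\<And>i. i \<in> I \<Longrightarrow> preserves_finite_limits C D (F i)"
    and epi: "\<And>i e. \<lbrakk>i \<in> I; effective_epi C e\<rbrakk> \<Longrightarrow> effective_epi D (FA (F i) e)"
    and un: "\<And>i x S u. \<lbrakk>i \<in> I; x \<in> Obj C; finite S; is_union C x S u\<rbrakk> \<Longrightarrow>
      is_union D (FO (F i) x) (FA (F i) ` S) (FA (F i) u)"
    using F unfolding coherent_functor_def by blast+
  have map: "FA ?F f = ultra_map D U (\<lambda>i. FO (F i) x) (\<lambda>i. FO (F i) y) (\<lambda>i. FA (F i) f)"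
    and maph: "\<forall>i\<in>I. FA (F i) f \<in> hom D (FO (F i) x) (FO (F i) y)"
    if "f \<in> hom C x y" for f x y
    using that functor_hom[OF func] by (auto simp: ultra_fctr_def hom_def)
  show ?thesis
    unfolding coherent_functor_def
  proof (intro conjI allI ballI impI)
    show "is_functor C D ?F" using functor_ultra_fctr[OF C func] .
    show "preserves_finite_limits C D ?F"
      unfolding preserves_finite_limits_def
    proof (intro allI impI, elim conjE)
      fix K :: "(nat, nat) cat" and G l p
      assume K: "finite (Arr K)" and G: "is_functor K C G" and L: "is_limit K C G l p"
      let ?H = "\<lambda>i. comp_fctr (F i) G"
      have catK: "category K" using functor_categories[OF G] by blast
      have p: "p k \<in> hom C l (FO G k)" if "k \<in> Obj K" for k
        using L that unfolding is_limit_def is_cone_def by blast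
      have H: "is_functor K D (?H i)" if "i \<in> I" for i using functor_comp_fctr[OF G func[OF that]] .
      have "is_limit K D (?H i) (FO (F i) l) (\<lambda>k. FA (F i) (p k))" if "i \<in> I" for i
        using lim[OF that] K G L unfolding preserves_finite_limits_def by blast
      from ultra_limit[OF catK K H this]
      have "is_limit K D (ultra_fctr K D U ?H) (FO ?F l)
          (\<lambda>k. ultra_map D U (\<lambda>i. FO (F i) l) (\<lambda>i. FO (?H i) k) (\<lambda>i. FA (F i) (p k)))"
        by (simp add: ultra_fctr_def)
      then have "is_limit K D (ultra_fctr K D U ?H) (FO ?F l) (\<lambda>k. FA ?F (p k))"
        by (subst limit_legs_cong[OF catK]) (simp_all add: map[OF p] comp_fctr_def)
      moreover have "FA (ultra_fctr K D U ?H) g = FA (comp_fctr ?F G) g" if "g \<in> Arr K" for g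
        using map[OF functor_hom[OF G that refl refl]] by (simp add: ultra_fctr_def comp_fctr_def)
      moreover have "FO (ultra_fctr K D U ?H) k = FO (comp_fctr ?F G) k" for k
        by (simp add: ultra_fctr_def comp_fctr_def)
      ultimately show "is_limit K D (comp_fctr ?F G) (FO ?F l) (\<lambda>k. FA ?F (p k))"
        using limit_cong[of K "ultra_fctr K D U ?H" "comp_fctr ?F G"] by simp
    qed
  next
    fix e assume e: "effective_epi C e"
    then have h: "e \<in> hom C (Dom C e) (Cod C e)" using C.pullback_homs unfolding effective_epi_def by blast
    show "effective_epi D (FA ?F e)"
      unfolding map[OF h] using ultra_effective_epi[OF _ maph[OF h]] epi e by blast
  next
    fix x S u assume x: "x \<in> Obj C" and "finite S \<and> is_union C x S u"
    then have S: "finite S" and u: "is_union C x S u" by auto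
    have sh: "s \<in> hom C (Dom C s) x" if "s \<in> S" for s
      using u that C.SubD unfolding is_union_def by blast
    have uh: "u \<in> hom C (Dom C u) x" using u C.SubD unfolding is_union_def by blast
    have "is_union D (ultra_obj D U (\<lambda>i. FO (F i) x))
        ((\<lambda>s. ultra_map D U (\<lambda>i. FO (F i) (Dom C s)) (\<lambda>i. FO (F i) x) (\<lambda>i. FA (F i) s)) ` S)
        (ultra_map D U (\<lambda>i. FO (F i) (Dom C u)) (\<lambda>i. FO (F i) x) (\<lambda>i. FA (F i) u))"
    proof (rule ultra_finite_union[OF S _ _ maph[OF uh]])
      show "\<forall>s\<in>S. \<forall>i\<in>I. FA (F i) s \<in> hom D (FO (F i) (Dom C s)) (FO (F i) x)" using maph[OF sh] by blast
      show "\<forall>i\<in>I. FO (F i) x \<in> Obj D" using functor_obj[OF func x] by blast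
      show "\<forall>i\<in>I. is_union D (FO (F i) x) ((\<lambda>s. FA (F i) s) ` S) (FA (F i) u)" using un[OF _ x S u] by blast
    qed
    then show "is_union D (FO ?F x) (FA ?F ` S) (FA ?F u)"
      using map[OF sh] map[OF uh] by (simp add: ultra_fctr_def cong: image_cong)
  qed
qed

theorem ultra_le_iff:
  assumes "\<forall>i\<in>I. a i \<in> Sub D (X i)" "\<forall>i\<in>I. b i \<in> Sub D (X i)"
  shows "sub_le D (ultra_obj D U X)
      (ultra_map D U (\<lambda>i. Dom D (a i)) X a) (ultra_map D U (\<lambda>i. Dom D (b i)) X b)
    \<longleftrightarrow> {i \<in> I. sub_le D (X i) (a i) (b i)} \<in> U"
proof -
  have a: "\<forall>i\<in>I. mono_arr D (a i)" "\<forall>i\<in>I. a i \<in> hom D (Dom D (a i)) (X i)"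
    and b: "\<forall>i\<in>I. mono_arr D (b i)" "\<forall>i\<in>I. b i \<in> hom D (Dom D (b i)) (X i)"
    using assms SubD by blast+
  show ?thesis using ultra_le[OF a b] ultra_le_imp[OF a b] by blast
qed

end


section \<open>Ultraproducts indexed by fewer than \<open>\<kappa>\<close> elements\<close>

lemma meets_distribute_reindex:
  fixes \<kappa> :: "'k rel" and h :: "'i \<Rightarrow> 'k"
  assumes D: "small_meets_distribute \<kappa> D" and h: "inj_on h J" "|h ` J| <o \<kappa>" and x: "x \<in> Obj D"
    and u: "\<forall>i\<in>J. is_union D x {a False i, a True i} (u i)" and m: "is_meet D x (u ` J) m"
    and n: "\<forall>\<epsilon>\<in>J \<rightarrow>\<^sub>E UNIV. is_meet D x ((\<lambda>i. a (\<epsilon> i) i) ` J) (n \<epsilon>)"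
  shows "is_union D x (n ` (J \<rightarrow>\<^sub>E UNIV)) m"
proof -
  let ?g = "inv_into J h"
  let ?r = "\<lambda>\<epsilon>. \<lambda>i\<in>J. \<epsilon> (h i)"
  have gh [simp]: "?g (h i) = i" if "i \<in> J" for i using h that by simp
  \<comment> \<open>a choice on \<open>h ` J\<close> must be restricted after reindexing, being arbitrary on \<open>h i\<close> for \<open>i \<notin> J\<close>\<close>
  have "\<epsilon> \<in> ?r ` (h ` J \<rightarrow>\<^sub>E UNIV)" if \<epsilon>: "\<epsilon> \<in> J \<rightarrow>\<^sub>E (UNIV :: bool set)" for \<epsilon>
  proof
    show "(\<lambda>t\<in>h ` J. \<epsilon> (?g t)) \<in> h ` J \<rightarrow>\<^sub>E UNIV" by simp
    show "\<epsilon> = ?r (\<lambda>t\<in>h ` J. \<epsilon> (?g t))" using \<epsilon> by (auto simp: fun_eq_iff PiE_def extensional_def)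
  qed
  then have surj: "?r ` (h ` J \<rightarrow>\<^sub>E UNIV) = J \<rightarrow>\<^sub>E (UNIV :: bool set)" by auto
  have "is_union D x ((\<lambda>\<epsilon>. n (?r \<epsilon>)) ` (h ` J \<rightarrow>\<^sub>E UNIV)) m"
  proof (rule D[unfolded small_meets_distribute_def, rule_format, OF x,
        of "h ` J" "\<lambda>s t. a s (?g t)" "\<lambda>t. u (?g t)"], intro conjI ballI)
    show "|h ` J| <o \<kappa>" by fact
    show "is_union D x {a False (?g t), a True (?g t)} (u (?g t))" if "t \<in> h ` J" for t
      using u that by auto
    have "(\<lambda>t. u (?g t)) ` h ` J = u ` J" by (simp add: image_image)
    then show "is_meet D x ((\<lambda>t. u (?g t)) ` h ` J) m" using m by simp
    fix \<epsilon> :: "'k \<Rightarrow> bool"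
    have "(\<lambda>t. a (\<epsilon> t) (?g t)) ` h ` J = (\<lambda>i. a (?r \<epsilon> i) i) ` J"
      by (simp add: image_image cong: image_cong)
    moreover have "is_meet D x ((\<lambda>i. a (?r \<epsilon> i) i) ` J) (n (?r \<epsilon>))"
      by (rule bspec[OF n]) (simp only: restrict_PiE_iff UNIV_I ball_simps simp_thms ball_triv)
    ultimately show "is_meet D x ((\<lambda>t. a (\<epsilon> t) (?g t)) ` h ` J) (n (?r \<epsilon>))" by simp
  qed
  then show ?thesis unfolding surj[symmetric] image_image .
qed

lemma boolean_ultraproducts_small:
  fixes \<kappa> :: "'k rel" and lam :: "'l rel"
    and D :: "('o, 'm) cat"
    and I :: "'i set" and U :: "'i set set"
  assumes \<kappa>: "Card_order \<kappa>" and lam: "Cinfinite lam"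
    and exp: "\<And>A :: 'k set. |A| <o \<kappa> \<Longrightarrow> ctwo ^c |A| <o lam"
    and D: "coherent_category D"
    and prods: "has_small_products \<kappa> D"
    and meets: "small_meets_distribute \<kappa> D"
    and epis: "small_products_preserve_effective_epis \<kappa> D"
    and noninit: "small_products_of_noninitial \<kappa> D"
    and colims: "has_filtered_colimits lam D"
    and comm: "filtered_colimits_commute_with_finite_limits lam D"
    and wB: "weakly_Boolean D"
    and I: "|I| <o \<kappa>" and U: "is_ultrafilter I U"
  shows "boolean_ultraproducts D I U"
proof -
  obtain h :: "'i \<Rightarrow> 'k" where h: "inj_on h I" and small: "\<And>J. J \<subseteq> I \<Longrightarrow> |h ` J| <o \<kappa>"
    by (rule small_index_embedding[OF \<kappa> I]) blast
  have hJ: "inj_on h J" if "J \<subseteq> I" for J using h that by (rule inj_on_subset)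
  let ?g = "inv_into I h"
  have gh [simp]: "?g (h i) = i" if "i \<in> I" for i using h that by simp
  have cardlam: "Card_order lam" using lam by blast
  have UI: "U \<subseteq> Pow I" using U unfolding is_ultrafilter_def by blast
  have J: "filtered (ultra_cat U)" "|Arr (ultra_cat U)| <o lam"
    using filtered_ultra_cat[OF U] ultra_cat_small[OF \<kappa> lam I exp UI] by auto
  interpret coherent_cat D
    using D by (simp add: coherent_cat_def coherent_cat_axioms_def coherent_category_def)
  interpret small_products D I
  proof
    fix J and x :: "'i \<Rightarrow> 'o" assume JI: "J \<subseteq> I" and x: "\<forall>i\<in>J. x i \<in> Obj D"
    have "\<forall>t\<in>h ` J. x (?g t) \<in> Obj D" using x JI by auto
    then obtain P p where "is_product D (h ` J) (\<lambda>t. x (?g t)) P p"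
      using prods[unfolded has_small_products_def, THEN spec, THEN spec,
          of "h ` J" "\<lambda>t. x (?g t)"] small[OF JI] by blast
    moreover have "?g (h i) = i" if "i \<in> J" for i using that JI by auto
    ultimately have "is_product D J x P (\<lambda>i. p (h i))"
      using product_reindex[OF hJ[OF JI], of "\<lambda>t. x (?g t)" x p "\<lambda>i. p (h i)"] by simp
    then show "\<exists>P p. is_product D J x P p" by blast
  qed
  have reindex: "is_product D (h ` J) x' (prod_obj D J x) (\<lambda>t. prod_proj D J x (?g t))"
    if JI: "J \<subseteq> I" and x: "\<forall>i\<in>J. x i \<in> Obj D" and x': "\<And>i. i \<in> J \<Longrightarrow> x' (h i) = x i" for J x x'
  proof -
    have "?g (h i) = i" if "i \<in> J" for i using that JI by auto
    then show ?thesis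
      using product_reindex[OF hJ[OF JI], of x' x "\<lambda>t. prod_proj D J x (?g t)" "prod_proj D J x"]
        prod_is_product[OF JI x] x' by simp
  qed
  show ?thesis
  proof
    show "is_ultrafilter I U" by fact
    show "\<exists>l q. is_colimit (ultra_cat U) D F l q" if "is_functor (ultra_cat U) D F" for F
      using ex_filtered_colimit[OF colims cardlam J that] .
    show "colimits_commute_with_finite_limits (ultra_cat U) D"
      using filtered_colimits_commute[OF comm cardlam J] .
    show "weakly_Boolean D" by fact
    show "effective_epi D (prod_map D J x y e)"
      if JI: "J \<subseteq> I" and e: "\<forall>i\<in>J. effective_epi D (e i)" and eh: "\<forall>i\<in>J. e i \<in> hom D (x i) (y i)"
      for J and e :: "'i \<Rightarrow> 'm" and x y
    proof -
      have x: "\<forall>i\<in>J. x i \<in> Obj D" and y: "\<forall>i\<in>J. y i \<in> Obj D" using eh hom_objs by blast+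
      have gJ: "?g (h i) = i" if "i \<in> J" for i using that JI by auto
      have "is_product D (h ` J) (\<lambda>t. Dom D (e (?g t))) (prod_obj D J x) (\<lambda>t. prod_proj D J x (?g t))"
        "is_product D (h ` J) (\<lambda>t. Cod D (e (?g t))) (prod_obj D J y) (\<lambda>t. prod_proj D J y (?g t))"
        using reindex[OF JI x] reindex[OF JI y] gJ eh by (auto simp: hom_def)
      moreover have "\<forall>t\<in>h ` J. effective_epi D (e (?g t))"
        "\<forall>t\<in>h ` J. prod_proj D J y (?g t) \<cdot>\<^bsub>D\<^esub> prod_map D J x y e = e (?g t) \<cdot>\<^bsub>D\<^esub> prod_proj D J x (?g t)"
        using e gJ prod_map_proj[OF JI eh] by auto
      ultimately show ?thesis
        using epis[unfolded small_products_preserve_effective_epis_def, rule_format,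
            of "h ` J" "\<lambda>t. e (?g t)" "prod_obj D J x" "\<lambda>t. prod_proj D J x (?g t)"
              "prod_obj D J y" "\<lambda>t. prod_proj D J y (?g t)" "prod_map D J x y e"]
          small[OF JI] prod_map_hom[OF JI eh] by blast
    qed
    show "\<not> is_initial D (prod_obj D J x)"
      if JI: "J \<subseteq> I" and x: "\<forall>i\<in>J. x i \<in> Obj D" "\<forall>i\<in>J. \<not> is_initial D (x i)" for J x
    proof -
      have gJ: "?g (h i) = i" if "i \<in> J" for i using that JI by auto
      have "is_product D (h ` J) (\<lambda>t. x (?g t)) (prod_obj D J x) (\<lambda>t. prod_proj D J x (?g t))"
        using reindex[OF JI x(1)] gJ by simp
      moreover have "\<forall>t\<in>h ` J. \<not> is_initial D (x (?g t))" using x(2) gJ by auto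
      ultimately show ?thesis
        using noninit[unfolded small_products_of_noninitial_def, rule_format,
            of "h ` J" "\<lambda>t. x (?g t)"] small[OF JI] by blast
    qed
    show "is_union D P (n ` (J \<rightarrow>\<^sub>E UNIV)) m"
      if "J \<subseteq> I" "P \<in> Obj D" "\<forall>i\<in>J. is_union D P {a False i, a True i} (u i)"
        "is_meet D P (u ` J) m" "\<forall>\<epsilon>\<in>J \<rightarrow>\<^sub>E UNIV. is_meet D P ((\<lambda>i. a (\<epsilon> i) i) ` J) (n \<epsilon>)"
      for J P and a :: "bool \<Rightarrow> 'i \<Rightarrow> 'm" and u m n
      using meets_distribute_reindex[OF meets hJ[OF that(1)] small[OF that(1)] that(2-5)] .
  qed
qed

theorem theorem5p2:
  fixes \<kappa> :: "'k rel" and lam :: "'l rel"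
    and D :: "('o, 'm) cat"
    and I :: "'i set" and U :: "'i set set"
  assumes "Cinfinite \<kappa>" and "regularCard \<kappa>"
    and "Cinfinite lam" and "regularCard lam"
    and "\<And>A :: 'k set. |A| <o \<kappa> \<Longrightarrow> ctwo ^c |A| <o lam"
    and "geometric_category lam D"
    and "has_small_products \<kappa> D"
    and "small_meets_distribute \<kappa> D"
    and "small_products_preserve_effective_epis \<kappa> D"
    and "small_products_of_noninitial \<kappa> D"
    and "has_filtered_colimits lam D"
    and "filtered_colimits_commute_with_finite_limits lam D"
    and "weakly_Boolean D"
    and "|I| <o \<kappa>" and "is_ultrafilter I U"
  shows "(\<forall>(C :: ('c, 'd) cat) F. coherent_category C \<and> (\<forall>i\<in>I. coherent_functor C D (F i)) \<longrightarrow>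
            coherent_functor C D (ultra_fctr C D U F)) \<and>
         (\<forall>X a b. (\<forall>i\<in>I. X i \<in> Obj D \<and> a i \<in> Sub D (X i) \<and> b i \<in> Sub D (X i)) \<longrightarrow>
            (sub_le D (ultra_obj D U X)
               (ultra_map D U (\<lambda>i. Dom D (a i)) X a) (ultra_map D U (\<lambda>i. Dom D (b i)) X b)
             \<longleftrightarrow> {i \<in> I. sub_le D (X i) (a i) (b i)} \<in> U))"
proof -
  have "Card_order \<kappa>" using assms(1) by blast
  moreover have "coherent_category D" using assms(6) by (simp add: geometric_category_def)
  ultimately interpret boolean_ultraproducts D I U
    using assms by (intro boolean_ultraproducts_small[where \<kappa> = \<kappa> and lam = lam])
  have "category C" if "coherent_category C" for C :: "('c, 'd) cat"
    using that by (simp add: coherent_category_def)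
  then show ?thesis using coherent_ultra_fctr ultra_le_iff by blast
qed

end
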